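(* Let $X$ be a compact or discrete abelian group with Haar measure $\alpha$, and $\hat X$ its dual with Haar measure $\hat\alpha$ normalized so that the Plancherel identity holds (as in the context). Let $\psi\in L^2(X)$ with $\|\psi\|_2=1$. Then for all $p,q\in(0,\infty)$ with $\frac1p+\frac1q\ge1$, $$h_{p/2}(|\psi|^2)+h_{q/2}(|\hat\psi|^2)\ge 0,$$ whenever the left-hand side is well defined in $[-\infty,\infty]$. This bound is sharp: equality holds for $\psi=\gamma/\sqrt{\alpha(X)}$ with any $\gamma\in\hat X$ if $X$ is compact, and for $\psi=\mathbb 1_{\{x_0\}}/\sqrt{\alpha(\{x_0\})}$ with any $x_0\in X$ if $X$ is discrete.
   Context: $\hat X$ is the group of continuous homomorphisms $X\to\mathbb T$; $\hat f(\gamma)=\int_X f(x)\overline{\gamma(x)}\alpha(dx)$, extended to $L^2$ by Plancherel. If $X$ is compact, $\hat\alpha$ gives mass $\alpha(X)^{-1}$ to each point of $\hat X$; if $X$ is discrete, $\alpha$ gives mass $c>0$ to each point and $\hat\alpha(\hat X)=1/c$. For a probability density $f$ (nonnegative, integral $1$ against Haar measure $\mu$), the Rényi entropy of order $s\in(0,1)\cup(1,\infty)$ is $h_s(f)=\frac1{1-s}\log\int f^s d\mu$, and $h_1(f)=-\int f\log f\,d\mu$ (Shannon entropy). *)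

theory Defs
  imports "HOL-Analysis.Analysis"
begin

text \<open>Dual group: continuous homomorphisms from the (additive, abelian) group 'a into the unit circle T.
  It lives inside the function space 'a => complex, whose topology (from HOL-Analysis) is the
  product topology (= compact-open topology when 'a is discrete).\<close>
definition dual_group :: "('a::{plus,topological_space} \<Rightarrow> complex) set" where
  "dual_group = {\<gamma>. continuous_on UNIV \<gamma> \<and> (\<forall>x y. \<gamma> (x + y) = \<gamma> x * \<gamma> y)
                      \<and> (\<forall>x. cmod (\<gamma> x) = 1)}"

definition is_haar :: "'g::topological_space set \<Rightarrow> ('g \<Rightarrow> 'g \<Rightarrow> 'g) \<Rightarrow> 'g measure \<Rightarrow> bool" where
  "is_haar S gop M \<longleftrightarrow>
     space M = S \<and> sets M = sets (restrict_space borel S) \<and>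
     (\<forall>x\<in>S. \<forall>A\<in>sets M. gop x ` A \<in> sets M \<and> emeasure M (gop x ` A) = emeasure M A) \<and>
     (\<forall>K. compact K \<and> K \<subseteq> S \<longrightarrow> emeasure M K < \<infinity>) \<and>
     (\<forall>A\<in>sets M. emeasure M A = (INF U\<in>{U. openin (top_of_set S) U \<and> A \<subseteq> U}. emeasure M U)) \<and>
     (\<forall>U. openin (top_of_set S) U \<longrightarrow> emeasure M U = (SUP K\<in>{K. compact K \<and> K \<subseteq> U}. emeasure M K)) \<and>
     emeasure M S \<noteq> 0"

definition compact_setting :: "'a::{ab_group_add,topological_space} measure \<Rightarrow> ('a \<Rightarrow> complex) measure \<Rightarrow> bool" where
  "compact_setting \<alpha> \<alpha>h \<longleftrightarrow> compact (UNIV :: 'a set) \<and> is_haar UNIV (+) \<alpha> \<and>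
     \<alpha>h = scale_measure (inverse (emeasure \<alpha> UNIV)) (count_space dual_group)"

definition discrete_setting :: "'a::{ab_group_add,topological_space} measure \<Rightarrow> ('a \<Rightarrow> complex) measure \<Rightarrow> bool" where
  "discrete_setting \<alpha> \<alpha>h \<longleftrightarrow> (\<forall>x::'a. open {x}) \<and>
     (\<exists>c>0. \<alpha> = scale_measure (ennreal c) (count_space UNIV) \<and>
            is_haar dual_group (\<lambda>g1 g2 x. g1 x * g2 x) \<alpha>h \<and> emeasure \<alpha>h dual_group = ennreal (1 / c))"

definition L2 :: "'b measure \<Rightarrow> ('b \<Rightarrow> complex) \<Rightarrow> bool" where
  "L2 M f \<longleftrightarrow> f \<in> borel_measurable M \<and> integrable M (\<lambda>x. (cmod (f x))^2)"

definition fourier_L1 :: "'a measure \<Rightarrow> ('a \<Rightarrow> complex) \<Rightarrow> ('a \<Rightarrow> complex) \<Rightarrow> complex" where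
  "fourier_L1 \<alpha> f \<gamma> = (LINT x|\<alpha>. f x * cnj (\<gamma> x))"

text \<open>Psi is (a representative of) the Fourier transform of psi in L^2, obtained by extending the
  L^1 Fourier transform from L^1 \<inter> L^2 by continuity (Plancherel).\<close>
definition is_fourier_L2 :: "'a measure \<Rightarrow> ('a \<Rightarrow> complex) measure \<Rightarrow> ('a \<Rightarrow> complex) \<Rightarrow> (('a \<Rightarrow> complex) \<Rightarrow> complex) \<Rightarrow> bool" where
  "is_fourier_L2 \<alpha> \<alpha>h \<psi> \<Psi> \<longleftrightarrow> L2 \<alpha>h \<Psi> \<and>
     (\<forall>fs. (\<forall>n. integrable \<alpha> (fs n) \<and> L2 \<alpha> (fs n)) \<and>
           (\<lambda>n. \<integral>\<^sup>+x. ennreal ((cmod (fs n x - \<psi> x))^2) \<partial>\<alpha>) \<longlonglongrightarrow> 0 \<longrightarrow>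
           (\<lambda>n. \<integral>\<^sup>+\<gamma>. ennreal ((cmod (fourier_L1 \<alpha> (fs n) \<gamma> - \<Psi> \<gamma>))^2) \<partial>\<alpha>h) \<longlonglongrightarrow> 0)"

definition shannon_pos :: "'b measure \<Rightarrow> ('b \<Rightarrow> real) \<Rightarrow> ereal" where
  "shannon_pos M f = enn2ereal (\<integral>\<^sup>+x. ennreal (- (f x * ln (f x))) \<partial>M)"
definition shannon_neg :: "'b measure \<Rightarrow> ('b \<Rightarrow> real) \<Rightarrow> ereal" where
  "shannon_neg M f = enn2ereal (\<integral>\<^sup>+x. ennreal (f x * ln (f x)) \<partial>M)"

definition renyi_entropy :: "'b measure \<Rightarrow> ('b \<Rightarrow> real) \<Rightarrow> real \<Rightarrow> ereal" where
  "renyi_entropy M f s =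
     (if s = 1 then shannon_pos M f - shannon_neg M f
      else (let I = (\<integral>\<^sup>+x. ennreal (f x powr s) \<partial>M) in
            if I = \<infinity> then (if s < 1 then \<infinity> else - \<infinity>)
            else if I = 0 then (if s < 1 then - \<infinity> else \<infinity>)
            else ereal (ln (enn2real I) / (1 - s))))"

definition entropy_defined :: "'b measure \<Rightarrow> ('b \<Rightarrow> real) \<Rightarrow> real \<Rightarrow> bool" where
  "entropy_defined M f s \<longleftrightarrow> s \<noteq> 1 \<or> \<not> (shannon_pos M f = \<infinity> \<and> shannon_neg M f = \<infinity>)"

definition lhs_defined :: "'a measure \<Rightarrow> 'c measure \<Rightarrow> ('a \<Rightarrow> complex) \<Rightarrow> ('c \<Rightarrow> complex) \<Rightarrow> real \<Rightarrow> real \<Rightarrow> bool" where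
  "lhs_defined \<alpha> \<alpha>h \<psi> \<Psi> p q \<longleftrightarrow>
     entropy_defined \<alpha> (\<lambda>x. (cmod (\<psi> x))^2) (p/2) \<and>
     entropy_defined \<alpha>h (\<lambda>\<gamma>. (cmod (\<Psi> \<gamma>))^2) (q/2) \<and>
     \<not> (renyi_entropy \<alpha> (\<lambda>x. (cmod (\<psi> x))^2) (p/2) = \<infinity> \<and> renyi_entropy \<alpha>h (\<lambda>\<gamma>. (cmod (\<Psi> \<gamma>))^2) (q/2) = - \<infinity>) \<and>
     \<not> (renyi_entropy \<alpha> (\<lambda>x. (cmod (\<psi> x))^2) (p/2) = - \<infinity> \<and> renyi_entropy \<alpha>h (\<lambda>\<gamma>. (cmod (\<Psi> \<gamma>))^2) (q/2) = \<infinity>)"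

definition uncertainty_lhs :: "'a measure \<Rightarrow> 'c measure \<Rightarrow> ('a \<Rightarrow> complex) \<Rightarrow> ('c \<Rightarrow> complex) \<Rightarrow> real \<Rightarrow> real \<Rightarrow> ereal" where
  "uncertainty_lhs \<alpha> \<alpha>h \<psi> \<Psi> p q =
     renyi_entropy \<alpha> (\<lambda>x. (cmod (\<psi> x))^2) (p/2) + renyi_entropy \<alpha>h (\<lambda>\<gamma>. (cmod (\<Psi> \<gamma>))^2) (q/2)"

end

theory Submission
  imports Defs "HOL-Real_Asymp.Real_Asymp" "HOL-Complex_Analysis.Complex_Analysis"
begin

text \<open>Both settings are instances of one situation: a finite measure space of mass \<open>A\<close> with an orthogonal
  system of unimodular functions, and the index set with mass \<open>1 / A\<close> at each point. The Hausdorff--Young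
  inequality holds in both directions between a function and its coefficients by Riesz--Thorin
  interpolation (three lines theorem), with constant \<open>1\<close>. Its logarithm is the entropy inequality for conjugate
  exponents, the limit \<open>p \<rightarrow> 2\<close> gives the Shannon case, and monotonicity of the Renyi entropy in its order
  gives the remaining exponents.

  The direction from coefficients to functions needs Parseval's identity. In the discrete setting it
  comes from orthogonality of the evaluations, i.e. from the extension of characters of
  subgroups. In the compact setting it is the completeness of the characters: a positive definite convolution
  operator has an idempotent spectral projection, obtained by the power method, and an idempotent of
  minimal trace is a multiple of a character. Hence characters separate points, and Stone--Weierstrass
  applies.\<close>

section \<open>Renyi and Shannon entropies\<close>

text \<open>The interpolation constant is exactly \<open>1\<close> because both endpoint bounds are:
  unimodularity gives the bound from L^1 to the supremum, orthogonality the one on L^2, and the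
  point mass \<open>1 / A\<close> absorbs the normalization. For the entropies the two sides are not
  symmetric, and this shapes the case analysis. On the side of finite mass every power mass of order
  between \<open>0\<close> and \<open>1\<close> is finite; on the index side the atoms bound the
  density, so the negative part of the Shannon integral is finite. The remaining conflicts of
  infinite values are excluded by \<open>lhs_defined\<close>. A second obstacle is the hypothesis on
  the transform: \<open>is_fourier_L2\<close> only speaks of L^2 limits. If the group is compact,
  L^2 lies in L^1 and the limit can be evaluated at once. If it is discrete, the dual takes the role
  of the finite measure space, and both the inversion formula and the norm identity have to be
  extracted from limits of finite partial sums before Parseval's identity is at hand.\<close>

definition unit_density :: "'b measure \<Rightarrow> ('b \<Rightarrow> real) \<Rightarrow> bool" where
  "unit_density M f \<longleftrightarrow> f \<in> borel_measurable M \<and> (\<forall>x. 0 \<le> f x) \<and> (\<integral>\<^sup>+x. ennreal (f x) \<partial>M) = 1"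

definition power_mass :: "'b measure \<Rightarrow> ('b \<Rightarrow> real) \<Rightarrow> real \<Rightarrow> ennreal" where
  "power_mass M f s = (\<integral>\<^sup>+x. ennreal (f x powr s) \<partial>M)"

lemma unit_densityD:
  assumes "unit_density M f"
  shows "f \<in> borel_measurable M" "0 \<le> f x" "integrable M f" "(LINT x|M. f x) = 1"
    "(\<integral>\<^sup>+x. ennreal (f x) \<partial>M) = 1"
proof -
  show 1: "f \<in> borel_measurable M" "\<And>x. 0 \<le> f x" and 2: "(\<integral>\<^sup>+x. ennreal (f x) \<partial>M) = 1"
    using assms by (auto simp: unit_density_def)
  show "integrable M f"
    by (rule integrableI_nonneg) (use 1 2 in auto)
  show "(LINT x|M. f x) = 1"
    by (subst integral_eq_nn_integral) (use 1 2 in auto)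
qed

lemma power_mass_nonzero:
  assumes "unit_density M f"
  shows "power_mass M f s \<noteq> 0"
proof
  note f = unit_densityD[OF assms]
  assume "power_mass M f s = 0"
  then have "AE x in M. ennreal (f x powr s) = 0"
    unfolding power_mass_def using f(1) by (subst (asm) nn_integral_0_iff_AE) auto
  then have "AE x in M. ennreal (f x) = 0"
    by eventually_elim (auto simp: ennreal_eq_0_iff powr_nonneg_iff)
  then have "(\<integral>\<^sup>+x. ennreal (f x) \<partial>M) = 0"
    using f(1) by (subst nn_integral_0_iff_AE) auto
  with f(5) show False by simp
qed

lemma renyi_real:
  assumes "unit_density M f" "power_mass M f s < \<infinity>" "s \<noteq> 1"
  obtains I where "0 < I" "power_mass M f s = ennreal I" "integrable M (\<lambda>x. f x powr s)"
    "(LINT x|M. f x powr s) = I" "renyi_entropy M f s = ereal (ln I / (1 - s))"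
proof -
  note f = unit_densityD[OF assms(1)]
  define I where "I = enn2real (power_mass M f s)"
  have I: "power_mass M f s = ennreal I" using assms(2) by (simp add: I_def)
  have "I \<noteq> 0" using power_mass_nonzero[OF assms(1), of s] I by auto
  then have pos: "0 < I" by (simp add: I_def order_less_le)
  have meas: "(\<lambda>x. f x powr s) \<in> borel_measurable M" using f(1) by measurable
  have int: "integrable M (\<lambda>x. f x powr s)"
    by (rule integrableI_nonneg) (use meas assms(2) in \<open>auto simp: power_mass_def\<close>)
  have val: "(LINT x|M. f x powr s) = I"
    by (subst integral_eq_nn_integral) (use meas I in \<open>auto simp: power_mass_def I_def\<close>)
  have "renyi_entropy M f s = ereal (ln I / (1 - s))"
    using assms(3) I pos by (simp add: renyi_entropy_def Let_def power_mass_def)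
  with pos I int val show thesis by (rule that)
qed

lemma renyi_infinite:
  assumes "s < 1" "power_mass M f s = \<infinity>"
  shows "renyi_entropy M f s = \<infinity>"
  using assms by (auto simp: renyi_entropy_def power_mass_def Let_def)

text \<open>Both parts are weighted arithmetic-geometric means. For \<open>r \<le> 0\<close> the
  numbers \<open>z powr r\<close> and \<open>z\<close> receive the weights \<open>1/(1-r)\<close>
  and \<open>-r/(1-r)\<close>, for which their weighted geometric mean is \<open>1\<close>.\<close>

lemma bernoulli_powr:
  fixes z r :: real
  assumes z: "0 < z"
  shows "r \<le> 0 \<Longrightarrow> 1 + r * (z - 1) \<le> z powr r" "0 \<le> r \<Longrightarrow> r \<le> 1 \<Longrightarrow> z powr r \<le> 1 + r * (z - 1)"
proof -
  assume r: "r \<le> 0"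
  have "1 - r > 0" using r by simp
  have "1 = (z powr r) powr (1/(1-r)) * z powr (-r/(1-r))"
    using r z by (simp add: powr_powr powr_add[symmetric] diff_divide_distrib[symmetric] add_divide_distrib[symmetric])
  also have "\<dots> \<le> (1/(1-r)) * z powr r + (-r/(1-r)) * z"
    using Youngs_inequality_0[of "1/(1-r)" "-r/(1-r)" "z powr r" z] r z
    by (simp add: field_simps)
  also have "\<dots> = (z powr r - r * z) / (1 - r)" by (simp add: diff_divide_distrib)
  finally have "(1 - r) * 1 \<le> z powr r - r * z" using \<open>1 - r > 0\<close> by (simp add: pos_le_divide_eq mult.commute)
  then show "1 + r * (z - 1) \<le> z powr r" by (simp add: algebra_simps)
next
  assume r: "0 \<le> r" "r \<le> 1"
  show "z powr r \<le> 1 + r * (z - 1)"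
    using Youngs_inequality_0[of r "1-r" z 1] r z by (simp add: algebra_simps)
qed

lemma powr_shift:
  fixes y :: real assumes "0 \<le> y" shows "y * y powr (s - 1) = y powr s"
  using assms by (cases "y = 0") (auto simp: powr_diff)

text \<open>Jensen's inequality for the probability measure with density \<open>f\<close>, in
  tangent-line form. The function \<open>z = f powr (s - 1) / I\<close> has mean \<open>1\<close>,
  and \<open>f powr t = I powr r * f * z powr r\<close> where \<open>f > 0\<close>; Bernoulli's
  inequality bounds \<open>z powr r\<close> from above for \<open>t < 1\<close> and from below for
  \<open>t > 1\<close>. The pointwise form also yields the finiteness claim.\<close>

lemma renyi_mono:
  assumes f: "unit_density M f" and st: "s < t" "s < 1" "t \<noteq> 1" and fin: "power_mass M f s < \<infinity>"
  shows "renyi_entropy M f t \<le> renyi_entropy M f s" "t < 1 \<Longrightarrow> power_mass M f t < \<infinity>"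
proof -
  note F = unit_densityD[OF f]
  obtain I where I: "0 < I" "integrable M (\<lambda>x. f x powr s)" "(LINT x|M. f x powr s) = I"
    "renyi_entropy M f s = ereal (ln I / (1 - s))"
    by (rule renyi_real[OF f fin]) (use st in auto)
  define r where "r = (1 - t) / (1 - s)"
  \<comment> \<open>This is \<open>I powr r * f\<close> times the tangent of \<open>z powr r\<close>
    at \<open>z = 1\<close>, multiplied out so that it vanishes where \<open>f = 0\<close>; since
    \<open>z\<close> has mean \<open>1\<close>, its integral is \<open>I powr r\<close>.\<close>
  define u where "u = (\<lambda>x. I powr r * (f x + r * (f x powr s / I - f x)))"
  have intu: "integrable M u" unfolding u_def using F(3) I(2) by auto
  have valu: "(LINT x|M. u x) = I powr r"
    unfolding u_def using F(3,4) I by (simp add: field_simps)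
  have key: "u x = I powr r * (f x * (1 + r * (f x powr (s - 1) / I - 1)))" for x
  proof -
    have "f x powr s / I = f x * (f x powr (s - 1) / I)"
      using powr_shift[of "f x" s] F(2)[of x] by simp
    then show ?thesis unfolding u_def by (simp only: algebra_simps)
  qed
  have key2: "f x powr t = I powr r * (f x * (f x powr (s - 1) / I) powr r)" if "f x > 0" for x
  proof -
    have "(s - 1) * r = t - 1" using st by (simp add: r_def field_simps)
    then have "(f x powr (s - 1) / I) powr r = f x powr (t - 1) / I powr r"
      using that I(1) by (simp add: powr_divide powr_powr)
    then show ?thesis
      using that I(1) powr_shift[of "f x" t] by simp
  qed
  have upper: "f x powr t \<le> u x" if t: "t < 1" for x
  proof (cases "f x = 0")
    case False
    then have p: "f x > 0" using F(2)[of x] by simp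
    then have "f x powr (s - 1) / I > 0" using I(1) by simp
    moreover have "0 \<le> r" "r \<le> 1" using st t by (auto simp: r_def field_simps)
    ultimately have "(f x powr (s - 1) / I) powr r \<le> 1 + r * (f x powr (s - 1) / I - 1)"
      by (rule bernoulli_powr(2))
    then show ?thesis
      unfolding key[of x] key2[OF p] using p I(1) by (intro mult_left_mono) auto
  qed (auto simp: u_def)
  show small: "power_mass M f t < \<infinity>" if t: "t < 1"
  proof -
    have "power_mass M f t \<le> (\<integral>\<^sup>+x. ennreal (u x) \<partial>M)"
      unfolding power_mass_def by (intro nn_integral_mono ennreal_leI upper t)
    also have "\<dots> < \<infinity>" using intu by (simp add: real_integrable_def less_top)
    finally show ?thesis .
  qed
  show "renyi_entropy M f t \<le> renyi_entropy M f s"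
  proof (cases "power_mass M f t < \<infinity>")
    case False
    \<comment> \<open>An infinite mass can occur only for orders above \<open>1\<close>, where the
      entropy is \<open>- \<infinity>\<close> by convention.\<close>
    then have "t > 1" using small st by force
    with False show ?thesis
      by (auto simp: renyi_entropy_def Let_def power_mass_def not_less top_unique)
  next
    case True
    obtain J where J: "0 < J" "integrable M (\<lambda>x. f x powr t)" "(LINT x|M. f x powr t) = J"
      "renyi_entropy M f t = ereal (ln J / (1 - t))"
      by (rule renyi_real[OF f True]) (use st in auto)
    have "ln J / (1 - t) \<le> ln I / (1 - s)"
    proof (cases "t < 1")
      case True
      have "J \<le> I powr r"
        using integral_mono[OF J(2) intu upper[OF True]] J(3) valu by simp
      then have "ln J \<le> ln (I powr r)" using J(1) I(1) by (subst ln_le_cancel_iff) auto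
      then have "ln J \<le> r * ln I" using I(1) by (simp add: ln_powr)
      then have "ln J / (1 - t) \<le> r * ln I / (1 - t)" using True by (simp add: divide_right_mono)
      also have "\<dots> = ln I / (1 - s)" unfolding r_def using st True by simp
      finally show ?thesis .
    next
      case False
      then have t: "t > 1" using st by simp
      have r: "r \<le> 0" using st t by (auto simp: r_def divide_simps)
      have "u x \<le> f x powr t" for x
      proof (cases "f x = 0")
        case False
        then have p: "f x > 0" using F(2)[of x] by simp
        then have "f x powr (s - 1) / I > 0" using I(1) by simp
        from bernoulli_powr(1)[OF this r] show ?thesis
          unfolding key[of x] key2[OF p] using p I(1) by (intro mult_left_mono) auto
      qed (auto simp: u_def)
      then have "I powr r \<le> J"
        using integral_mono[OF intu J(2)] J(3) valu by auto
      then have "ln (I powr r) \<le> ln J" using J(1) I(1) by (subst ln_le_cancel_iff) auto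
      then have "r * ln I \<le> ln J" using I(1) by (simp add: ln_powr)
      then have "ln J / (1 - t) \<le> r * ln I / (1 - t)" using t by (simp add: divide_right_mono_neg)
      also have "\<dots> = ln I / (1 - s)" unfolding r_def using st t by simp
      finally show ?thesis .
    qed
    then show ?thesis using I(4) J(4) by simp
  qed
qed

text \<open>The integrand \<open>f * ln f\<close> need not be integrable, so the bound cannot be
  integrated directly. It is rearranged pointwise into an inequality between sums of positive parts,
  which holds in the extended nonnegative reals even if \<open>shannon_neg\<close> is
  infinite.\<close>

lemma shannon_le_integral:
  assumes f: "f \<in> borel_measurable M" and u: "integrable M u" and le: "\<And>x. - (f x * ln (f x)) \<le> u x"
  shows "shannon_pos M f < \<infinity>" "shannon_pos M f - shannon_neg M f \<le> ereal (LINT x|M. u x)"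
proof -
  let ?P = "\<integral>\<^sup>+x. ennreal (- (f x * ln (f x))) \<partial>M" and ?N = "\<integral>\<^sup>+x. ennreal (f x * ln (f x)) \<partial>M"
  let ?U = "\<integral>\<^sup>+x. ennreal (u x) \<partial>M" and ?V = "\<integral>\<^sup>+x. ennreal (- u x) \<partial>M"
  have fin: "?U \<noteq> \<infinity>" "?V \<noteq> \<infinity>" using u by (auto simp: real_integrable_def)
  have [measurable]: "u \<in> borel_measurable M" "f \<in> borel_measurable M" using u f by auto
  have "?P \<le> ?U" by (intro nn_integral_mono ennreal_leI le)
  then have Pfin: "?P \<noteq> \<infinity>" using fin by (auto simp: top_unique)
  then show "shannon_pos M f < \<infinity>"
    by (cases ?P) (auto simp: shannon_pos_def)
  have "?P + ?V = (\<integral>\<^sup>+x. ennreal (- (f x * ln (f x))) + ennreal (- u x) \<partial>M)"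
    by (rule nn_integral_add[symmetric]) measurable
  also have "\<dots> \<le> (\<integral>\<^sup>+x. ennreal (u x) + ennreal (f x * ln (f x)) \<partial>M)"
  proof (intro nn_integral_mono)
    fix x
    have "max 0 (- (f x * ln (f x))) + max 0 (- u x) \<le> max 0 (u x) + max 0 (f x * ln (f x))"
      using le[of x] by (auto simp: max_def)
    then have "ennreal (max 0 (- (f x * ln (f x))) + max 0 (- u x)) \<le> ennreal (max 0 (u x) + max 0 (f x * ln (f x)))"
      by (rule ennreal_leI)
    then show "ennreal (- (f x * ln (f x))) + ennreal (- u x) \<le> ennreal (u x) + ennreal (f x * ln (f x))"
      by (simp add: ennreal_max_0)
  qed
  also have "\<dots> = ?U + ?N"
    by (rule nn_integral_add) measurable
  finally have main: "?P + ?V \<le> ?U + ?N" .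
  obtain a b c where abc: "?P = ennreal a" "0 \<le> a" "?U = ennreal b" "0 \<le> b" "?V = ennreal c" "0 \<le> c"
    using Pfin fin by (cases ?P; cases ?U; cases ?V) auto
  have int: "(LINT x|M. u x) = b - c"
    using u by (subst real_lebesgue_integral_def) (auto simp: abc)
  show "shannon_pos M f - shannon_neg M f \<le> ereal (LINT x|M. u x)"
  proof (cases "?N = \<infinity>")
    case True
    then show ?thesis using abc by (simp add: shannon_pos_def shannon_neg_def)
  next
    case False
    then obtain d where d: "?N = ennreal d" "0 \<le> d" by (cases ?N) auto
    have "a + c \<le> b + d" using main abc d by (simp flip: ennreal_plus)
    then show ?thesis using abc d int by (simp add: shannon_pos_def shannon_neg_def)
  qed
qed

text \<open>The tangent argument of \<open>renyi_mono\<close> at order \<open>1\<close>: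
  \<open>ln z \<le> z - 1\<close> with the same \<open>z\<close>, multiplied by \<open>f\<close> and
  divided by \<open>1 - s\<close>. Finiteness of the positive part is recorded because it decides
  which infinities the Shannon difference can produce.\<close>

lemma shannon_le_renyi:
  assumes f: "unit_density M f" and s: "s < 1" and fin: "power_mass M f s < \<infinity>"
  shows "shannon_pos M f < \<infinity>" "renyi_entropy M f 1 \<le> renyi_entropy M f s"
proof -
  note F = unit_densityD[OF f]
  obtain I where I: "0 < I" "integrable M (\<lambda>x. f x powr s)" "(LINT x|M. f x powr s) = I"
    "renyi_entropy M f s = ereal (ln I / (1 - s))"
    by (rule renyi_real[OF f fin]) (use s in auto)
  define u where "u = (\<lambda>x. (f x * ln I + (f x powr s / I - f x)) / (1 - s))"
  have intu: "integrable M u" unfolding u_def using F(3) I(2) by auto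
  have valu: "(LINT x|M. u x) = ln I / (1 - s)"
    unfolding u_def using F(3,4) I by simp
  have le: "- (f x * ln (f x)) \<le> u x" for x
  proof (cases "f x = 0")
    case False
    then have p: "f x > 0" using F(2)[of x] by simp
    let ?z = "f x powr (s - 1) / I"
    have "ln ?z \<le> ?z - 1" using p I(1) by (intro ln_le_minus_one) auto
    then have "(s - 1) * ln (f x) - ln I \<le> ?z - 1" using p I(1) by (simp add: ln_div ln_powr)
    then have "f x * ((s - 1) * ln (f x) - ln I) \<le> f x * (?z - 1)" using p by (intro mult_left_mono) auto
    also have "\<dots> = f x powr s / I - f x" using powr_shift[of "f x" s] p by (simp add: algebra_simps)
    finally have "- (f x * ln (f x)) * (1 - s) \<le> f x * ln I + (f x powr s / I - f x)"
      by (simp add: algebra_simps)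
    then show ?thesis unfolding u_def using s by (subst pos_le_divide_eq) auto
  qed (auto simp: u_def)
  show "shannon_pos M f < \<infinity>" by (rule shannon_le_integral(1)[OF F(1) intu le])
  show "renyi_entropy M f 1 \<le> renyi_entropy M f s"
    using shannon_le_integral(2)[OF F(1) intu le] I(4) valu by (simp add: renyi_entropy_def)
qed

text \<open>Source of the equality cases: a density that is uniform on a set has the same entropy
  for all orders. The hypothesis is almost everywhere because a transform is only determined up to
  null sets.\<close>

lemma renyi_const:
  assumes B: "B \<in> sets M" "emeasure M B = ennreal (1 / k)" and k: "0 < k"
    and f: "AE x in M. f x = (if x \<in> B then k else 0)"
  shows "renyi_entropy M f s = ereal (- ln k)" "entropy_defined M f s"
proof -
  have int: "(\<integral>\<^sup>+x. ennreal (h (f x)) \<partial>M) = ennreal (h k) * ennreal (1 / k)" if "h 0 = 0" for h :: "real \<Rightarrow> real"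
  proof -
    have "(\<integral>\<^sup>+x. ennreal (h (f x)) \<partial>M) = (\<integral>\<^sup>+x. ennreal (h k) * indicator B x \<partial>M)"
      by (rule nn_integral_cong_AE) (use f in eventually_elim, auto simp: that)
    then show ?thesis using B by (simp add: nn_integral_cmult_indicator)
  qed
  have pos: "shannon_pos M f = ereal (max 0 (- ln k))" 
    using int[of "\<lambda>y. - (y * ln y)"] k unfolding shannon_pos_def
    by (cases "ln k \<le> 0") (auto simp: ennreal_mult'[symmetric] mult_nonneg_nonpos ennreal_neg max_def zero_ennreal.rep_eq zero_ereal_def)
  have neg: "shannon_neg M f = ereal (max 0 (ln k))" 
    using int[of "\<lambda>y. y * ln y"] k unfolding shannon_neg_def
    by (cases "ln k \<ge> 0") (auto simp: ennreal_mult'[symmetric] mult_nonneg_nonpos ennreal_neg max_def zero_ennreal.rep_eq zero_ereal_def)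
  show "entropy_defined M f s" using pos by (simp add: entropy_defined_def max_def)
  have ren: "(\<integral>\<^sup>+x. ennreal (f x powr s) \<partial>M) = ennreal (k powr (s - 1))" 
    using int[of "\<lambda>y. y powr s"] k by (simp add: ennreal_mult'[symmetric] powr_diff)
  show "renyi_entropy M f s = ereal (- ln k)"
  proof (cases "s = 1")
    case True
    then show ?thesis using pos neg by (auto simp: renyi_entropy_def max_def)
  next
    case False
    have "ln (k powr (s - 1)) / (1 - s) = - ln k" using False k by (simp add: ln_powr divide_simps) (simp add: algebra_simps)
    moreover have "k powr (s - 1) > 0" using k by simp
    ultimately show ?thesis using False ren k by (simp add: renyi_entropy_def Let_def)
  qed
qed

text \<open>Stated for densities \<open>f = |F|^2\<close> and \<open>g = |G|^2\<close>: the power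
  mass of order \<open>p/2\<close> is then the \<open>p\<close>-th power of the L^p norm of
  \<open>F\<close>, and the condition says that the L^q norm of \<open>G\<close> is at most the L^p
  norm of \<open>F\<close>.\<close>

definition hausdorff_young :: "'b measure \<Rightarrow> ('b \<Rightarrow> real) \<Rightarrow> 'c measure \<Rightarrow> ('c \<Rightarrow> real) \<Rightarrow> bool" where
  "hausdorff_young M f N g \<longleftrightarrow> (\<forall>p q I. 1 < p \<and> p < 2 \<and> 1/p + 1/q = 1 \<and> 0 < I \<and>
     power_mass M f (p/2) = ennreal I \<longrightarrow> power_mass N g (q/2) \<le> ennreal (I powr (q/p)))"

section \<open>Conjugate exponents and entropy sums\<close>

lemma conjugate_exponent:
  fixes p q :: real
  assumes "1 < p" "p < 2" "1/p + 1/q = 1"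
  shows "q = p / (p - 1)" "2 < q" "q / p = 1 / (p - 1)" "q / 2 - 1 = (2 - p) / (2 * (p - 1))"
proof -
  have "1 / q = (p - 1) / p" using assms by (simp add: field_simps)
  then have "1 / (1 / q) = 1 / ((p - 1) / p)" by simp
  then show q: "q = p / (p - 1)" by simp
  show "2 < q" "q / p = 1 / (p - 1)" "q / 2 - 1 = (2 - p) / (2 * (p - 1))"
    unfolding q using assms by (simp_all add: field_simps)
qed

lemma hausdorff_youngD:
  assumes hy: "hausdorff_young M f N g" and f: "unit_density M f" and g: "unit_density N g"
    and p: "1 < p" "p < 2" "1/p + 1/q = 1" and fin: "power_mass M f (p/2) < \<infinity>"
  obtains I J where "0 < I" "0 < J" "integrable M (\<lambda>x. f x powr (p/2))" "(LINT x|M. f x powr (p/2)) = I"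
    "integrable N (\<lambda>x. g x powr (q/2))" "(LINT x|N. g x powr (q/2)) = J" "ln J \<le> ln I / (p - 1)"
    "renyi_entropy M f (p/2) = ereal (ln I / (1 - p/2))" "renyi_entropy N g (q/2) = ereal (ln J / (1 - q/2))"
proof -
  note c = conjugate_exponent[OF p]
  obtain I where I: "0 < I" "power_mass M f (p/2) = ennreal I" "integrable M (\<lambda>x. f x powr (p/2))"
    "(LINT x|M. f x powr (p/2)) = I" "renyi_entropy M f (p/2) = ereal (ln I / (1 - p/2))"
    by (rule renyi_real[OF f fin]) (use p in auto)
  have le: "power_mass N g (q/2) \<le> ennreal (I powr (q/p))"
    using hy p I(1,2) unfolding hausdorff_young_def by blast
  then have "power_mass N g (q/2) < \<infinity>" by (metis ennreal_less_top infinity_ennreal_def order.strict_trans1)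
  then obtain J where J: "0 < J" "power_mass N g (q/2) = ennreal J" "integrable N (\<lambda>x. g x powr (q/2))"
    "(LINT x|N. g x powr (q/2)) = J" "renyi_entropy N g (q/2) = ereal (ln J / (1 - q/2))"
    by (rule renyi_real[OF g]) (use c in auto)
  have "J \<le> I powr (q/p)" using le J by (simp add: ennreal_le_iff)
  then have "ln J \<le> ln (I powr (q/p))" using J(1) I(1) by (subst ln_le_cancel_iff) auto
  then have "ln J \<le> ln I / (p - 1)" using I(1) c(3) by (simp add: ln_powr)
  with I J that show thesis by blast
qed

text \<open>The logarithm of the Hausdorff--Young inequality, divided by \<open>q/2 - 1\<close>. The
  identity \<open>(p - 1) * (q/2 - 1) = 1 - p/2\<close> turns both denominators into those of the
  entropies, and the negative sign of \<open>1 - q/2\<close> turns the upper bound into a lower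
  bound for the sum.\<close>

lemma renyi_conjugate:
  assumes hy: "hausdorff_young M f N g" and f: "unit_density M f" and g: "unit_density N g"
    and p: "1 < p" "p < 2" "1/p + 1/q = 1" and fin: "power_mass M f (p/2) < \<infinity>"
  shows "0 \<le> renyi_entropy M f (p/2) + renyi_entropy N g (q/2)"
proof -
  note c = conjugate_exponent[OF p]
  obtain I J where IJ: "ln J \<le> ln I / (p - 1)"
    "renyi_entropy M f (p/2) = ereal (ln I / (1 - p/2))" "renyi_entropy N g (q/2) = ereal (ln J / (1 - q/2))"
    by (rule hausdorff_youngD[OF assms]) (rule that)
  have "ln J / (q/2 - 1) \<le> (ln I / (p - 1)) / (q/2 - 1)" 
    using IJ(1) c(2) by (intro divide_right_mono) auto
  also have "(p - 1) * (q/2 - 1) = 1 - p/2"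
    unfolding c(4) using p by (simp add: field_simps)
  then have "ln I / (p - 1) / (q/2 - 1) = ln I / (1 - p/2)" by (simp add: divide_divide_eq_left)
  finally have "ln J / (q/2 - 1) \<le> ln I / (1 - p/2)" .
  moreover have "ln J / (1 - q/2) = - (ln J / (q/2 - 1))"
    by (metis minus_diff_eq minus_divide_right)
  ultimately show ?thesis using IJ by simp
qed

text \<open>The exponent \<open>r\<close> conjugate to \<open>q\<close> satisfies
  \<open>p \<le> r\<close> by the condition on \<open>p\<close> and \<open>q\<close>, and lowering
  the order from \<open>r/2\<close> to \<open>p/2\<close> only increases the entropy. If the power
  mass at \<open>p/2\<close> is infinite, the first entropy is \<open>\<infinity>\<close> and
  definedness of the sum suffices.\<close>

lemma renyi_conjugate_mono:
  assumes hy: "hausdorff_young M f N g" and f: "unit_density M f" and g: "unit_density N g"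
    and pq: "0 < p" "2 < q" "1/p + 1/q \<ge> 1"
    and def: "\<not> (renyi_entropy M f (p/2) = \<infinity> \<and> renyi_entropy N g (q/2) = - \<infinity>)"
  shows "0 \<le> renyi_entropy M f (p/2) + renyi_entropy N g (q/2)"
proof -
  define r where "r = q / (q - 1)"
  have r: "1 < r" "r < 2" "1/r + 1/q = 1" using pq by (auto simp: r_def field_simps)
  have "1 / r \<le> 1 / p" using r(3) pq(3) by linarith
  then have pr: "p \<le> r" using pq(1) r(1) by (simp add: field_simps)
  show ?thesis
  proof (cases "power_mass M f (p/2) < \<infinity>")
    case False
    then have "renyi_entropy M f (p/2) = \<infinity>" 
      using pr r by (intro renyi_infinite) (auto simp: not_less top_unique)
    with def show ?thesis by (cases "renyi_entropy N g (q/2)") auto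
  next
    case True
    have "renyi_entropy M f (r/2) \<le> renyi_entropy M f (p/2) \<and> power_mass M f (r/2) < \<infinity>"
    proof (cases "p = r")
      case False
      then show ?thesis
        using renyi_mono[OF f, of "p/2" "r/2"] True pr r by auto
    qed (use True in auto)
    then show ?thesis
      using renyi_conjugate[OF hy f g r] by (meson add_right_mono order_trans)
  qed
qed

section \<open>The limit of orders tending to one\<close>

lemma powr_le_one_plus:
  fixes y :: real assumes "0 \<le> y" "0 \<le> s" "s \<le> 1" shows "y powr s \<le> 1 + y"
proof (cases "y \<le> 1")
  case True
  then have "y powr s \<le> 1 powr s" using assms by (intro powr_mono2) auto
  then show ?thesis using assms by simp
next
  case False
  then have "y powr s \<le> y powr 1" using assms by (intro powr_mono) auto
  then show ?thesis using False by simp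
qed

lemma power_mass_finite:
  assumes "finite_measure M" and f: "unit_density M f" and s: "0 < s" "s < 1"
  shows "power_mass M f s < \<infinity>"
proof -
  interpret finite_measure M by fact
  note F = unit_densityD[OF f]
  have "power_mass M f s \<le> (\<integral>\<^sup>+x. 1 + ennreal (f x) \<partial>M)"
    unfolding power_mass_def
  proof (intro nn_integral_mono)
    fix x show "ennreal (f x powr s) \<le> 1 + ennreal (f x)"
      using powr_le_one_plus[OF F(2)[of x] less_imp_le[OF s(1)] less_imp_le[OF s(2)]] F(2)[of x]
      by (metis ennreal_1 ennreal_leI ennreal_plus zero_le_one)
  qed
  also have "\<dots> = emeasure M (space M) + 1" using F by (subst nn_integral_add) auto
  also have "\<dots> < \<infinity>" using emeasure_finite by (simp add: less_top[symmetric])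
  finally show ?thesis .
qed

text \<open>A lower bound uniform in \<open>s\<close>, as Fatou's lemma requires. With
  \<open>z = y powr s\<close> the quotient is at least \<open>z * ln y = (z * ln z) / s\<close>;
  since \<open>z * ln z \<ge> z - 1 \<ge> -1\<close> and \<open>s \<ge> 1/2\<close>, this is at
  least \<open>-2\<close>.\<close>

lemma entropy_quotient_bounds:
  fixes y s :: real
  assumes "0 \<le> y" "1/2 \<le> s" "s < 1"
  shows "-2 \<le> (y - y powr s) / (1 - s)"
proof (cases "y = 0")
  case False
  then have y: "y > 0" using assms by simp
  let ?z = "y powr s"
  have z: "?z > 0" using y by simp
  have "(1 - s) * ln y \<le> y powr (1 - s) - 1"
    using ln_le_minus_one[of "y powr (1 - s)"] y by (simp add: ln_powr)
  then have "?z * ((1 - s) * ln y) \<le> ?z * (y powr (1 - s) - 1)" using z by (intro mult_left_mono) auto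
  also have "\<dots> = y - ?z" using y by (simp add: algebra_simps powr_add[symmetric])
  finally have 1: "?z * ln y \<le> (y - ?z) / (1 - s)" using assms by (simp add: pos_le_divide_eq algebra_simps)
  have "- ln ?z \<le> 1 / ?z - 1" using ln_le_minus_one[of "1 / ?z"] z by (simp add: ln_div)
  then have "?z * (- ln ?z) \<le> ?z * (1 / ?z - 1)" using z by (intro mult_left_mono) auto
  also have "\<dots> = 1 - ?z" using z by (simp add: algebra_simps)
  also have "?z * (- ln ?z) = - (s * (?z * ln y))" using y by (simp add: ln_powr)
  finally have 2: "s * (?z * ln y) \<ge> -1" using z by linarith
  have "?z * ln y \<ge> -2"
  proof (rule ccontr)
    assume "\<not> ?z * ln y \<ge> -2"
    then have "s * (?z * ln y) < s * (-2)" using assms by (intro mult_strict_left_mono) auto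
    with 2 assms show False by linarith
  qed
  with 1 show ?thesis by linarith
qed auto

text \<open>The quotient is the difference quotient at \<open>1\<close> of the map from
  \<open>s\<close> to \<open>y powr s\<close>, whose derivative there is
  \<open>y * ln y\<close>.\<close>

lemma entropy_quotient_tendsto:
  fixes y :: real
  assumes "0 \<le> y" and s: "s \<longlonglongrightarrow> 1" "\<And>n. s n < 1"
  shows "(\<lambda>n. (y - y powr s n) / (1 - s n)) \<longlonglongrightarrow> y * ln y"
proof (cases "y = 0")
  case False
  then have y: "y > 0" using assms by simp
  have "((\<lambda>s. y powr s) has_real_derivative y powr 1 * ln y) (at 1)"
    using y by (auto intro!: derivative_eq_intros)
  then have "((\<lambda>t. (y powr t - y powr 1) / (t - 1)) \<longlongrightarrow> y powr 1 * ln y) (at 1)"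
    by (simp add: has_field_derivative_iff)
  moreover have "filterlim s (at 1) sequentially"
    using s by (auto simp: filterlim_at less_imp_neq)
  ultimately have "((\<lambda>n. (y powr s n - y powr 1) / (s n - 1)) \<longlonglongrightarrow> y powr 1 * ln y)"
    by (rule filterlim_compose)
  moreover have "(y powr s n - y powr 1) / (s n - 1) = (y - y powr s n) / (1 - s n)" for n
    using y minus_divide_divide[of "y - y powr s n" "1 - s n"] by simp
  ultimately show ?thesis using y by simp
qed auto

lemma shannon_finite:
  assumes g: "g \<in> borel_measurable N" and fin: "shannon_pos N g < \<infinity>" "shannon_neg N g < \<infinity>"
  shows "integrable N (\<lambda>x. g x * ln (g x))" "renyi_entropy N g 1 = ereal (- (LINT x|N. g x * ln (g x)))"
proof -
  let ?P = "\<integral>\<^sup>+x. ennreal (- (g x * ln (g x))) \<partial>N" and ?N = "\<integral>\<^sup>+x. ennreal (g x * ln (g x)) \<partial>N"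
  obtain a b where ab: "?P = ennreal a" "0 \<le> a" "?N = ennreal b" "0 \<le> b"
    using fin unfolding shannon_pos_def shannon_neg_def
    by (cases ?P; cases ?N) auto
  show int: "integrable N (\<lambda>x. g x * ln (g x))"
    using ab g by (auto simp: real_integrable_def)
  show "renyi_entropy N g 1 = ereal (- (LINT x|N. g x * ln (g x)))"
    using ab int by (subst real_lebesgue_integral_def) (auto simp: renyi_entropy_def shannon_pos_def shannon_neg_def)
qed

text \<open>The Shannon case is the limit of the Renyi case for \<open>p \<rightarrow> 2\<close>: Jensen's inequality bounds the
  entropy of \<open>g\<close> from below for every \<open>q > 2\<close>, and Fatou's lemma passes to the limit for \<open>f\<close>.\<close>

lemma shannon_sum:
  assumes M: "finite_measure M" and hy: "hausdorff_young M f N g" and f: "unit_density M f" and g: "unit_density N g"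
    and fin: "shannon_pos N g < \<infinity>" "shannon_neg N g < \<infinity>"
  shows "shannon_pos M f < \<infinity>" "shannon_neg M f < \<infinity>" "0 \<le> renyi_entropy M f 1 + renyi_entropy N g 1"
proof -
  interpret finite_measure M by fact
  note F = unit_densityD[OF f] and G = unit_densityD[OF g]
  note gint = shannon_finite[OF G(1) fin]
  define h where "h = (LINT x|N. g x * ln (g x))"
  \<comment> \<open>The shift by \<open>3\<close> keeps \<open>s n > 1/2\<close>, i.e.
    \<open>p = 2 * s n > 1\<close>, already for \<open>n = 0\<close>.\<close>
  define s where "s = (\<lambda>n::nat. 1 - 1 / real (n + 3))"
  have s: "s n < 1" "1/2 < s n" for n by (auto simp: s_def field_simps)
  have slim: "s \<longlonglongrightarrow> 1" unfolding s_def by real_asymp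
  define v where "v = (\<lambda>n x. (f x - f x powr s n) / (1 - s n))"
  have v: "integrable M (v n)" "(LINT x|M. v n x) \<le> - h" for n
  proof -
    define p where "p = 2 * s n"
    define q where "q = p / (p - 1)"
    have p: "1 < p" "p < 2" "1/p + 1/q = 1" using s[of n] by (auto simp: p_def q_def divide_simps)
    note c = conjugate_exponent[OF p]
    have sp: "s n = p / 2" by (simp add: p_def)
    have fin': "power_mass M f (p/2) < \<infinity>" using power_mass_finite[OF M f] p by auto
    obtain I J where IJ: "0 < I" "0 < J" "integrable M (\<lambda>x. f x powr (p/2))" "(LINT x|M. f x powr (p/2)) = I"
      "integrable N (\<lambda>x. g x powr (q/2))" "(LINT x|N. g x powr (q/2)) = J" "ln J \<le> ln I / (p - 1)"
      by (rule hausdorff_youngD[OF hy f g p fin']) (rule that)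
    show "integrable M (v n)" unfolding v_def sp using IJ(3) F(3) by auto
    have val: "(LINT x|M. v n x) = (1 - I) / (1 - p/2)"
      unfolding v_def sp using IJ(3,4) F(3,4) by simp
    define t where "t = q/2 - 1"
    have t: "t > 0" using c(2) by (simp add: t_def)
    \<comment> \<open>Jensen's inequality for the exponential under the density \<open>g\<close>:
      this is \<open>g\<close> times the tangent of \<open>exp\<close> at the mean
      \<open>t * h\<close> of \<open>t * ln g\<close>, so its integral is
      \<open>exp (t * h)\<close>.\<close>
    let ?w = "\<lambda>x. exp (t * h) * (g x + t * (g x * ln (g x)) - t * h * g x)"
    have "(LINT x|N. ?w x) \<le> (LINT x|N. g x powr (q/2))"
    proof (rule integral_mono)
      show "integrable N ?w" using gint(1) G(3) by auto
      fix x
      show "?w x \<le> g x powr (q/2)"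
      proof (cases "g x = 0")
        case False
        then have y: "g x > 0" using G(2)[of x] by simp
        have "1 + (t * ln (g x) - t * h) \<le> exp (t * ln (g x) - t * h)" by (rule exp_ge_add_one_self)
        then have "exp (t * h) * g x * (1 + (t * ln (g x) - t * h)) \<le> exp (t * h) * g x * exp (t * ln (g x) - t * h)"
          using y by (intro mult_left_mono) auto
        also have "\<dots> = g x * g x powr t" using y by (simp add: exp_diff powr_def)
        also have "\<dots> = g x powr (q/2)" using powr_shift[of "g x" "q/2"] y by (simp add: t_def)
        finally show ?thesis by (simp add: algebra_simps)
      qed auto
    qed (fact IJ)
    moreover have "(LINT x|N. ?w x) = exp (t * h)" using gint(1) G(3,4) by (simp add: h_def)
    ultimately have "exp (t * h) \<le> J" using IJ(6) by simp
    then have "t * h \<le> ln J" using IJ(2) by (simp add: ln_ge_iff)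
    also have "\<dots> \<le> ln I / (p - 1)" by fact
    \<comment> \<open>The integral of \<open>v n\<close> is \<open>(1 - I) / (1 - p/2)\<close>, so
      \<open>ln I\<close> is exchanged for \<open>I - 1\<close> here;
      \<open>t * (p - 1) = 1 - p/2\<close> then gives the right denominator.\<close>
    also have "\<dots> \<le> (I - 1) / (p - 1)" using ln_le_minus_one[OF IJ(1)] p by (simp add: divide_right_mono)
    finally have "t * (p - 1) * h \<le> I - 1" using p by (simp add: pos_le_divide_eq algebra_simps)
    moreover have "t * (p - 1) = 1 - p/2" using c(4) p by (simp add: t_def field_simps)
    ultimately have "(1 - p/2) * h \<le> I - 1" by simp
    then have "(1 - I) / (1 - p/2) \<le> - h" using p by (simp add: pos_divide_le_eq algebra_simps)
    then show "(LINT x|M. v n x) \<le> - h" using val by simp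
  qed
  have low: "v n x \<ge> -2" for n x
    unfolding v_def using s[of n] F(2)[of x] by (intro entropy_quotient_bounds) auto
  have lim: "(\<lambda>n. v n x) \<longlonglongrightarrow> f x * ln (f x)" for x
    unfolding v_def using s slim F(2) by (intro entropy_quotient_tendsto) auto
  have flow: "f x * ln (f x) \<ge> -2" for x
    by (rule LIMSEQ_le_const[OF lim]) (use low in auto)
  have flow2: "0 \<le> f x * ln (f x) + 2" for x using flow[of x] by simp
  have low2: "0 \<le> v n x + 2" for n x using low[of n x] by simp
  let ?m = "measure M (space M)"
  have [measurable]: "f \<in> borel_measurable M" "\<And>n. v n \<in> borel_measurable M" using F v(1) by auto
  have vb: "(\<integral>\<^sup>+x. ennreal (v n x + 2) \<partial>M) \<le> ennreal (- h + 2 * ?m)" for n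
  proof -
    have "(\<integral>\<^sup>+x. ennreal (v n x + 2) \<partial>M) = ennreal (LINT x|M. v n x + 2)"
    proof (rule nn_integral_eq_integral)
      show "AE x in M. 0 \<le> v n x + 2" using low2 by simp
    qed (use v(1) in auto)
    also have "\<dots> \<le> ennreal (- h + 2 * ?m)" using v[of n] by (intro ennreal_leI) (simp add: algebra_simps)
    finally show ?thesis .
  qed
  have "(\<integral>\<^sup>+x. ennreal (f x * ln (f x) + 2) \<partial>M) = (\<integral>\<^sup>+x. liminf (\<lambda>n. ennreal (v n x + 2)) \<partial>M)"
  proof (rule nn_integral_cong)
    fix x
    have "(\<lambda>n. ennreal (v n x + 2)) \<longlonglongrightarrow> ennreal (f x * ln (f x) + 2)"
      by (intro tendsto_ennrealI tendsto_add lim tendsto_const)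
    then show "ennreal (f x * ln (f x) + 2) = liminf (\<lambda>n. ennreal (v n x + 2))"
      by (simp add: lim_imp_Liminf)
  qed
  also have "\<dots> \<le> liminf (\<lambda>n. \<integral>\<^sup>+x. ennreal (v n x + 2) \<partial>M)"
    by (rule nn_integral_liminf) measurable
  also have "\<dots> \<le> liminf (\<lambda>n. ennreal (- h + 2 * ?m))"
    by (intro Liminf_mono always_eventually allI vb)
  also have "\<dots> = ennreal (- h + 2 * ?m)" by (simp add: Liminf_const)
  finally have bound: "(\<integral>\<^sup>+x. ennreal (f x * ln (f x) + 2) \<partial>M) \<le> ennreal (- h + 2 * ?m)" .
  have intf2: "integrable M (\<lambda>x. f x * ln (f x) + 2)"
  proof (rule integrableI_nonneg)
    show "AE x in M. 0 \<le> f x * ln (f x) + 2" using flow2 by simp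
    show "(\<integral>\<^sup>+x. ennreal (f x * ln (f x) + 2) \<partial>M) < \<infinity>"
      using bound by (metis ennreal_less_top infinity_ennreal_def order.strict_trans1)
  qed measurable
  have intf: "integrable M (\<lambda>x. f x * ln (f x))"
    using Bochner_Integration.integrable_diff[OF intf2, of "\<lambda>_. 2"] by simp
  \<comment> \<open>Without this sign the bound from Fatou's lemma could not be read back as a real
    inequality, because \<open>ennreal\<close> truncates negative numbers to
    \<open>0\<close>.\<close>
  have pos: "0 \<le> - h + 2 * ?m"
  proof -
    have "0 \<le> (LINT x|M. v 0 x + 2)" using low2 by (intro integral_nonneg_AE) simp
    also have "\<dots> = (LINT x|M. v 0 x) + 2 * ?m" using v(1)[of 0] by simp
    finally show ?thesis using v(2)[of 0] by simp
  qed
  have "(LINT x|M. f x * ln (f x) + 2) \<le> - h + 2 * ?m"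
  proof -
    have "ennreal (LINT x|M. f x * ln (f x) + 2) = (\<integral>\<^sup>+x. ennreal (f x * ln (f x) + 2) \<partial>M)"
      by (rule nn_integral_eq_integral[symmetric]) (use intf2 flow2 in auto)
    also have "\<dots> \<le> ennreal (- h + 2 * ?m)" by (rule bound)
    finally show ?thesis by (subst (asm) ennreal_le_iff[OF pos])
  qed
  then have le: "(LINT x|M. f x * ln (f x)) \<le> - h" using intf by simp
  show 1: "shannon_pos M f < \<infinity>" "shannon_neg M f < \<infinity>"
    using intf unfolding real_integrable_def shannon_pos_def shannon_neg_def
    by (cases "\<integral>\<^sup>+x. ennreal (- (f x * ln (f x))) \<partial>M"; cases "\<integral>\<^sup>+x. ennreal (f x * ln (f x)) \<partial>M"; simp)+
  show "0 \<le> renyi_entropy M f 1 + renyi_entropy N g 1"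
    using shannon_finite[OF F(1) 1] gint le by (simp add: h_def)
qed

text \<open>The position of \<open>p\<close> and \<open>q\<close> relative to \<open>2\<close>
  decides. If one exceeds \<open>2\<close>, its conjugate exponent is compared with the other. If
  neither does, both orders are raised to a conjugate pair or, with an exponent equal to
  \<open>2\<close>, to the Shannon case. Finite mass of \<open>M\<close> and the bound on
  \<open>shannon_neg\<close> control the infinite values.\<close>

theorem entropy_sum_nonneg:
  assumes M: "finite_measure M" and f: "unit_density M f" and g: "unit_density N g"
    and hy: "hausdorff_young M f N g" "hausdorff_young N g M f"
    and neg: "shannon_neg N g < \<infinity>"
    and pq: "0 < p" "0 < q" "1/p + 1/q \<ge> 1"
    and def: "\<not> (renyi_entropy M f (p/2) = \<infinity> \<and> renyi_entropy N g (q/2) = - \<infinity>)"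
      "\<not> (renyi_entropy M f (p/2) = - \<infinity> \<and> renyi_entropy N g (q/2) = \<infinity>)"
  shows "0 \<le> renyi_entropy M f (p/2) + renyi_entropy N g (q/2)"
proof -
  have shannon_inf: "renyi_entropy N g 1 = \<infinity> \<or> shannon_pos N g < \<infinity>"
    using neg by (cases "shannon_pos N g"; cases "shannon_neg N g") (auto simp: renyi_entropy_def)
  have conc: "0 \<le> a + b" if "a = \<infinity> \<and> b \<noteq> -\<infinity> \<or> b = \<infinity> \<and> a \<noteq> -\<infinity>" for a b :: ereal
    using that by (cases a; cases b) auto
  consider "q > 2" | "p > 2" | "p < 2" "q < 2" | "p < 2" "q = 2" | "p = 2" "q < 2" | "p = 2" "q = 2" by linarith
  then show ?thesis
  proof cases
    case 1
    then show ?thesis using renyi_conjugate_mono[OF hy(1) f g pq(1) _ pq(3) def(1)] by simp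
  next
    case 2
    then have "0 \<le> renyi_entropy N g (q/2) + renyi_entropy M f (p/2)"
      using pq(3) def(2) by (intro renyi_conjugate_mono[OF hy(2) g f pq(2)]) auto
    then show ?thesis by (simp add: add.commute)
  next
    case 3
    \<comment> \<open>Any \<open>r\<close> with \<open>max p 1 < r < 2\<close> would serve: its
      conjugate \<open>t\<close> exceeds \<open>2\<close>, hence \<open>q\<close>, so that both
      orders go up and both entropies go down.\<close>
    define r where "r = (max p 1 + 2) / 2"
    define t where "t = r / (r - 1)"
    have r0: "1 < r" "r < 2" "p < r" using 3 by (auto simp: r_def)
    have "1 / t = 1 - 1 / r" using r0 by (simp add: t_def diff_divide_distrib)
    then have r: "1 < r" "r < 2" "p < r" "1/r + 1/t = 1" using r0 by auto
    note c = conjugate_exponent[OF r(1,2,4)]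
    have "renyi_entropy M f (r/2) \<le> renyi_entropy M f (p/2)"
      using renyi_mono(1)[OF f _ _ _ power_mass_finite[OF M f, of "p/2"], of "r/2"] r 3 pq by auto
    moreover have "power_mass M f (r/2) < \<infinity>" using power_mass_finite[OF M f] r by auto
    moreover have "renyi_entropy N g (t/2) \<le> renyi_entropy N g (q/2)"
    proof (cases "power_mass N g (q/2) < \<infinity>")
      case True
      then show ?thesis by (intro renyi_mono(1)[OF g _ _ _ True]) (use c(2) 3 in auto)
    next
      case False
      then have "renyi_entropy N g (q/2) = \<infinity>" using 3 by (intro renyi_infinite) (auto simp: not_less top_unique)
      then show ?thesis by simp
    qed
    ultimately show ?thesis
      using renyi_conjugate[OF hy(1) f g r(1,2,4)] by (meson add_mono order_trans)
  next
    case 4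
    have fin: "power_mass M f (p/2) < \<infinity>" using power_mass_finite[OF M f] 4 pq by auto
    have real: "renyi_entropy M f (p/2) \<noteq> - \<infinity>"
      by (rule renyi_real[OF f fin]) (use 4 in auto)
    show ?thesis
    proof (cases "shannon_pos N g < \<infinity>")
      case True
      then show ?thesis using shannon_sum(3)[OF M hy(1) f g True neg] shannon_le_renyi(2)[OF f _ fin] 4
        by (auto intro: order_trans add_right_mono)
    next
      case False
      with shannon_inf real 4 show ?thesis by (intro conc) auto
    qed
  next
    case 5
    show ?thesis
    proof (cases "power_mass N g (q/2) < \<infinity>")
      case True
      have s: "shannon_pos N g < \<infinity>" "renyi_entropy N g 1 \<le> renyi_entropy N g (q/2)"
        using shannon_le_renyi[OF g _ True] 5 by auto
      then show ?thesis using shannon_sum(3)[OF M hy(1) f g s(1) neg] 5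
        by (auto intro: order_trans add_left_mono)
    next
      case False
      then have "renyi_entropy N g (q/2) = \<infinity>" using 5 by (intro renyi_infinite) (auto simp: not_less top_unique)
      with def(2) show ?thesis by (intro conc) auto
    qed
  next
    case 6
    show ?thesis
    proof (cases "shannon_pos N g < \<infinity>")
      case True
      then show ?thesis using shannon_sum(3)[OF M hy(1) f g True neg] 6 by auto
    next
      case False
      with shannon_inf def(2) 6 show ?thesis by (intro conc) auto
    qed
  qed
qed

section \<open>The Riesz theorem for unimodular orthogonal systems\<close>

text \<open>The factor \<open>exp (e * z\<^sup>2)\<close> decays as the imaginary part grows, so the
  maximum modulus principle on a large rectangle applies; its size on the strip is at most
  \<open>exp (e * c\<^sup>2)\<close>, which tends to \<open>1\<close> with \<open>e\<close> tending
  to \<open>0\<close>.\<close>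

lemma three_lines:
  fixes f :: "complex \<Rightarrow> complex"
  assumes hol: "f holomorphic_on UNIV"
    and bound: "\<And>w. a \<le> Re w \<Longrightarrow> Re w \<le> b \<Longrightarrow> cmod (f w) \<le> B"
    and edge: "\<And>w. Re w = a \<or> Re w = b \<Longrightarrow> cmod (f w) \<le> 1"
    and w: "a \<le> Re w" "Re w \<le> b"
  shows "cmod (f w) \<le> 1"
proof -
  define c where "c = \<bar>a\<bar> + \<bar>b\<bar>"
  have re_sq: "(Re z)\<^sup>2 \<le> c\<^sup>2" if "a \<le> Re z" "Re z \<le> b" for z
    using that unfolding c_def by (intro power2_le_iff_abs_le[THEN iffD2]) auto
  have B: "0 \<le> B" using bound[OF w] norm_ge_zero order_trans by blast
  have key: "cmod (f w) * exp (e * ((Re w)\<^sup>2 - (Im w)\<^sup>2)) \<le> exp (e * c\<^sup>2)" if e: "e > 0" for e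
  proof -
    \<comment> \<open>Large enough for the rectangle to contain \<open>w\<close> and for
      \<open>B \<le> e * R\<^sup>2\<close>, so that with \<open>B \<le> exp B\<close> the decay on
      the horizontal sides absorbs the bound \<open>B\<close>.\<close>
    define R where "R = 1 + \<bar>Im w\<bar> + B / e"
    define g where "g = (\<lambda>z. f z * exp (of_real e * z\<^sup>2))"
    have normg: "cmod (g z) = cmod (f z) * exp (e * ((Re z)\<^sup>2 - (Im z)\<^sup>2))" for z
      by (simp add: g_def norm_mult power2_eq_square)
    define S where "S = cbox (Complex a (-R)) (Complex b R)"
    have mem: "z \<in> S \<longleftrightarrow> a \<le> Re z \<and> Re z \<le> b \<and> \<bar>Im z\<bar> \<le> R" for z
      by (auto simp: S_def in_cbox_complex_iff)
    have holg: "g holomorphic_on UNIV"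
      unfolding g_def using hol by (intro holomorphic_intros)
    have Rb: "B \<le> e * R\<^sup>2"
    proof -
      have "B \<le> e * R" using e B by (simp add: R_def field_simps)
      also have "\<dots> \<le> e * R\<^sup>2"
      proof -
        have "1 \<le> R" using e B by (simp add: R_def)
        then have "R * 1 \<le> R * R" by (intro mult_left_mono) auto
        then show ?thesis using e by (simp add: power2_eq_square)
      qed
      finally show ?thesis .
    qed
    have "cmod (g w) \<le> exp (e * c\<^sup>2)"
    proof (rule maximum_modulus_frontier[of g S])
      show "g holomorphic_on interior S" using holg by (rule holomorphic_on_subset) simp
      show "continuous_on (closure S) g"
        using holomorphic_on_imp_continuous_on[OF holg] by (rule continuous_on_subset) simp
      show "bounded S" unfolding S_def by simp
      show "w \<in> S" using w B e by (simp add: mem R_def)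
      fix z assume z: "z \<in> frontier S"
      then have zS: "z \<in> S" by (metis S_def closed_cbox frontier_subset_closed subsetD)
      have "z \<notin> box (Complex a (-R)) (Complex b R)"
        using z by (simp add: S_def frontier_cbox)
      then consider "Re z = a \<or> Re z = b" | "\<bar>Im z\<bar> = R"
        using zS unfolding mem by (auto simp: in_box_complex_iff)
      then show "cmod (g z) \<le> exp (e * c\<^sup>2)"
      proof cases
        case 1
        have "cmod (g z) \<le> 1 * exp (e * ((Re z)\<^sup>2 - (Im z)\<^sup>2))"
          unfolding normg using edge[OF 1] by (intro mult_right_mono) auto
        also have "\<dots> \<le> exp (e * c\<^sup>2)"
          using re_sq[of z] zS e by (simp add: mem) (smt (verit) zero_le_power2)
        finally show ?thesis .
      next
        case 2
        have "cmod (g z) \<le> B * exp (e * ((Re z)\<^sup>2 - (Im z)\<^sup>2))"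
          unfolding normg using bound[of z] zS by (intro mult_right_mono) (auto simp: mem)
        also have "\<dots> \<le> exp B * exp (e * (c\<^sup>2 - R\<^sup>2))"
        proof (intro mult_mono)
          show "B \<le> exp B" using exp_ge_add_one_self[of B] by linarith
          have "(Im z)\<^sup>2 = R\<^sup>2" using 2 by (metis power2_abs)
          then show "exp (e * ((Re z)\<^sup>2 - (Im z)\<^sup>2)) \<le> exp (e * (c\<^sup>2 - R\<^sup>2))"
            using re_sq[of z] zS e by (simp add: mem)
        qed (use B in auto)
        also have "\<dots> = exp (B - e * R\<^sup>2) * exp (e * c\<^sup>2)"
          by (simp add: exp_add[symmetric] algebra_simps)
        also have "\<dots> \<le> 1 * exp (e * c\<^sup>2)" using Rb by (intro mult_right_mono) auto
        finally show ?thesis by simp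
      qed
    qed
    then show ?thesis by (simp add: normg)
  qed
  have l1: "((\<lambda>e. cmod (f w) * exp (e * ((Re w)\<^sup>2 - (Im w)\<^sup>2))) \<longlongrightarrow> cmod (f w) * exp (0 * ((Re w)\<^sup>2 - (Im w)\<^sup>2))) (at_right 0)"
    by (intro tendsto_intros)
  have l2: "((\<lambda>e. exp (e * c\<^sup>2)) \<longlongrightarrow> exp (0 * c\<^sup>2)) (at_right (0::real))"
    by (intro tendsto_intros)
  have l3: "\<forall>\<^sub>F e in at_right 0. cmod (f w) * exp (e * ((Re w)\<^sup>2 - (Im w)\<^sup>2)) \<le> exp (e * c\<^sup>2)"
    using key by (auto simp: eventually_at_right_less intro: eventually_mono[OF eventually_at_right_less])
  have "cmod (f w) * exp (0 * ((Re w)\<^sup>2 - (Im w)\<^sup>2)) \<le> exp (0 * c\<^sup>2)"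
    by (rule tendsto_le[OF trivial_limit_at_right_real l2 l1 l3])
  then show ?thesis by simp
qed

text \<open>The index set may be uncountable, so no enumeration is used. A simple function below
  \<open>f\<close> has finitely many values; were its support infinite, one nonzero value would be
  taken infinitely often and finite sums of \<open>f\<close> would exceed any finite
  \<open>C\<close>.\<close>

lemma nn_integral_count_space_le:
  fixes f :: "'a \<Rightarrow> ennreal"
  assumes "\<And>J. finite J \<Longrightarrow> J \<subseteq> I \<Longrightarrow> (\<Sum>i\<in>J. f i) \<le> C"
  shows "(\<integral>\<^sup>+i. f i \<partial>count_space I) \<le> C"
proof (cases "C = \<infinity>")
  case False
  then obtain c where c: "C = ennreal c" "0 \<le> c" by (cases C) auto
  show ?thesis
    unfolding nn_integral_def
  proof (rule SUP_least, clarify)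
    fix g :: "'a \<Rightarrow> ennreal"
    assume g: "simple_function (count_space I) g" "g \<le> f"
    define F where "F = {i \<in> I. g i \<noteq> 0}"
    have "finite F"
    proof (rule ccontr)
      assume inf: "infinite F"
      have "finite (g ` F)" using g(1) by (auto simp: F_def intro: finite_subset)
      then obtain k where k: "k \<in> F" "infinite {i \<in> F. g i = g k}"
        using pigeonhole_infinite[OF inf] by auto
      then have "0 < g k" by (simp add: F_def zero_less_iff_neq_zero)
      then obtain r where r: "0 < r" "ennreal r \<le> g k"
        by (metis ennreal_enn2real ennreal_less_zero_iff enn2real_positive_iff less_top linorder_not_less order_refl zero_less_one ennreal_1 top_greatest)
      obtain n :: nat where n: "c < real n * r" using reals_Archimedean3[OF r(1)] by blast
      obtain J where J: "finite J" "card J = n" "J \<subseteq> {i \<in> F. g i = g k}"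
        using infinite_arbitrarily_large[OF k(2)] by blast
      have "ennreal (real n * r) = (\<Sum>i\<in>J. ennreal r)"
        using J r by (simp add: ennreal_mult ennreal_of_nat_eq_real_of_nat)
      also have "\<dots> \<le> (\<Sum>i\<in>J. f i)"
      proof (rule sum_mono)
        fix i assume "i \<in> J"
        then have "g i = g k" using J(3) by auto
        then show "ennreal r \<le> f i" using r(2) g(2) by (metis le_funD order_trans)
      qed
      also have "\<dots> \<le> C" using J by (intro assms) (auto simp: F_def)
      finally show False using n c by simp
    qed
    have "integral\<^sup>S (count_space I) g = (\<integral>\<^sup>+i. g i \<partial>count_space I)"
      using g by (simp add: nn_integral_eq_simple_integral)
    also have "\<dots> = (\<Sum>i\<in>F. g i)"
      using \<open>finite F\<close> by (intro nn_integral_count_space') (auto simp: F_def)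
    also have "\<dots> \<le> (\<Sum>i\<in>F. f i)" using g(2) by (intro sum_mono) (auto simp: le_fun_def)
    also have "\<dots> \<le> C" using \<open>finite F\<close> by (intro assms) (auto simp: F_def)
    finally show "integral\<^sup>S (count_space I) g \<le> C" .
  qed
qed auto

section \<open>Square-integrable functions and their inner product\<close>

lemma borel_measurable_cnj [measurable]:
  "f \<in> borel_measurable M \<Longrightarrow> (\<lambda>x. cnj (f x)) \<in> borel_measurable M"
  by (rule borel_measurable_continuous_on[of cnj]) (intro continuous_intros)

lemma L2_cnj: "L2 M f \<Longrightarrow> L2 M (\<lambda>x. cnj (f x))"
  by (auto simp: L2_def)

lemma L2_mult_integrable:
  assumes "L2 M f" "L2 M g"
  shows "integrable M (\<lambda>x. f x * g x)"
proof (rule Bochner_Integration.integrable_bound)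
  show "integrable M (\<lambda>x. (cmod (f x))\<^sup>2 + (cmod (g x))\<^sup>2)" using assms by (auto simp: L2_def)
  show "(\<lambda>x. f x * g x) \<in> borel_measurable M" using assms by (auto simp: L2_def)
  have "cmod (f x * g x) \<le> (cmod (f x))\<^sup>2 + (cmod (g x))\<^sup>2" for x
  proof -
    have "0 \<le> cmod (f x) * cmod (g x)" by simp
    then show ?thesis using sum_squares_bound[of "cmod (f x)" "cmod (g x)"] unfolding norm_mult by linarith
  qed
  then show "AE x in M. norm (f x * g x) \<le> norm ((cmod (f x))\<^sup>2 + (cmod (g x))\<^sup>2)" by auto
qed

lemma cmod_add_square_le: "(cmod (z + w))\<^sup>2 \<le> 2 * (cmod z)\<^sup>2 + 2 * (cmod w)\<^sup>2"
proof -
  have "(cmod (z + w))\<^sup>2 \<le> (cmod z + cmod w)\<^sup>2" by (intro power_mono norm_triangle_ineq) auto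
  also have "\<dots> \<le> 2 * (cmod z)\<^sup>2 + 2 * (cmod w)\<^sup>2"
    using sum_squares_bound[of "cmod z" "cmod w"] by (simp add: power2_sum)
  finally show ?thesis .
qed

lemma L2_add:
  assumes "L2 M f" "L2 M g"
  shows "L2 M (\<lambda>x. f x + g x)"
  unfolding L2_def
proof
  show m: "(\<lambda>x. f x + g x) \<in> borel_measurable M" using assms by (auto simp: L2_def)
  show "integrable M (\<lambda>x. (cmod (f x + g x))\<^sup>2)"
  proof (rule Bochner_Integration.integrable_bound)
    show "integrable M (\<lambda>x. 2 * (cmod (f x))\<^sup>2 + 2 * (cmod (g x))\<^sup>2)" using assms by (auto simp: L2_def)
    show "AE x in M. norm ((cmod (f x + g x))\<^sup>2) \<le> norm (2 * (cmod (f x))\<^sup>2 + 2 * (cmod (g x))\<^sup>2)"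
      using cmod_add_square_le[of "f _" "g _"] by auto
  qed (use m in measurable)
qed

lemma L2_cmult: "L2 M f \<Longrightarrow> L2 M (\<lambda>x. c * f x)"
  by (auto simp: L2_def norm_mult power_mult_distrib)

lemma L2_diff: "L2 M f \<Longrightarrow> L2 M g \<Longrightarrow> L2 M (\<lambda>x. f x - g x)"
  using L2_add[of M f "\<lambda>x. - 1 * g x"] L2_cmult[of M g "-1"] by simp

lemma L2_sum: "finite J \<Longrightarrow> (\<And>i. i \<in> J \<Longrightarrow> L2 M (f i)) \<Longrightarrow> L2 M (\<lambda>x. \<Sum>i\<in>J. f i x)"
  by (induction rule: finite_induct) (auto intro: L2_add simp: L2_def[of _ "\<lambda>x. 0"])

lemma (in finite_measure) L2_bounded:
  assumes "f \<in> borel_measurable M" "\<And>x. x \<in> space M \<Longrightarrow> cmod (f x) \<le> B"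
  shows "L2 M f"
  unfolding L2_def
proof
  show "integrable M (\<lambda>x. (cmod (f x))\<^sup>2)"
    by (rule integrable_const_bound[where B = "B\<^sup>2"]) (use assms in \<open>auto intro!: AE_I2 power_mono\<close>)
qed fact

lemma (in finite_measure) L2_integrable: "L2 M f \<Longrightarrow> integrable M f"
  using L2_mult_integrable[of M f "\<lambda>_. 1"] L2_bounded[of "\<lambda>_. 1" 1] by simp

definition ip :: "'b measure \<Rightarrow> ('b \<Rightarrow> complex) \<Rightarrow> ('b \<Rightarrow> complex) \<Rightarrow> complex" where
  "ip M f g = (LINT x|M. f x * cnj (g x))"

lemma ip_cnj: "cnj (ip M f g) = ip M g f"
  unfolding ip_def Bochner_Integration.integral_cnj[symmetric] by (simp add: mult.commute del: Bochner_Integration.integral_cnj)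

lemma ip_simps:
  assumes "L2 M f" "L2 M g" "L2 M h"
  shows "ip M (\<lambda>x. f x + g x) h = ip M f h + ip M g h" "ip M h (\<lambda>x. f x + g x) = ip M h f + ip M h g"
    "ip M (\<lambda>x. f x - g x) h = ip M f h - ip M g h" "ip M h (\<lambda>x. f x - g x) = ip M h f - ip M h g"
    "ip M (\<lambda>x. c * f x) h = c * ip M f h" "ip M h (\<lambda>x. c * f x) = cnj c * ip M h f"
proof -
  note int = L2_mult_integrable[OF assms(1) L2_cnj[OF assms(3)]] L2_mult_integrable[OF assms(2) L2_cnj[OF assms(3)]]
  show 1: "ip M (\<lambda>x. f x + g x) h = ip M f h + ip M g h"
    unfolding ip_def distrib_right by (rule Bochner_Integration.integral_add[OF int])
  show 2: "ip M (\<lambda>x. f x - g x) h = ip M f h - ip M g h"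
    unfolding ip_def left_diff_distrib by (rule Bochner_Integration.integral_diff[OF int])
  show 3: "ip M (\<lambda>x. c * f x) h = c * ip M f h"
    unfolding ip_def mult.assoc by simp
  show "ip M h (\<lambda>x. f x + g x) = ip M h f + ip M h g" "ip M h (\<lambda>x. f x - g x) = ip M h f - ip M h g"
    "ip M h (\<lambda>x. c * f x) = cnj c * ip M h f"
    using 1 2 3 by (metis complex_cnj_add ip_cnj, metis complex_cnj_diff ip_cnj, metis complex_cnj_mult ip_cnj)
qed

lemma ip_sum:
  assumes "finite J" "\<And>i. i \<in> J \<Longrightarrow> L2 M (f i)" "L2 M h"
  shows "ip M (\<lambda>x. \<Sum>i\<in>J. f i x) h = (\<Sum>i\<in>J. ip M (f i) h)" "ip M h (\<lambda>x. \<Sum>i\<in>J. f i x) = (\<Sum>i\<in>J. ip M h (f i))"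
  unfolding ip_def using assms
  by (simp_all add: sum_distrib_right sum_distrib_left L2_mult_integrable L2_cnj)

lemma ip_self: "ip M f f = complex_of_real (LINT x|M. (cmod (f x))\<^sup>2)"
  unfolding ip_def by (subst integral_complex_of_real[symmetric]) (simp only: complex_norm_square)

text \<open>For a compact group \<open>M\<close> is its Haar measure and \<open>I\<close> the dual.
  For a discrete group the roles are exchanged: \<open>M\<close> is the Haar measure of the dual,
  \<open>I\<close> is the group and \<open>\<phi>\<close> consists of conjugated evaluations.
  Completeness of the system is not part of the locale and enters later through
  \<open>parseval\<close>.\<close>

locale unimodular_system = finite_measure M
  for M :: "'b measure" +
  fixes I :: "'i set" and \<phi> :: "'i \<Rightarrow> 'b \<Rightarrow> complex" and A :: real
  assumes A: "0 < A" "measure M (space M) = A"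
    and phi_measurable: "i \<in> I \<Longrightarrow> \<phi> i \<in> borel_measurable M"
    and phi_norm: "i \<in> I \<Longrightarrow> x \<in> space M \<Longrightarrow> cmod (\<phi> i x) = 1"
    and phi_orth: "i \<in> I \<Longrightarrow> j \<in> I \<Longrightarrow> i \<noteq> j \<Longrightarrow> ip M (\<phi> i) (\<phi> j) = 0"
begin

lemma phi_L2: "i \<in> I \<Longrightarrow> L2 M (\<phi> i)"
  by (rule L2_bounded[where B = 1]) (auto simp: phi_measurable phi_norm)

lemma phi_ip: "i \<in> I \<Longrightarrow> j \<in> I \<Longrightarrow> ip M (\<phi> i) (\<phi> j) = (if i = j then A else 0)"
proof (cases "i = j")
  case True
  assume "i \<in> I"
  have "(LINT x|M. (cmod (\<phi> i x))\<^sup>2) = (LINT x|M. 1)"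
    by (rule Bochner_Integration.integral_cong) (use phi_norm \<open>i \<in> I\<close> in auto)
  then show ?thesis using True A(2) by (simp add: ip_self)
qed (simp add: phi_orth)

text \<open>Completing the square in each coefficient. Keeping the \<open>a i\<close> arbitrary lets
  one identity serve several purposes: the optimal choice \<open>c i / A\<close> gives Bessel's
  inequality and approximation by partial sums, other choices measure how far given coefficients are
  from the true ones.\<close>

lemma square_expansion:
  assumes F: "L2 M F" and J: "finite J" "J \<subseteq> I"
  defines "c \<equiv> \<lambda>i. ip M F (\<phi> i)"
  shows "(LINT x|M. (cmod (F x - (\<Sum>i\<in>J. a i * \<phi> i x)))\<^sup>2)
    = (LINT x|M. (cmod (F x))\<^sup>2) - (\<Sum>i\<in>J. (cmod (c i))\<^sup>2) / A + A * (\<Sum>i\<in>J. (cmod (a i - c i / A))\<^sup>2)"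
proof -
  let ?S = "\<lambda>x. \<Sum>i\<in>J. a i * \<phi> i x"
  have L: "L2 M (\<lambda>x. a i * \<phi> i x)" if "i \<in> J" for i using that J by (intro L2_cmult phi_L2) auto
  have S: "L2 M ?S" using L2_sum[OF J(1) L] .
  have FS: "ip M F ?S = (\<Sum>i\<in>J. cnj (a i) * c i)"
    using J F by (subst ip_sum[OF J(1) L F]) (auto simp: c_def ip_simps(6)[OF phi_L2 F F] intro!: sum.cong)
  have SS: "ip M ?S ?S = (\<Sum>i\<in>J. a i * cnj (a i) * A)"
  proof -
    have "ip M ?S ?S = (\<Sum>i\<in>J. ip M (\<lambda>x. a i * \<phi> i x) ?S)"
      by (rule ip_sum(1)[OF J(1) L S])
    also have "\<dots> = (\<Sum>i\<in>J. \<Sum>j\<in>J. ip M (\<lambda>x. a i * \<phi> i x) (\<lambda>x. a j * \<phi> j x))"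
      by (intro sum.cong refl ip_sum(2)[OF J(1) L L])
    also have "\<dots> = (\<Sum>i\<in>J. \<Sum>j\<in>J. if i = j then a i * cnj (a i) * A else 0)"
    proof (intro sum.cong refl)
      fix i j assume ij: "i \<in> J" "j \<in> J"
      then have I: "L2 M (\<phi> i)" "L2 M (\<phi> j)" "L2 M (\<lambda>x. a j * \<phi> j x)" using J L phi_L2 by auto
      show "ip M (\<lambda>x. a i * \<phi> i x) (\<lambda>x. a j * \<phi> j x) = (if i = j then a i * cnj (a i) * A else 0)"
        unfolding ip_simps(5)[OF I(1,1,3)] ip_simps(6)[OF I(2,2,1)]
        using ij J phi_ip[of i j] by (auto simp: subset_iff)
    qed
    also have "\<dots> = (\<Sum>i\<in>J. a i * cnj (a i) * A)" using J(1) by simp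
    finally show ?thesis .
  qed
  have "complex_of_real (LINT x|M. (cmod (F x - ?S x))\<^sup>2) = ip M (\<lambda>x. F x - ?S x) (\<lambda>x. F x - ?S x)"
    by (simp add: ip_self)
  also have "\<dots> = ip M F F - ip M F ?S - (cnj (ip M F ?S) - ip M ?S ?S)"
    using ip_simps(3)[OF F S L2_diff[OF F S]] ip_simps(4)[OF F S F] ip_simps(4)[OF F S S] by (simp add: ip_cnj)
  also have "\<dots> = ip M F F + (\<Sum>i\<in>J. a i * cnj (a i) * A - cnj (a i) * c i - a i * cnj (c i))"
    by (simp add: FS SS sum.distrib sum_subtractf algebra_simps)
  also have "\<dots> = ip M F F + (\<Sum>i\<in>J. A * ((a i - c i / A) * cnj (a i - c i / A)) - c i * cnj (c i) / A)"
    using A(1) by (intro arg_cong2[where f = plus] sum.cong refl) (simp add: field_simps)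
  also have "\<dots> = complex_of_real ((LINT x|M. (cmod (F x))\<^sup>2) - (\<Sum>i\<in>J. (cmod (c i))\<^sup>2) / A + A * (\<Sum>i\<in>J. (cmod (a i - c i / A))\<^sup>2))"
    unfolding complex_norm_square[symmetric]
    by (simp add: ip_self sum_subtractf sum_distrib_left sum_divide_distrib)
  finally show ?thesis by (simp only: of_real_eq_iff)
qed

lemma bessel:
  assumes "L2 M F" "finite J" "J \<subseteq> I"
  shows "(\<Sum>i\<in>J. (cmod (ip M F (\<phi> i)))\<^sup>2) \<le> A * (LINT x|M. (cmod (F x))\<^sup>2)"
proof -
  have "0 \<le> (LINT x|M. (cmod (F x - (\<Sum>i\<in>J. ip M F (\<phi> i) / A * \<phi> i x)))\<^sup>2)" by simp
  also have "\<dots> = (LINT x|M. (cmod (F x))\<^sup>2) - (\<Sum>i\<in>J. (cmod (ip M F (\<phi> i)))\<^sup>2) / A"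
    by (subst square_expansion[OF assms]) simp
  finally show ?thesis using A(1) by (simp add: field_simps)
qed

text \<open>Interpolation works with the bilinear pairing, since a sesquilinear one would not stay
  holomorphic in a complex parameter. This translates it back to coefficients.\<close>

lemma pairing_cnj: "(LINT x|M. \<phi> i x * h x) = cnj (ip M (\<lambda>x. cnj (h x)) (\<phi> i))"
  unfolding ip_def Bochner_Integration.integral_cnj[symmetric] by (simp add: mult.commute del: Bochner_Integration.integral_cnj)

text \<open>The endpoint of exponent \<open>2\<close>: Cauchy--Schwarz for the finite sum, then
  Bessel's inequality for the coefficients of the conjugate of \<open>h\<close>.\<close>

lemma bilinear_L2_bound:
  assumes h: "L2 M h" and J: "finite J" "J \<subseteq> I"
    and b: "(\<Sum>i\<in>J. (cmod (b i))\<^sup>2) \<le> A" and h1: "(LINT x|M. (cmod (h x))\<^sup>2) \<le> 1"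
  shows "cmod (\<Sum>i\<in>J. b i * (LINT x|M. \<phi> i x * h x)) \<le> A"
proof -
  define d where "d = (\<lambda>i. ip M (\<lambda>x. cnj (h x)) (\<phi> i))"
  have "cmod (\<Sum>i\<in>J. b i * (LINT x|M. \<phi> i x * h x)) \<le> (\<Sum>i\<in>J. cmod (b i) * cmod (d i))"
    unfolding pairing_cnj d_def by (rule order_trans[OF norm_sum]) (simp add: norm_mult)
  also have "\<dots> \<le> L2_set (\<lambda>i. cmod (b i)) J * L2_set (\<lambda>i. cmod (d i)) J"
    using L2_set_mult_ineq[of "\<lambda>i. cmod (b i)" "\<lambda>i. cmod (d i)" J] by simp
  also have "\<dots> \<le> sqrt A * sqrt A"
  proof (intro mult_mono)
    show "L2_set (\<lambda>i. cmod (b i)) J \<le> sqrt A" unfolding L2_set_def using b by simp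
    have "(\<Sum>i\<in>J. (cmod (d i))\<^sup>2) \<le> A * (LINT x|M. (cmod (cnj (h x)))\<^sup>2)"
      unfolding d_def by (rule bessel[OF L2_cnj[OF h] J])
    also have "\<dots> \<le> A * 1" using h1 A(1) by (intro mult_left_mono) auto
    finally show "L2_set (\<lambda>i. cmod (d i)) J \<le> sqrt A" unfolding L2_set_def by simp
  qed (use A in \<open>auto simp: L2_set_nonneg\<close>)
  finally show ?thesis using A(1) by simp
qed

end

section \<open>Riesz--Thorin interpolation\<close>

lemma sgn_mult_norm: "sgn z * complex_of_real (cmod z) = z"
  by (cases "z = 0") (simp_all add: sgn_div_norm scaleR_conv_of_real)

context unimodular_system begin

text \<open>The form is embedded in a family \<open>T w\<close> that equals the normalized form at
  \<open>w = 1/p\<close>. On \<open>Re w = 1\<close> it is bounded by \<open>1\<close> because the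
  \<open>\<phi> i\<close> are unimodular, on \<open>Re w = 1/2\<close> by
  \<open>bilinear_L2_bound\<close>; the three lines theorem does the rest. For simple
  \<open>g\<close> the family is entire.\<close>

lemma bilinear_simple_bound:
  assumes g: "simple_function M g" and J: "finite J" "J \<subseteq> I" and p: "1 < p" "p < 2"
  shows "cmod (\<Sum>i\<in>J. a i * (LINT x|M. \<phi> i x * g x))
    \<le> A * ((\<Sum>i\<in>J. cmod (a i) powr p) / A) powr (1/p) * (LINT x|M. cmod (g x) powr p) powr (1/p)"
proof -
  define S where "S = (\<Sum>i\<in>J. cmod (a i) powr p) / A"
  define G where "G = (LINT x|M. cmod (g x) powr p)"
  have fin: "finite (g ` space M)" using g by (auto simp: simple_function_def)
  have gm [measurable]: "g \<in> borel_measurable M" using g by (rule borel_measurable_simple_function)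
  have simple_int: "integrable M (\<lambda>x. h (g x))" for h :: "complex \<Rightarrow> real"
  proof -
    have "simple_function M (\<lambda>x. h (g x))" using simple_function_compose1[OF g] .
    then show ?thesis
      by (intro integrable_const_bound[where B = "Max ((\<lambda>x. \<bar>h (g x)\<bar>) ` space M)"])
        (use fin in \<open>auto intro!: AE_I2 Max_ge borel_measurable_simple_function simp: image_image[symmetric, of "\<lambda>z. \<bar>h z\<bar>" g]\<close>)
  qed
  have S0: "0 \<le> S" and G0: "0 \<le> G" using A by (auto simp: S_def G_def intro!: sum_nonneg divide_nonneg_pos)
  consider "S = 0" | "G = 0" | "0 < S" "0 < G" using S0 G0 by linarith
  then show ?thesis
  proof cases
    case 1
    then have "(\<Sum>i\<in>J. cmod (a i) powr p) = 0" using A by (simp add: S_def)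
    then have "\<forall>i\<in>J. a i = 0" using J(1) by (subst (asm) sum_nonneg_eq_0_iff) auto
    then show ?thesis by simp
  next
    case 2
    then have "AE x in M. cmod (g x) powr p = 0"
      unfolding G_def using simple_int[of "\<lambda>z. cmod z powr p"] by (subst (asm) integral_nonneg_eq_0_iff_AE) auto
    then have ae: "AE x in M. g x = 0" by eventually_elim simp
    have "(LINT x|M. \<phi> i x * g x) = 0" if "i \<in> J" for i
    proof -
      have "(LINT x|M. \<phi> i x * g x) = (LINT x|M. 0)"
        by (rule integral_cong_AE) (use ae that J phi_measurable in \<open>auto simp: subset_iff\<close>)
      then show ?thesis by simp
    qed
    then show ?thesis using A by simp
  next
    case 3
    \<comment> \<open>Phases and normalized \<open>p\<close>-th powers: \<open>x\<close> sums to
      \<open>A\<close> and \<open>y\<close> has integral \<open>1\<close>, which makes both edge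
      bounds of \<open>T\<close> equal to \<open>1\<close>. The cases \<open>S = 0\<close> and
      \<open>G = 0\<close> had to be removed for this division.\<close>
    define u where "u = (\<lambda>i. sgn (a i))"
    define x where "x = (\<lambda>i. cmod (a i) powr p / S)"
    define v where "v = (\<lambda>t. sgn (g t))"
    define y where "y = (\<lambda>t. cmod (g t) powr p / G)"
    define k where "k = (\<lambda>w t. v t * complex_of_real (y t) powr w)"
    define T where "T = (\<lambda>w. (\<Sum>i\<in>J. u i * complex_of_real (x i) powr w * (LINT t|M. \<phi> i t * k w t)) / complex_of_real A)"
    have x0: "0 \<le> x i" and y0: "0 \<le> y t" for i t using 3 by (auto simp: x_def y_def)
    have u1: "cmod (u i) \<le> 1" and v1: "cmod (v t) \<le> 1" for i t by (auto simp: u_def v_def norm_sgn)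
    have "(\<Sum>i\<in>J. cmod (a i) powr p) = S * A" using A(1) by (simp add: S_def)
    then have xs: "(\<Sum>i\<in>J. x i) = A" using 3 by (simp add: x_def sum_divide_distrib[symmetric])
    have ys: "(LINT t|M. y t) = 1" using 3 by (simp add: y_def G_def)
    have yint: "integrable M y" unfolding y_def by (rule simple_int)
    have km: "k w \<in> borel_measurable M" for w
      unfolding k_def v_def y_def by (rule borel_measurable_simple_function, rule simple_function_compose1[OF g])
    have knorm: "cmod (k w t) \<le> y t powr Re w" for w t
      using mult_right_mono[OF v1[of t], of "y t powr Re w"] y0[of t] by (simp add: k_def norm_mult norm_powr_real_powr)
    have ypint: "integrable M (\<lambda>t. y t powr r)" for r unfolding y_def by (rule simple_int)
    have cnorm: "cmod (u i * complex_of_real (x i) powr w) \<le> x i powr Re w" for w i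
      using mult_right_mono[OF u1[of i], of "x i powr Re w"] x0[of i] by (simp add: norm_mult norm_powr_real_powr)
    have coef: "cmod (LINT t|M. \<phi> i t * k w t) \<le> (LINT t|M. y t powr Re w)" if "i \<in> J" for i w
    proof (rule order_trans[OF integral_norm_bound])
      have "cmod (\<phi> i t * k w t) \<le> y t powr Re w" if "t \<in> space M" for t
        using knorm[of w t] phi_norm[OF _ that, of i] \<open>i \<in> J\<close> J by (auto simp: norm_mult)
      then show "(LINT t|M. cmod (\<phi> i t * k w t)) \<le> (LINT t|M. y t powr Re w)"
        by (intro integral_mono_AE') (use ypint in auto)
    qed
    have Tbound: "cmod (T w) \<le> (\<Sum>i\<in>J. x i powr Re w) * (LINT t|M. y t powr Re w) / A" for w
    proof -
      have "cmod (\<Sum>i\<in>J. u i * complex_of_real (x i) powr w * (LINT t|M. \<phi> i t * k w t))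
        \<le> (\<Sum>i\<in>J. x i powr Re w * (LINT t|M. y t powr Re w))"
        unfolding norm_mult[of "u _ * _"]
        by (rule order_trans[OF norm_sum], rule sum_mono, subst norm_mult, rule mult_mono) (use cnorm coef in auto)
      then show ?thesis using A(1) by (simp add: T_def norm_divide sum_distrib_right divide_right_mono)
    qed
    have "cmod (T (complex_of_real (1/p))) \<le> 1"
    proof (rule three_lines[of T "1/2" 1 "(\<Sum>i\<in>J. 1 + x i) * (LINT t|M. 1 + y t) / A"])
      \<comment> \<open>Sorting the integral by the finitely many values of \<open>g\<close> shows
        \<open>T\<close> to be a finite combination of exponentials in \<open>w\<close>; a base
        equal to \<open>0\<close> contributes \<open>0\<close> for every exponent.\<close>
      have expand: "(LINT t|M. \<phi> i t * k w t)
        = (\<Sum>z\<in>g ` space M. sgn z * complex_of_real (cmod z powr p / G) powr w * (LINT t|M. \<phi> i t * indicator {t\<in>space M. g t = z} t))"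
        if "i \<in> J" for i w
      proof -
        have iint: "integrable M (\<lambda>t. \<phi> i t * indicator {t\<in>space M. g t = z} t)" for z
        proof (rule integrable_const_bound[where B = 1])
          show "(\<lambda>t. \<phi> i t * indicator {t\<in>space M. g t = z} t) \<in> borel_measurable M"
          proof -
            have [measurable]: "\<phi> i \<in> borel_measurable M" using phi_measurable that J by auto
            show ?thesis by measurable
          qed
          show "AE t in M. cmod (\<phi> i t * indicator {t\<in>space M. g t = z} t) \<le> 1"
            using phi_norm[of i] that J by (intro AE_I2) (auto simp: norm_mult indicator_def)
        qed
        have "(LINT t|M. \<phi> i t * k w t) = (LINT t|M. (\<Sum>z\<in>g ` space M. sgn z * complex_of_real (cmod z powr p / G) powr w * (\<phi> i t * indicator {t\<in>space M. g t = z} t)))"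
        proof (rule Bochner_Integration.integral_cong[OF refl])
          fix t assume t: "t \<in> space M"
          have "(\<Sum>z\<in>g ` space M. sgn z * complex_of_real (cmod z powr p / G) powr w * (\<phi> i t * indicator {t\<in>space M. g t = z} t))
            = (\<Sum>z\<in>g ` space M. if z = g t then sgn z * complex_of_real (cmod z powr p / G) powr w * \<phi> i t else 0)"
            using t by (intro sum.cong) (auto simp: indicator_def)
          also have "\<dots> = \<phi> i t * k w t" using t fin by (simp add: k_def v_def y_def)
          finally show "\<phi> i t * k w t = (\<Sum>z\<in>g ` space M. sgn z * complex_of_real (cmod z powr p / G) powr w * (\<phi> i t * indicator {t\<in>space M. g t = z} t))" ..
        qed
        also have "\<dots> = (\<Sum>z\<in>g ` space M. sgn z * complex_of_real (cmod z powr p / G) powr w * (LINT t|M. \<phi> i t * indicator {t\<in>space M. g t = z} t))"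
          using iint by (subst Bochner_Integration.integral_sum) auto
        finally show ?thesis .
      qed
      have T: "T = (\<lambda>w. (\<Sum>i\<in>J. u i * complex_of_real (x i) powr w *
         (\<Sum>z\<in>g ` space M. sgn z * complex_of_real (cmod z powr p / G) powr w * (LINT t|M. \<phi> i t * indicator {t\<in>space M. g t = z} t))) / complex_of_real A)"
        unfolding T_def by (intro ext arg_cong2[where f = divide] sum.cong refl arg_cong2[where f = times] expand)
      show "T holomorphic_on UNIV"
        unfolding T by (intro holomorphic_intros holomorphic_on_powr_right) (use A in auto)
    next
      fix w assume w: "1/2 \<le> Re w" "Re w \<le> 1"
      have "(\<Sum>i\<in>J. x i powr Re w) * (LINT t|M. y t powr Re w) \<le> (\<Sum>i\<in>J. 1 + x i) * (LINT t|M. 1 + y t)"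
      proof (rule mult_mono)
        show "(\<Sum>i\<in>J. x i powr Re w) \<le> (\<Sum>i\<in>J. 1 + x i)"
          using x0 w by (intro sum_mono powr_le_one_plus) auto
        show "(LINT t|M. y t powr Re w) \<le> (LINT t|M. 1 + y t)"
          using y0 w ypint yint by (intro integral_mono powr_le_one_plus) auto
        show "0 \<le> (\<Sum>i\<in>J. 1 + x i)" using x0 by (intro sum_nonneg) (auto intro: add_nonneg_nonneg)
        show "0 \<le> (LINT t|M. y t powr Re w)" by (intro integral_nonneg_AE) auto
      qed
      then show "cmod (T w) \<le> (\<Sum>i\<in>J. 1 + x i) * (LINT t|M. 1 + y t) / A"
        using Tbound[of w] A(1) by (meson divide_right_mono less_imp_le order_trans)
    next
      fix w assume "Re w = 1/2 \<or> Re w = 1"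
      then show "cmod (T w) \<le> 1"
      proof
        assume w: "Re w = 1"
        show ?thesis using Tbound[of w] x0 y0 xs ys A(1) by (simp add: w)
      next
        assume w: "Re w = 1/2"
        have sq: "(r powr Re w)\<^sup>2 = r" if "0 \<le> r" for r :: real
          using that by (simp add: w powr_half_sqrt)
        have "cmod (\<Sum>i\<in>J. u i * complex_of_real (x i) powr w * (LINT t|M. \<phi> i t * k w t)) \<le> A"
        proof (rule bilinear_L2_bound[OF _ J])
          have ksq: "(cmod (k w t))\<^sup>2 \<le> y t" for t
            using power_mono[OF knorm[of w t] norm_ge_zero, of 2] sq[OF y0[of t]] by simp
          show kL: "L2 M (k w)"
            unfolding L2_def
          proof
            show "integrable M (\<lambda>t. (cmod (k w t))\<^sup>2)"
              by (rule Bochner_Integration.integrable_bound[OF yint]) (use km ksq y0 in auto)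
          qed (rule km)
          have "(LINT t|M. (cmod (k w t))\<^sup>2) \<le> (LINT t|M. y t)"
            using kL yint ksq by (intro integral_mono) (auto simp: L2_def)
          then show "(LINT t|M. (cmod (k w t))\<^sup>2) \<le> 1" using ys by simp
          have "(cmod (u i * complex_of_real (x i) powr w))\<^sup>2 \<le> x i" for i
            using power_mono[OF cnorm[of i w] norm_ge_zero, of 2] sq[OF x0[of i]] by simp
          then show "(\<Sum>i\<in>J. (cmod (u i * complex_of_real (x i) powr w))\<^sup>2) \<le> A"
            unfolding xs[symmetric] by (intro sum_mono)
        qed
        then show ?thesis using A(1) by (simp add: T_def norm_divide)
      qed
    qed (use p in \<open>auto simp: field_simps\<close>)
    \<comment> \<open>At \<open>w = 1/p\<close> the \<open>p\<close>-th powers are undone, and the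
      phases restore \<open>a\<close> and \<open>g\<close> up to the normalizing constants.\<close>
    moreover have "T (complex_of_real (1/p)) = (\<Sum>i\<in>J. a i * (LINT t|M. \<phi> i t * g t)) / (A * S powr (1/p) * G powr (1/p))"
    proof -
      have root: "complex_of_real (r powr p / R) powr complex_of_real (1/p) = complex_of_real r / complex_of_real (R powr (1/p))"
        if "0 \<le> r" "0 < R" for r R :: real
        using that p by (subst powr_of_real) (auto simp: powr_divide powr_powr)
      have ux: "u i * complex_of_real (x i) powr complex_of_real (1/p) = a i / complex_of_real (S powr (1/p))" for i
        unfolding x_def u_def using root[of "cmod (a i)" S] 3 sgn_mult_norm[of "a i"] by simp
      have kk: "k (complex_of_real (1/p)) t = g t / complex_of_real (G powr (1/p))" for t
        unfolding k_def v_def y_def using root[of "cmod (g t)" G] 3 sgn_mult_norm[of "g t"] by simp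
      show ?thesis
        unfolding T_def ux kk by (simp add: sum_divide_distrib mult_ac)
    qed
    ultimately have "cmod (\<Sum>i\<in>J. a i * (LINT t|M. \<phi> i t * g t)) / (A * S powr (1/p) * G powr (1/p)) \<le> 1"
      using A(1) by (simp add: norm_divide norm_mult)
    then show ?thesis using 3 A(1) unfolding S_def[symmetric] G_def[symmetric] by (simp add: pos_divide_le_eq)
  qed
qed

lemma powr_p_bound:
  fixes y :: real assumes "0 \<le> y" "0 < p" "p < 2" shows "y powr p \<le> 1 + y\<^sup>2"
  using powr_le_one_plus[of "y\<^sup>2" "p/2"] assms by (simp add: powr_powr flip: powr_numeral)

lemma L2_powr_integrable:
  assumes "L2 M g" "0 < p" "p < 2"
  shows "integrable M (\<lambda>x. cmod (g x) powr p)"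
proof (rule Bochner_Integration.integrable_bound)
  show "integrable M (\<lambda>x. 1 + (cmod (g x))\<^sup>2)" using assms by (auto simp: L2_def)
  have [measurable]: "g \<in> borel_measurable M" using assms by (auto simp: L2_def)
  show "(\<lambda>x. cmod (g x) powr p) \<in> borel_measurable M" by measurable
  show "AE x in M. norm (cmod (g x) powr p) \<le> norm (1 + (cmod (g x))\<^sup>2)"
    using powr_p_bound[OF norm_ge_zero assms(2,3)] by (intro AE_I2) (auto intro: order_trans)
qed

text \<open>Simple functions with \<open>|F n| \<le> 2 * |g|\<close> converge to \<open>g\<close>
  pointwise; on a finite measure space an L^2 function dominates in L^1 and in L^p, so both sides
  pass to the limit.\<close>

lemma bilinear_Lp_bound:
  assumes g: "L2 M g" and J: "finite J" "J \<subseteq> I" and p: "1 < p" "p < 2"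
  shows "cmod (\<Sum>i\<in>J. a i * (LINT x|M. \<phi> i x * g x))
    \<le> A * ((\<Sum>i\<in>J. cmod (a i) powr p) / A) powr (1/p) * (LINT x|M. cmod (g x) powr p) powr (1/p)"
proof -
  have gm [measurable]: "g \<in> borel_measurable M" using g by (auto simp: L2_def)
  obtain F where F: "\<And>n. simple_function M (F n)" "\<And>x. x \<in> space M \<Longrightarrow> (\<lambda>n. F n x) \<longlonglongrightarrow> g x"
    "\<And>n x. x \<in> space M \<Longrightarrow> dist (F n x) 0 \<le> 2 * dist (g x) 0"
    using borel_measurable_implies_sequence_metric[OF gm, of 0] by blast
  have Fm [measurable]: "F n \<in> borel_measurable M" for n using F(1) by (rule borel_measurable_simple_function)
  have c: "(\<lambda>n. LINT x|M. \<phi> i x * F n x) \<longlonglongrightarrow> (LINT x|M. \<phi> i x * g x)" if "i \<in> J" for i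
  proof (rule integral_dominated_convergence[where w = "\<lambda>x. 2 * cmod (g x)"])
    have i: "\<phi> i \<in> borel_measurable M" "\<And>x. x \<in> space M \<Longrightarrow> cmod (\<phi> i x) = 1"
      using that J phi_measurable phi_norm by auto
    show "(\<lambda>x. \<phi> i x * g x) \<in> borel_measurable M" "\<And>n. (\<lambda>x. \<phi> i x * F n x) \<in> borel_measurable M"
      using i(1) by measurable
    show "integrable M (\<lambda>x. 2 * cmod (g x))" using L2_integrable[OF g] by auto
    show "AE x in M. (\<lambda>n. \<phi> i x * F n x) \<longlonglongrightarrow> \<phi> i x * g x"
      using F(2) by (intro AE_I2 tendsto_intros)
    show "\<And>n. AE x in M. norm (\<phi> i x * F n x) \<le> 2 * cmod (g x)"
      using F(3) i(2) by (intro AE_I2) (simp add: norm_mult)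
  qed
  have n: "(\<lambda>n. LINT x|M. cmod (F n x) powr p) \<longlonglongrightarrow> (LINT x|M. cmod (g x) powr p)"
  proof (rule integral_dominated_convergence[where w = "\<lambda>x. 2 powr p * cmod (g x) powr p"])
    show "(\<lambda>x. cmod (g x) powr p) \<in> borel_measurable M" "\<And>n. (\<lambda>x. cmod (F n x) powr p) \<in> borel_measurable M"
      by measurable
    show "integrable M (\<lambda>x. 2 powr p * cmod (g x) powr p)" using L2_powr_integrable[OF g] p by auto
    show "AE x in M. (\<lambda>n. cmod (F n x) powr p) \<longlonglongrightarrow> cmod (g x) powr p"
      using F(2) p by (intro AE_I2 tendsto_powr' tendsto_norm tendsto_const) auto
    show "\<And>n. AE x in M. norm (cmod (F n x) powr p) \<le> 2 powr p * cmod (g x) powr p"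
      using F(3) p by (intro AE_I2) (auto simp: powr_mult[symmetric] intro!: powr_mono2)
  qed
  show ?thesis
  proof (rule LIMSEQ_le)
    show "(\<lambda>n. cmod (\<Sum>i\<in>J. a i * (LINT x|M. \<phi> i x * F n x))) \<longlonglongrightarrow> cmod (\<Sum>i\<in>J. a i * (LINT x|M. \<phi> i x * g x))"
      by (intro tendsto_intros c)
    show "(\<lambda>n. A * ((\<Sum>i\<in>J. cmod (a i) powr p) / A) powr (1/p) * (LINT x|M. cmod (F n x) powr p) powr (1/p))
      \<longlonglongrightarrow> A * ((\<Sum>i\<in>J. cmod (a i) powr p) / A) powr (1/p) * (LINT x|M. cmod (g x) powr p) powr (1/p)"
      using p by (intro tendsto_mult tendsto_const tendsto_powr' n) (auto intro!: always_eventually integral_nonneg_AE)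
    show "\<exists>N. \<forall>n\<ge>N. cmod (\<Sum>i\<in>J. a i * (LINT x|M. \<phi> i x * F n x))
      \<le> A * ((\<Sum>i\<in>J. cmod (a i) powr p) / A) powr (1/p) * (LINT x|M. cmod (F n x) powr p) powr (1/p)"
      using bilinear_simple_bound[OF F(1) J p] by blast
  qed
qed

end

text \<open>The pointwise equality case of Hoelder's inequality: \<open>w\<close> is the dual
  element of \<open>z\<close>, whose \<open>p\<close>-th power and whose pairing with
  \<open>z\<close> both give the \<open>q\<close>-th power of \<open>cmod z\<close>.\<close>

lemma sgn_powr_facts:
  fixes z :: complex and p q :: real
  assumes "1 < p" "1/p + 1/q = 1"
  defines "w \<equiv> sgn z * complex_of_real (cmod z powr (q - 1))"
  shows "cmod w powr p = cmod z powr q" "w * cnj z = complex_of_real (cmod z powr q)" "cnj w * z = complex_of_real (cmod z powr q)"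
    "cmod w = cmod z powr (q - 1)"
proof -
  have q: "q = p / (p - 1)"
  proof -
    have "1 / q = (p - 1) / p" using assms by (simp add: field_simps)
    then have "1 / (1 / q) = 1 / ((p - 1) / p)" by simp
    then show ?thesis by simp
  qed
  have "q - 1 = 1 / (p - 1)" using assms(1) unfolding q by (simp add: field_simps)
  then have qp: "(q - 1) * p = q" unfolding q by simp
  show n: "cmod w = cmod z powr (q - 1)"
    by (cases "z = 0") (auto simp: w_def norm_mult norm_sgn)
  show "cmod w powr p = cmod z powr q"
    unfolding n powr_powr qp ..
  have zz: "sgn z * cnj z = complex_of_real (cmod z)"
    by (cases "z = 0") (simp_all add: sgn_div_norm scaleR_conv_of_real mult.assoc complex_norm_square[symmetric] power2_eq_square)
  have "w * cnj z = (sgn z * cnj z) * complex_of_real (cmod z powr (q - 1))"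
    by (simp add: w_def mult_ac)
  also have "\<dots> = complex_of_real (cmod z powr q)"
    unfolding zz of_real_mult[symmetric] powr_shift[OF norm_ge_zero] ..
  finally show 1: "w * cnj z = complex_of_real (cmod z powr q)" .
  show "cnj w * z = complex_of_real (cmod z powr q)"
    using arg_cong[OF 1, of cnj] by simp
qed

lemma power_mass_cmod: "power_mass M (\<lambda>x. (cmod (F x))\<^sup>2) (p/2) = (\<integral>\<^sup>+x. ennreal (cmod (F x) powr p) \<partial>M)"
proof -
  have "((cmod z)\<^sup>2) powr (p/2) = cmod z powr p" for z
    by (cases "z = 0") (simp_all add: powr_powr flip: powr_numeral)
  then show ?thesis by (simp add: power_mass_def)
qed

text \<open>Testing with the dual element produces \<open>S\<close> on both sides. Dividing by
  \<open>S powr (1/p)\<close> leaves \<open>S powr (1/q)\<close>; this is legitimate because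
  \<open>S\<close> is finite, which is why the estimates are made on finite index sets.\<close>

lemma young_cancel:
  fixes S R :: real
  assumes "0 \<le> S" "0 \<le> R" "1 < p" "1/p + 1/q = 1" "S \<le> S powr (1/p) * R powr (1/p)"
  shows "S \<le> R powr (q/p)"
proof (cases "S = 0")
  case False
  then have S: "S > 0" using assms by simp
  have q1: "1/q = 1 - 1/p" using assms by simp
  have "0 < 1/q" using assms(3) unfolding q1 by simp
  then have q0: "q > 0" by simp
  have "S powr (1/q) = S / S powr (1/p)" unfolding q1 using S by (simp add: powr_diff)
  also have "\<dots> \<le> R powr (1/p)" using assms(5) S by (simp add: pos_divide_le_eq mult.commute)
  finally have "(S powr (1/q)) powr q \<le> (R powr (1/p)) powr q" using q0 by (intro powr_mono2) auto
  then show ?thesis using S q0 by (simp add: powr_powr)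
qed simp

section \<open>Hausdorff--Young for coefficients and for synthesis\<close>

context unimodular_system begin

definition coeff_measure :: "'i measure" where
  "coeff_measure = scale_measure (ennreal (1/A)) (count_space I)"

lemma nn_integral_coeff: "(\<integral>\<^sup>+i. f i \<partial>coeff_measure) = ennreal (1/A) * (\<integral>\<^sup>+i. f i \<partial>count_space I)"
  unfolding coeff_measure_def by (rule nn_integral_scale_measure) simp

lemma nn_integral_coeff_le:
  assumes "\<And>J. finite J \<Longrightarrow> J \<subseteq> I \<Longrightarrow> (\<Sum>i\<in>J. f i) / A \<le> C" and f: "\<And>i. 0 \<le> f i"
  shows "(\<integral>\<^sup>+i. ennreal (f i) \<partial>coeff_measure) \<le> ennreal C"
proof -
  have "(\<integral>\<^sup>+i. ennreal (f i) \<partial>count_space I) \<le> ennreal (A * C)"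
  proof (rule nn_integral_count_space_le)
    fix J assume J: "finite J" "J \<subseteq> I"
    have "(\<Sum>i\<in>J. ennreal (f i)) = ennreal (\<Sum>i\<in>J. f i)" using f by (simp add: sum_ennreal)
    also have "\<dots> \<le> ennreal (A * C)" using assms(1)[OF J] A(1) by (intro ennreal_leI) (simp add: field_simps)
    finally show "(\<Sum>i\<in>J. ennreal (f i)) \<le> ennreal (A * C)" .
  qed
  then have "ennreal (1/A) * (\<integral>\<^sup>+i. ennreal (f i) \<partial>count_space I) \<le> ennreal (1/A) * ennreal (A * C)"
    by (intro mult_left_mono) auto
  also have "\<dots> = ennreal C" using A(1) by (simp add: ennreal_mult'[symmetric])
  finally show ?thesis by (simp add: nn_integral_coeff)
qed

lemma sum_le_nn_integral_coeff:
  assumes "finite J" "J \<subseteq> I" and f: "\<And>i. 0 \<le> f i"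
  shows "ennreal ((\<Sum>i\<in>J. f i) / A) \<le> (\<integral>\<^sup>+i. ennreal (f i) \<partial>coeff_measure)"
proof -
  have "ennreal ((\<Sum>i\<in>J. f i) / A) = ennreal (1/A) * (\<Sum>i\<in>J. ennreal (f i))"
    using A(1) f by (simp add: sum_ennreal sum_nonneg ennreal_mult[symmetric])
  also have "(\<Sum>i\<in>J. ennreal (f i)) = (\<integral>\<^sup>+i. ennreal (f i) \<partial>count_space J)"
    using assms(1) by (simp add: nn_integral_count_space_finite)
  also have "\<dots> = (\<integral>\<^sup>+i. ennreal (f i) * indicator J i \<partial>count_space I)"
    using assms(2) by (subst nn_integral_restrict_space[symmetric]) (auto simp: restrict_count_space Int_absorb2)
  also have "\<dots> \<le> (\<integral>\<^sup>+i. ennreal (f i) \<partial>count_space I)"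
    by (intro nn_integral_mono) (auto simp: indicator_def)
  finally show ?thesis by (simp add: nn_integral_coeff mult_left_mono)
qed

definition coeff :: "('b \<Rightarrow> complex) \<Rightarrow> 'i \<Rightarrow> complex" where
  "coeff F i = ip M F (\<phi> i)"

text \<open>Duality on a finite set \<open>J\<close>: the coefficients are tested with their own
  dual elements in \<open>bilinear_Lp_bound\<close>, the common power is cancelled, and the bound is
  uniform in \<open>J\<close>.\<close>

lemma hausdorff_young_coeff:
  assumes F: "L2 M F"
  shows "hausdorff_young M (\<lambda>x. (cmod (F x))\<^sup>2) coeff_measure (\<lambda>i. (cmod (coeff F i))\<^sup>2)"
  unfolding hausdorff_young_def power_mass_cmod
proof (intro allI impI, elim conjE)
  fix p q R :: real
  assume p: "1 < p" "p < 2" "1/p + 1/q = 1" and R: "0 < R" "(\<integral>\<^sup>+x. ennreal (cmod (F x) powr p) \<partial>M) = ennreal R"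
  have int: "integrable M (\<lambda>x. cmod (F x) powr p)" using L2_powr_integrable[OF F] p by auto
  have RI: "(LINT x|M. cmod (F x) powr p) = R"
    using R nn_integral_eq_integral[OF int] by (simp add: integral_nonneg_AE)
  show "(\<integral>\<^sup>+i. ennreal (cmod (coeff F i) powr q) \<partial>coeff_measure) \<le> ennreal (R powr (q/p))"
  proof (rule nn_integral_coeff_le)
    fix J assume J: "finite J" "J \<subseteq> I"
    define S where "S = (\<Sum>i\<in>J. cmod (coeff F i) powr q) / A"
    have S0: "0 \<le> S" unfolding S_def using A(1) by (intro divide_nonneg_pos sum_nonneg) auto
    define a where "a = (\<lambda>i. sgn (coeff F i) * complex_of_real (cmod (coeff F i) powr (q - 1)))"
    note facts = sgn_powr_facts[OF p(1,3)]
    have "(\<Sum>i\<in>J. a i * (LINT x|M. \<phi> i x * cnj (F x))) = (\<Sum>i\<in>J. complex_of_real (cmod (coeff F i) powr q))"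
      unfolding pairing_cnj complex_cnj_cnj coeff_def[symmetric] a_def facts(2) ..
    also have "\<dots> = complex_of_real (A * S)" using A(1) by (simp add: S_def)
    finally have "cmod (\<Sum>i\<in>J. a i * (LINT x|M. \<phi> i x * cnj (F x))) = A * S"
      using A(1) S0 by (simp only: norm_of_real) simp
    moreover have "(\<Sum>i\<in>J. cmod (a i) powr p) / A = S"
      unfolding S_def a_def facts(1) ..
    ultimately have "A * S \<le> A * S powr (1/p) * R powr (1/p)"
      using bilinear_Lp_bound[OF L2_cnj[OF F] J p(1,2), of a] RI by simp
    then have "S \<le> S powr (1/p) * R powr (1/p)" using A(1) by (simp add: mult.assoc)
    then show "(\<Sum>i\<in>J. cmod (coeff F i) powr q) / A \<le> R powr (q/p)"
      using young_cancel[OF S0 _ p(1,3)] R(1) unfolding S_def by simp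
  qed simp
qed

text \<open>The reverse inequality holds for the partial sums by duality; \<open>F\<close> is their limit almost everywhere
  along a subsequence, and Fatou's lemma concludes.\<close>

lemma partial_sum_bound:
  fixes c :: "'i \<Rightarrow> complex"
  assumes J: "finite J" "J \<subseteq> I" and p: "1 < p" "p < 2" "1/p + 1/q = 1"
  defines "f \<equiv> \<lambda>x. \<Sum>i\<in>J. c i / complex_of_real A * \<phi> i x"
  shows "(\<integral>\<^sup>+x. ennreal (cmod (f x) powr q) \<partial>M) \<le> ennreal (((\<Sum>i\<in>J. cmod (c i) powr p) / A) powr (q/p))"
proof -
  define S where "S = (\<Sum>i\<in>J. cmod (c i) powr p) / A"
  have S0: "0 \<le> S" unfolding S_def using A(1) by (intro divide_nonneg_pos sum_nonneg) auto
  have [measurable]: "f \<in> borel_measurable M" unfolding f_def using phi_measurable J by (auto simp: subset_iff)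
  \<comment> \<open>A finite sum of unimodular functions is bounded. This puts the dual function
    \<open>g\<close> into L^2 and makes \<open>R\<close> finite before it is cancelled.\<close>
  define B where "B = (\<Sum>i\<in>J. cmod (c i) / A)"
  have fB: "cmod (f x) \<le> B" if "x \<in> space M" for x
    unfolding f_def B_def by (rule order_trans[OF norm_sum], rule sum_mono) (use phi_norm that A J in \<open>auto simp: norm_mult norm_divide\<close>)
  note c = conjugate_exponent[OF p]
  note facts = sgn_powr_facts[OF p(1,3)]
  define g where "g = (\<lambda>x. cnj (sgn (f x) * complex_of_real (cmod (f x) powr (q - 1))))"
  have gm [measurable]: "g \<in> borel_measurable M" unfolding g_def by measurable
  have gL: "L2 M g"
  proof (rule L2_bounded)
    fix x assume "x \<in> space M"
    then show "cmod (g x) \<le> B powr (q - 1)"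
      unfolding g_def complex_mod_cnj facts(4) using fB c by (intro powr_mono2) auto
  qed fact
  have int: "integrable M (\<lambda>x. cmod (f x) powr q)"
    by (rule integrable_const_bound[where B = "B powr q"]) (use fB c in \<open>auto intro!: AE_I2 powr_mono2\<close>)
  define R where "R = (LINT x|M. cmod (f x) powr q)"
  have R0: "0 \<le> R" unfolding R_def by (intro integral_nonneg_AE) auto
  have "(\<Sum>i\<in>J. c i / complex_of_real A * (LINT x|M. \<phi> i x * g x)) = (LINT x|M. f x * g x)"
  proof -
    have "integrable M (\<lambda>x. \<phi> i x * g x)" if "i \<in> J" for i
      using that J by (intro L2_mult_integrable gL phi_L2) auto
    then show ?thesis unfolding f_def sum_distrib_right mult.assoc by (subst Bochner_Integration.integral_sum) auto
  qed
  also have "\<dots> = (LINT x|M. complex_of_real (cmod (f x) powr q))"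
  proof (rule Bochner_Integration.integral_cong[OF refl])
    fix x show "f x * g x = complex_of_real (cmod (f x) powr q)"
      using facts(3)[of "f x"] by (simp add: g_def mult.commute)
  qed
  also have "\<dots> = complex_of_real R" unfolding R_def by (rule integral_complex_of_real)
  finally have "(\<Sum>i\<in>J. c i / complex_of_real A * (LINT x|M. \<phi> i x * g x)) = complex_of_real R" .
  then have "(\<Sum>i\<in>J. c i * (LINT x|M. \<phi> i x * g x)) = complex_of_real (A * R)"
    using A(1) by (simp add: sum_divide_distrib[symmetric] field_simps)
  then have "cmod (\<Sum>i\<in>J. c i * (LINT x|M. \<phi> i x * g x)) = A * R" using A(1) R0 by (simp only: norm_of_real) simp
  moreover have "(LINT x|M. cmod (g x) powr p) = R"
    unfolding R_def g_def complex_mod_cnj facts(1) ..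
  ultimately have "A * R \<le> A * S powr (1/p) * R powr (1/p)"
    using bilinear_Lp_bound[OF gL J p(1,2), of c] unfolding S_def by simp
  then have "R \<le> R powr (1/p) * S powr (1/p)" using A(1) by (simp add: mult.assoc mult.commute)
  then have "R \<le> S powr (q/p)" by (rule young_cancel[OF R0 S0 p(1,3)])
  moreover have "(\<integral>\<^sup>+x. ennreal (cmod (f x) powr q) \<partial>M) = ennreal R"
    unfolding R_def by (rule nn_integral_eq_integral[OF int]) simp
  ultimately show ?thesis by (simp add: S_def ennreal_leI)
qed

text \<open>A property of a single function and not of the system: in the discrete setting it is
  obtained only for the transform under consideration.\<close>

definition parseval :: "('b \<Rightarrow> complex) \<Rightarrow> bool" where
  "parseval F \<longleftrightarrow> (\<integral>\<^sup>+i. ennreal ((cmod (coeff F i))\<^sup>2) \<partial>coeff_measure) = (\<integral>\<^sup>+x. ennreal ((cmod (F x))\<^sup>2) \<partial>M)"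

lemma parseval_approx:
  assumes F: "L2 M F" and P: "parseval F" and e: "0 < e"
  obtains J where "finite J" "J \<subseteq> I"
    "(LINT x|M. (cmod (F x - (\<Sum>i\<in>J. coeff F i / complex_of_real A * \<phi> i x)))\<^sup>2) < e"
proof -
  define R where "R = (LINT x|M. (cmod (F x))\<^sup>2)"
  have N: "(\<integral>\<^sup>+x. ennreal ((cmod (F x))\<^sup>2) \<partial>M) = ennreal R"
    unfolding R_def using F by (intro nn_integral_eq_integral) (auto simp: L2_def)
  have "\<exists>J. finite J \<and> J \<subseteq> I \<and> (\<Sum>i\<in>J. (cmod (coeff F i))\<^sup>2) / A > R - e"
  proof (rule ccontr)
    assume *: "\<not> ?thesis"
    have "(\<integral>\<^sup>+i. ennreal ((cmod (coeff F i))\<^sup>2) \<partial>coeff_measure) \<le> ennreal (R - e)"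
      by (rule nn_integral_coeff_le) (use * in \<open>auto simp: not_less\<close>)
    then have le: "ennreal R \<le> ennreal (R - e)" using P N by (simp add: parseval_def)
    \<comment> \<open>The empty set is one of the finite sets in the negated claim; the sign keeps
      \<open>ennreal\<close> from truncating \<open>R - e\<close>.\<close>
    have "0 \<le> R - e" using * by (auto dest!: spec[of _ "{}"])
    then show False using le e by (simp add: ennreal_le_iff)
  qed
  then obtain J where J: "finite J" "J \<subseteq> I" "(\<Sum>i\<in>J. (cmod (coeff F i))\<^sup>2) / A > R - e" by blast
  show thesis
  proof (rule that[OF J(1,2)])
    show "(LINT x|M. (cmod (F x - (\<Sum>i\<in>J. coeff F i / complex_of_real A * \<phi> i x)))\<^sup>2) < e"
      unfolding square_expansion[OF F J(1,2)] using J(3) by (simp add: coeff_def R_def)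
  qed
qed

lemma hausdorff_young_synthesis:
  assumes F: "L2 M F" and P: "parseval F"
  shows "hausdorff_young coeff_measure (\<lambda>i. (cmod (coeff F i))\<^sup>2) M (\<lambda>x. (cmod (F x))\<^sup>2)"
  unfolding hausdorff_young_def power_mass_cmod
proof (intro allI impI, elim conjE)
  fix p q R :: real
  assume p: "1 < p" "p < 2" "1/p + 1/q = 1"
    and R: "0 < R" "(\<integral>\<^sup>+i. ennreal (cmod (coeff F i) powr p) \<partial>coeff_measure) = ennreal R"
  note c = conjugate_exponent[OF p]
  have Fm [measurable]: "F \<in> borel_measurable M" using F by (simp add: L2_def)
  have "\<exists>J. \<forall>n. finite (J n) \<and> J n \<subseteq> I \<and>
    (LINT x|M. (cmod (F x - (\<Sum>i\<in>J n. coeff F i / complex_of_real A * \<phi> i x)))\<^sup>2) < 1 / real (Suc n)"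
  proof (intro choice allI)
    fix n
    show "\<exists>K. finite K \<and> K \<subseteq> I \<and>
      (LINT x|M. (cmod (F x - (\<Sum>i\<in>K. coeff F i / complex_of_real A * \<phi> i x)))\<^sup>2) < 1 / real (Suc n)"
      by (rule parseval_approx[OF F P, of "1 / real (Suc n)"]) auto
  qed
  then obtain J where J: "\<And>n. finite (J n)" "\<And>n. J n \<subseteq> I"
    "\<And>n. (LINT x|M. (cmod (F x - (\<Sum>i\<in>J n. coeff F i / complex_of_real A * \<phi> i x)))\<^sup>2) < 1 / real (Suc n)"
    by blast
  define s where "s = (\<lambda>n x. \<Sum>i\<in>J n. coeff F i / complex_of_real A * \<phi> i x)"
  have sL: "L2 M (s n)" for n
    unfolding s_def using J by (intro L2_sum L2_cmult phi_L2) auto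
  have sm [measurable]: "s n \<in> borel_measurable M" for n using sL by (simp add: L2_def)
  have "(\<lambda>n. LINT x|M. norm ((cmod (F x - s n x))\<^sup>2)) \<longlonglongrightarrow> 0"
  proof (rule tendsto_sandwich[OF _ _ tendsto_const LIMSEQ_inverse_real_of_nat])
    show "\<forall>\<^sub>F n in sequentially. (LINT x|M. norm ((cmod (F x - s n x))\<^sup>2)) \<le> inverse (real (Suc n))"
    proof (intro always_eventually allI)
      fix n show "(LINT x|M. norm ((cmod (F x - s n x))\<^sup>2)) \<le> inverse (real (Suc n))"
        using less_imp_le[OF J(3)[of n]] by (simp add: s_def inverse_eq_divide)
    qed
  qed (auto intro!: always_eventually integral_nonneg_AE)
  moreover have "integrable M (\<lambda>x. (cmod (F x - s n x))\<^sup>2)" for n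
    using L2_diff[OF F sL] by (simp add: L2_def)
  ultimately have "\<exists>r. strict_mono r \<and> (AE x in M. (\<lambda>n. (cmod (F x - s (r n) x))\<^sup>2) \<longlonglongrightarrow> 0)"
    using tendsto_L1_AE_subseq[of M "\<lambda>n x. (cmod (F x - s n x))\<^sup>2"] by blast
  then obtain r where r: "strict_mono r" "AE x in M. (\<lambda>n. (cmod (F x - s (r n) x))\<^sup>2) \<longlonglongrightarrow> 0"
    by blast
  have "(\<integral>\<^sup>+x. ennreal (cmod (F x) powr q) \<partial>M) = (\<integral>\<^sup>+x. liminf (\<lambda>n. ennreal (cmod (s (r n) x) powr q)) \<partial>M)"
  proof (rule nn_integral_cong_AE)
    show "AE x in M. ennreal (cmod (F x) powr q) = liminf (\<lambda>n. ennreal (cmod (s (r n) x) powr q))"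
      using r(2)
    proof eventually_elim
      case (elim x)
      then have "(\<lambda>n. sqrt ((cmod (F x - s (r n) x))\<^sup>2)) \<longlonglongrightarrow> sqrt 0" by (rule tendsto_real_sqrt)
      then have "(\<lambda>n. F x - s (r n) x) \<longlonglongrightarrow> 0" by (simp add: tendsto_norm_zero_iff)
      then have "(\<lambda>n. F x - (F x - s (r n) x)) \<longlonglongrightarrow> F x - 0" by (intro tendsto_intros)
      then have "(\<lambda>n. s (r n) x) \<longlonglongrightarrow> F x" by simp
      then have "(\<lambda>n. ennreal (cmod (s (r n) x) powr q)) \<longlonglongrightarrow> ennreal (cmod (F x) powr q)"
        using c(2) by (intro tendsto_ennrealI tendsto_powr' tendsto_norm tendsto_const) auto
      then show ?case by (rule lim_imp_Liminf[OF sequentially_bot, symmetric])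
    qed
  qed
  also have "\<dots> \<le> liminf (\<lambda>n. \<integral>\<^sup>+x. ennreal (cmod (s (r n) x) powr q) \<partial>M)"
    by (rule nn_integral_liminf) measurable
  also have "\<dots> \<le> liminf (\<lambda>n. ennreal (R powr (q/p)))"
  proof (intro Liminf_mono always_eventually allI)
    fix n
    have "ennreal ((\<Sum>i\<in>J (r n). cmod (coeff F i) powr p) / A) \<le> ennreal R"
      unfolding R(2)[symmetric] using J by (intro sum_le_nn_integral_coeff) auto
    then have "(\<Sum>i\<in>J (r n). cmod (coeff F i) powr p) / A \<le> R" using R(1) by (subst (asm) ennreal_le_iff) auto
    then have "((\<Sum>i\<in>J (r n). cmod (coeff F i) powr p) / A) powr (q/p) \<le> R powr (q/p)"
      using A(1) p c by (intro powr_mono2) (auto intro!: divide_nonneg_pos sum_nonneg)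
    then show "(\<integral>\<^sup>+x. ennreal (cmod (s (r n) x) powr q) \<partial>M) \<le> ennreal (R powr (q/p))"
      using partial_sum_bound[OF J(1)[of "r n"] J(2)[of "r n"] p, of "coeff F"] unfolding s_def
      by (meson ennreal_leI order_trans)
  qed
  also have "\<dots> = ennreal (R powr (q/p))" by (simp add: Liminf_const)
  finally show "(\<integral>\<^sup>+x. ennreal (cmod (F x) powr q) \<partial>M) \<le> ennreal (R powr (q/p))" .
qed

theorem coeff_entropy_sum:
  assumes F: "L2 M F" and P: "parseval F" and one: "(\<integral>\<^sup>+x. ennreal ((cmod (F x))\<^sup>2) \<partial>M) = 1"
    and pq: "0 < p" "0 < q" "1/p + 1/q \<ge> 1"
    and def: "\<not> (renyi_entropy M (\<lambda>x. (cmod (F x))\<^sup>2) (p/2) = \<infinity> \<and> renyi_entropy coeff_measure (\<lambda>i. (cmod (coeff F i))\<^sup>2) (q/2) = - \<infinity>)"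
      "\<not> (renyi_entropy M (\<lambda>x. (cmod (F x))\<^sup>2) (p/2) = - \<infinity> \<and> renyi_entropy coeff_measure (\<lambda>i. (cmod (coeff F i))\<^sup>2) (q/2) = \<infinity>)"
  shows "0 \<le> renyi_entropy M (\<lambda>x. (cmod (F x))\<^sup>2) (p/2) + renyi_entropy coeff_measure (\<lambda>i. (cmod (coeff F i))\<^sup>2) (q/2)"
proof (rule entropy_sum_nonneg)
  let ?g = "\<lambda>i. (cmod (coeff F i))\<^sup>2"
  have Fm [measurable]: "F \<in> borel_measurable M" using F by (simp add: L2_def)
  have meas: "?g \<in> borel_measurable coeff_measure" 
    unfolding coeff_measure_def by (auto simp: measurable_def space_scale_measure)
  have g1: "(\<integral>\<^sup>+i. ennreal (?g i) \<partial>coeff_measure) = 1" using P one by (simp add: parseval_def)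
  show "finite_measure M" by (rule finite_measure_axioms)
  show "unit_density M (\<lambda>x. (cmod (F x))\<^sup>2)" using one by (simp add: unit_density_def)
  show "unit_density coeff_measure ?g" using meas g1 by (simp add: unit_density_def)
  show "hausdorff_young M (\<lambda>x. (cmod (F x))\<^sup>2) coeff_measure ?g" by (rule hausdorff_young_coeff[OF F])
  show "hausdorff_young coeff_measure ?g M (\<lambda>x. (cmod (F x))\<^sup>2)" by (rule hausdorff_young_synthesis[OF F P])
  \<comment> \<open>Total mass \<open>1\<close> and atoms of mass \<open>1 / A\<close> bound the
    density by \<open>A\<close>. Hence \<open>?g * ln ?g\<close> is at most
    \<open>\<bar>ln A\<bar> * ?g\<close>, which makes the negative part of the Shannon entropy
    finite.\<close>
  have bound: "?g i \<le> A" if "i \<in> I" for i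
  proof -
    have "ennreal (?g i / A) \<le> ennreal 1"
      using sum_le_nn_integral_coeff[of "{i}" ?g] that g1 by simp
    then show ?thesis using A(1) by (subst (asm) ennreal_le_iff) (auto simp: pos_divide_le_eq)
  qed
  have "(\<integral>\<^sup>+i. ennreal (?g i * ln (?g i)) \<partial>coeff_measure) \<le> (\<integral>\<^sup>+i. ennreal \<bar>ln A\<bar> * ennreal (?g i) \<partial>coeff_measure)"
  proof (rule nn_integral_mono)
    fix i assume "i \<in> space coeff_measure"
    then have i: "i \<in> I" by (simp add: coeff_measure_def space_scale_measure)
    have "?g i * ln (?g i) \<le> \<bar>ln A\<bar> * ?g i"
    proof (cases "?g i = 0")
      case False
      then have "ln (?g i) \<le> ln A" using bound[OF i] by (subst ln_le_cancel_iff) (auto intro: A(1))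
      then have "ln (?g i) \<le> \<bar>ln A\<bar>" by simp
      then show ?thesis by (subst mult.commute) (rule mult_right_mono, auto)
    qed simp
    then show "ennreal (?g i * ln (?g i)) \<le> ennreal \<bar>ln A\<bar> * ennreal (?g i)"
      by (subst ennreal_mult'[symmetric]) (auto intro: ennreal_leI)
  qed
  also have "\<dots> = ennreal \<bar>ln A\<bar>" using meas g1 by (subst nn_integral_cmult) auto
  finally have "(\<integral>\<^sup>+i. ennreal (?g i * ln (?g i)) \<partial>coeff_measure) \<noteq> \<infinity>"
    by (metis ennreal_less_top infinity_ennreal_def leD)
  then show "shannon_neg coeff_measure ?g < \<infinity>"
    unfolding shannon_neg_def by (cases "\<integral>\<^sup>+i. ennreal (?g i * ln (?g i)) \<partial>coeff_measure") auto
qed (use pq def in auto)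

end

section \<open>Characters of discrete groups\<close>

primrec nat_multiple :: "nat \<Rightarrow> 'a::ab_group_add \<Rightarrow> 'a" where
  "nat_multiple 0 y = 0"
| "nat_multiple (Suc n) y = y + nat_multiple n y"

lemma nat_multiple_add: "nat_multiple (m + n) y = nat_multiple m y + nat_multiple n y"
  by (induction m) (auto simp: add.assoc)

lemma nat_multiple_mult: "nat_multiple (m * n) y = nat_multiple m (nat_multiple n y)"
  by (induction m) (auto simp: nat_multiple_add)

text \<open>The graph of a unimodular character of a subgroup.\<close>

definition partial_character :: "('a::ab_group_add \<times> complex) set \<Rightarrow> bool" where
  "partial_character G \<longleftrightarrow> (0, 1) \<in> G \<and> (\<forall>x z y w. (x, z) \<in> G \<and> (y, w) \<in> G \<longrightarrow> (x - y, z / w) \<in> G) \<and>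
     (\<forall>x z. (x, z) \<in> G \<longrightarrow> cmod z = 1) \<and> (\<forall>z. (0, z) \<in> G \<longrightarrow> z = 1)"

lemma partial_characterD:
  assumes "partial_character G"
  shows "(0, 1) \<in> G" "(x, z) \<in> G \<Longrightarrow> (y, w) \<in> G \<Longrightarrow> (x - y, z / w) \<in> G"
    "(x, z) \<in> G \<Longrightarrow> cmod z = 1" "(0, z) \<in> G \<Longrightarrow> z = 1"
    "(x, z) \<in> G \<Longrightarrow> (y, w) \<in> G \<Longrightarrow> (x + y, z * w) \<in> G"
    "(x, z) \<in> G \<Longrightarrow> (nat_multiple n x, z ^ n) \<in> G"
    "(x, z) \<in> G \<Longrightarrow> (x, w) \<in> G \<Longrightarrow> z = w"
proof -
  show 1: "(0, 1) \<in> G" and 2: "\<And>x z y w. (x, z) \<in> G \<Longrightarrow> (y, w) \<in> G \<Longrightarrow> (x - y, z / w) \<in> G"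
    and 3: "\<And>x z. (x, z) \<in> G \<Longrightarrow> cmod z = 1" and 4: "\<And>z. (0, z) \<in> G \<Longrightarrow> z = 1"
    using assms unfolding partial_character_def by blast+
  show 5: "(x + y, z * w) \<in> G" if "(x, z) \<in> G" "(y, w) \<in> G" for x y z w
    using 2[OF that(1) 2[OF 1 that(2)]] by simp
  show "(nat_multiple n x, z ^ n) \<in> G" if "(x, z) \<in> G"
    by (induction n) (auto intro: 1 5 that)
  show "z = w" if "(x, z) \<in> G" "(x, w) \<in> G"
  proof -
    have "(0, z / w) \<in> G" using 2[OF that] by simp
    then have "z / w = 1" by (rule 4)
    then show ?thesis by (auto simp: divide_eq_1_iff)
  qed
qed

text \<open>Extension to the subgroup generated by the domain and \<open>y\<close>. The value
  \<open>w\<close> at \<open>y\<close> is consistent exactly if it agrees with \<open>G\<close> on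
  those multiples of \<open>y\<close> that already lie in the domain; this is what makes the new
  graph single-valued at \<open>0\<close>.\<close>

lemma partial_character_extend:
  fixes y :: "'a::ab_group_add"
  assumes G: "partial_character G" and w: "cmod w = 1"
    and comp: "\<And>n z. (nat_multiple n y, z) \<in> G \<Longrightarrow> z = w ^ n"
  obtains H where "partial_character H" "G \<subseteq> H" "(y, w) \<in> H"
proof
  note D = partial_characterD[OF G]
  have w0: "w \<noteq> 0" using w by auto
  \<comment> \<open>Integer multiples of \<open>y\<close> appear as differences of natural
    multiples, and integer powers of \<open>w\<close> as quotients.\<close>
  define H where "H = {(x + nat_multiple m y - nat_multiple n y, z * w ^ m / w ^ n) |x z m n. (x, z) \<in> G}"
  have HI: "(x', z') \<in> H" if "(x, z) \<in> G" "x' = x + nat_multiple m y - nat_multiple n y" "z' = z * w ^ m / w ^ n" for x z m n x' z'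
    using that unfolding H_def by blast
  show "G \<subseteq> H"
  proof clarify
    fix x z assume "(x, z) \<in> G"
    then show "(x, z) \<in> H" by (rule HI[of _ _ _ 0 0]) auto
  qed
  show "(y, w) \<in> H" by (rule HI[OF D(1), of _ 1 0]) auto
  show "partial_character H"
    unfolding partial_character_def
  proof (intro conjI allI impI, goal_cases)
    case 1
    show ?case by (rule HI[OF D(1), of _ 0 0]) auto
  next
    case (2 x z x' z')
    then obtain a c m n a' c' m' n' where *: "(a, c) \<in> G" "x = a + nat_multiple m y - nat_multiple n y" "z = c * w ^ m / w ^ n"
      "(a', c') \<in> G" "x' = a' + nat_multiple m' y - nat_multiple n' y" "z' = c' * w ^ m' / w ^ n'"
      unfolding H_def by blast
    have "c' \<noteq> 0" using D(3)[OF *(4)] by auto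
    then show ?case
    proof (intro HI[OF D(2)[OF *(1,4)], of _ "m + n'" "n + m'"])
      show "x - x' = a - a' + nat_multiple (m + n') y - nat_multiple (n + m') y"
        unfolding *(2,5) nat_multiple_add by (simp add: algebra_simps)
      show "z / z' = c / c' * w ^ (m + n') / w ^ (n + m')"
        unfolding *(3,6) power_add using w0 \<open>c' \<noteq> 0\<close> by (simp add: mult_ac)
    qed
  next
    case (3 x z)
    then obtain a c m n where *: "(a, c) \<in> G" "z = c * w ^ m / w ^ n" unfolding H_def by blast
    then show ?case using D(3)[OF *(1)] w by (simp add: norm_mult norm_divide norm_power)
  next
    case (4 z)
    then obtain a c m n where *: "(a, c) \<in> G" "0 = a + nat_multiple m y - nat_multiple n y" "z = c * w ^ m / w ^ n"
      unfolding H_def by blast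
    have c0: "c \<noteq> 0" using D(3)[OF *(1)] by auto
    have "c * w ^ m = w ^ n"
    proof (cases "m \<le> n")
      case True
      then obtain k where k: "n = m + k" using le_Suc_ex by blast
      then have "a = nat_multiple k y" using *(2) by (simp add: nat_multiple_add algebra_simps)
      then have "c = w ^ k" using comp *(1) by blast
      then show ?thesis by (simp add: k power_add mult.commute)
    next
      case False
      then obtain k where k: "m = n + k" using le_Suc_ex nat_le_linear by blast
      then have "a + nat_multiple k y = 0" using *(2) by (simp add: nat_multiple_add algebra_simps)
      then have "nat_multiple k y = 0 - a" using minus_unique[of a "nat_multiple k y"] by simp
      then have "1 / c = w ^ k" using comp D(2)[OF D(1) *(1)] by metis
      then have "1 = c * w ^ k" using c0 by (simp add: field_simps)
      then show ?thesis by (simp add: k power_add algebra_simps)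
    qed
    then show ?case using *(3) w0 by simp
  qed
qed

lemma unimodular_root:
  assumes "cmod v = 1" "0 < d"
  obtains w where "cmod w = 1" "w ^ d = v"
proof
  show "cmod (cis (Arg v / real d)) = 1" by simp
  have "cis (Arg v / real d) ^ d = cis (real d * (Arg v / real d))" by (rule Complex.DeMoivre)
  also have "\<dots> = cis (Arg v)" using assms(2) by simp
  also have "\<dots> = v" using assms(1) by (subst cis_Arg) (auto simp: sgn_div_norm)
  finally show "cis (Arg v / real d) ^ d = v" .
qed

text \<open>Division with remainder: the natural multiples of \<open>y\<close> in the domain are the
  multiples of the least positive one, so consistency has to be checked only at
  \<open>d\<close>.\<close>

lemma compatible_value:
  fixes y :: "'a::ab_group_add"
  assumes G: "partial_character G" and d: "0 < d" "(nat_multiple d y, w ^ d) \<in> G"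
    and least: "\<And>n z. 0 < n \<Longrightarrow> n < d \<Longrightarrow> (nat_multiple n y, z) \<notin> G"
    and n: "(nat_multiple n y, z) \<in> G"
  shows "z = w ^ n"
proof -
  note D = partial_characterD[OF G]
  have nd: "n = n div d * d + n mod d" by simp
  have md: "(nat_multiple (n div d * d) y, w ^ (n div d * d)) \<in> G"
    using D(6)[OF d(2), of "n div d"] unfolding nat_multiple_mult power_mult[symmetric] by (simp only: mult.commute[of d])
  have "(nat_multiple (n mod d) y, z / w ^ (n div d * d)) \<in> G"
    using D(2)[OF n md] nat_multiple_add[of "n div d * d" "n mod d" y] by simp
  then have "n mod d = 0" using least[of "n mod d"] d(1) by (metis gr0I mod_less_divisor)
  then have "n div d * d = n" by auto
  then show ?thesis using D(7)[OF n] md by metis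
qed

text \<open>The circle is divisible: the value prescribed at \<open>nat_multiple d y\<close> for the
  least \<open>d\<close> has a unimodular \<open>d\<close>-th root. If no positive multiple of
  \<open>y\<close> lies in the domain, no value is prescribed and \<open>1\<close> is taken.\<close>

lemma partial_character_extend_any:
  fixes y :: "'a::ab_group_add"
  assumes G: "partial_character G"
  obtains H w where "partial_character H" "G \<subseteq> H" "(y, w) \<in> H"
proof (cases "\<exists>n z. 0 < n \<and> (nat_multiple n y, z) \<in> G")
  case True
  define d where "d = (LEAST n. 0 < n \<and> (\<exists>z. (nat_multiple n y, z) \<in> G))"
  have d: "0 < d \<and> (\<exists>z. (nat_multiple d y, z) \<in> G)" unfolding d_def by (rule LeastI_ex) (use True in auto)
  have least: "(nat_multiple n y, z) \<notin> G" if "0 < n" "n < d" for n z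
    using not_less_Least[of n "\<lambda>n. 0 < n \<and> (\<exists>z. (nat_multiple n y, z) \<in> G)"] that unfolding d_def by auto
  from d obtain v where v: "(nat_multiple d y, v) \<in> G" by blast
  obtain w where w: "cmod w = 1" "w ^ d = v"
    using unimodular_root[OF partial_characterD(3)[OF G v]] d by blast
  have vG: "(nat_multiple d y, w ^ d) \<in> G" using v w(2) by simp
  have d0: "0 < d" using d by simp
  obtain H where "partial_character H" "G \<subseteq> H" "(y, w) \<in> H"
    by (rule partial_character_extend[OF G w(1) compatible_value[OF G d0 vG least]])
  then show ?thesis by (rule that)
next
  case False
  have comp: "z = 1 ^ n" if "(nat_multiple n y, z) \<in> G" for n z
  proof -
    have "n = 0" using that False by (metis gr0I)
    then show ?thesis using that partial_characterD(4)[OF G, of z] by simp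
  qed
  obtain H where "partial_character H" "G \<subseteq> H" "(y, 1) \<in> H"
    by (rule partial_character_extend[OF G norm_one comp])
  then show ?thesis by (rule that)
qed

text \<open>If \<open>y\<close> has finite order \<open>d\<close>, then \<open>d \<ge> 2\<close> and
  the first \<open>d\<close>-th root of unity is a value different from \<open>1\<close>; by
  \<open>compatible_value\<close> it fits all relations of \<open>y\<close>. For infinite order
  there are no relations and \<open>-1\<close> is taken.\<close>

lemma partial_character_start:
  fixes y :: "'a::ab_group_add"
  assumes "y \<noteq> 0"
  obtains H w where "partial_character H" "(y, w) \<in> H" "w \<noteq> 1"
proof -
  have G: "partial_character {(0::'a, 1)}" by (auto simp: partial_character_def)
  have "\<exists>w. cmod w = 1 \<and> w \<noteq> 1 \<and> (\<forall>n. nat_multiple n y = 0 \<longrightarrow> w ^ n = 1)"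
  proof (cases "\<exists>n. 0 < n \<and> nat_multiple n y = 0")
    case True
    define d where "d = (LEAST n. 0 < n \<and> nat_multiple n y = 0)"
    have d: "0 < d \<and> nat_multiple d y = 0" unfolding d_def by (rule LeastI_ex) (use True in auto)
    have least: "nat_multiple n y \<noteq> 0" if "0 < n" "n < d" for n
      using not_less_Least[of n "\<lambda>n. 0 < n \<and> nat_multiple n y = 0"] that unfolding d_def by auto
    have "d \<noteq> 1" using d assms by auto
    then have d2: "2 \<le> d" using d by linarith
    define w where "w = cis (2 * pi / real d)"
    have "w ^ d = 1" using d unfolding w_def by (simp add: Complex.DeMoivre)
    have "w \<noteq> 1"
    proof
      assume "w = 1"
      then have "cos (2 * pi / real d) = 1" by (simp add: w_def cis.ctr complex_eq_iff)
      moreover have "cos (2 * pi / real d) < cos 0 \<or> d = 2"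
      proof (cases "d = 2")
        case False
        then have "2 * pi / real d \<le> pi" using d2 by (simp add: pos_divide_le_eq)
        then show ?thesis using d by (intro disjI1 cos_monotone_0_pi) auto
      qed simp
      ultimately show False by auto
    qed
    moreover have "w ^ n = 1" if "nat_multiple n y = 0" for n
      using compatible_value[OF G, of d y w n 1] d least that \<open>w ^ d = 1\<close> by auto
    ultimately show ?thesis by (intro exI[of _ w]) (auto simp: w_def)
  next
    case False
    then have "(-1) ^ n = (1::complex)" if "nat_multiple n y = 0" for n using that by (metis gr0I power_0)
    then show ?thesis by (intro exI[of _ "-1"]) auto
  qed
  then obtain w where w: "cmod w = 1" "w \<noteq> 1" "\<And>n. nat_multiple n y = 0 \<Longrightarrow> w ^ n = 1" by blast
  obtain H where "partial_character H" "{(0, 1)} \<subseteq> H" "(y, w) \<in> H"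
    by (rule partial_character_extend[OF G w(1), of y]) (use w(3) in auto)
  then show thesis using w(2) that by blast
qed

text \<open>Zorn's lemma among the graphs that extend the one from
  \<open>partial_character_start\<close>: a maximal graph is total, since it could be extended
  otherwise, and it keeps the value at \<open>y\<close>.\<close>

lemma character_separation:
  fixes y :: "'a::ab_group_add"
  assumes "y \<noteq> 0"
  obtains c where "\<And>x x'. c (x + x') = c x * c x'" "\<And>x. cmod (c x) = 1" "c y \<noteq> 1"
proof -
  obtain H0 w where H0: "partial_character H0" "(y, w) \<in> H0" "w \<noteq> 1" by (rule partial_character_start[OF assms])
  let ?S = "{H. partial_character H \<and> H0 \<subseteq> H}"
  have "\<exists>G\<in>?S. \<forall>X\<in>?S. G \<subseteq> X \<longrightarrow> X = G"
  proof (rule subset_Zorn_nonempty)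
    show "?S \<noteq> {}" using H0 by blast
    fix C assume C: "C \<noteq> {}" "subset.chain ?S C"
    then have mem: "\<And>H. H \<in> C \<Longrightarrow> partial_character H \<and> H0 \<subseteq> H" and
      lin: "\<And>H K. H \<in> C \<Longrightarrow> K \<in> C \<Longrightarrow> H \<subseteq> K \<or> K \<subseteq> H"
      by (auto simp: subset_chain_def)
    obtain H1 where H1: "H1 \<in> C" using C by blast
    have "partial_character (\<Union>C)"
      unfolding partial_character_def
    proof (intro conjI allI impI, goal_cases)
      case 1
      then show ?case using H1 mem partial_characterD(1) by blast
    next
      case (2 x z x' z')
      then obtain H K where "H \<in> C" "K \<in> C" "(x, z) \<in> H" "(x', z') \<in> K" by blast
      then obtain L where "L \<in> C" "(x, z) \<in> L" "(x', z') \<in> L" using lin[of H K] by blast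
      then show ?case using partial_characterD(2) mem by blast
    next
      case (3 x z)
      then show ?case using partial_characterD(3) mem by blast
    next
      case (4 z)
      then show ?case using partial_characterD(4) mem by blast
    qed
    then show "\<Union>C \<in> ?S" using H1 mem by blast
  qed
  then obtain G where GS: "G \<in> ?S" "\<forall>X\<in>?S. G \<subseteq> X \<longrightarrow> X = G" by (rule bexE)
  then have G: "partial_character G" "H0 \<subseteq> G" by auto
  have max: "X = G" if "partial_character X" "G \<subseteq> X" for X
    using GS(2) that G(2) by auto
  have total: "\<exists>z. (x, z) \<in> G" for x
  proof (rule partial_character_extend_any[OF G(1), of x])
    fix H w assume "partial_character H" "G \<subseteq> H" "(x, w) \<in> H"
    then show ?thesis using max[of H] by auto
  qed
  define c where "c = (\<lambda>x. SOME z. (x, z) \<in> G)"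
  have c: "(x, c x) \<in> G" for x unfolding c_def by (rule someI_ex[OF total])
  note D = partial_characterD[OF G(1)]
  show thesis
  proof (rule that[of c])
    show "c (x + x') = c x * c x'" for x x' using D(7)[OF c D(5)[OF c c]] .
    show "cmod (c x) = 1" for x using D(3)[OF c] .
    show "c y \<noteq> 1" using D(7)[OF c, of y w] G(2) H0 by auto
  qed
qed

section \<open>The discrete setting\<close>

text \<open>Invariance in \<open>is_haar\<close> is about images of sets. The preimage under
  translation by \<open>x\<close> is the image under translation by its inverse \<open>x'\<close>,
  so the translation preserves \<open>M\<close>. The operation is a parameter because the lemma
  serves both the group and its dual.\<close>

lemma haar_integral_shift:
  fixes f :: "'g::topological_space \<Rightarrow> 'b::{banach,second_countable_topology}"
  assumes H: "is_haar S gop M" and x: "x \<in> S" "x' \<in> S"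
    and closed: "\<And>y. y \<in> S \<Longrightarrow> gop x y \<in> S" "\<And>y. y \<in> S \<Longrightarrow> gop x' y \<in> S"
    and inv: "\<And>y. y \<in> S \<Longrightarrow> gop x (gop x' y) = y" "\<And>y. y \<in> S \<Longrightarrow> gop x' (gop x y) = y"
    and f: "f \<in> borel_measurable M"
  shows "(LINT y|M. f (gop x y)) = (LINT y|M. f y)"
proof -
  have sp: "space M = S" and invariant: "\<And>B. B \<in> sets M \<Longrightarrow> gop x' ` B \<in> sets M \<and> emeasure M (gop x' ` B) = emeasure M B"
    using H x(2) unfolding is_haar_def by auto
  have vim: "gop x -` B \<inter> space M = gop x' ` B" if "B \<in> sets M" for B
  proof -
    have "B \<subseteq> S" using sets.sets_into_space[OF that] sp by simp
    show ?thesis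
    proof (intro equalityI subsetI)
      fix y assume "y \<in> gop x -` B \<inter> space M"
      then have "y = gop x' (gop x y)" "gop x y \<in> B" using inv(2) sp by auto
      then show "y \<in> gop x' ` B" by (rule image_eqI)
    next
      fix y assume "y \<in> gop x' ` B"
      then obtain b where "b \<in> B" "y = gop x' b" by blast
      then show "y \<in> gop x -` B \<inter> space M" using \<open>B \<subseteq> S\<close> closed(2) inv(1) sp by auto
    qed
  qed
  have meas: "gop x \<in> measurable M M"
    using closed(1) sp vim invariant by (intro measurableI) auto
  have "distr M M (gop x) = M"
    by (rule measure_eqI) (use meas vim invariant in \<open>auto simp: emeasure_distr\<close>)
  then have "(LINT y|M. f y) = (LINT y|distr M M (gop x). f y)" by simp
  also have "\<dots> = (LINT y|M. f (gop x y))" using meas f by (rule integral_distr)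
  finally show ?thesis ..
qed

context unimodular_system begin

text \<open>The assumption \<open>lim\<close> is what \<open>is_fourier_L2\<close> gives for
  truncations of \<open>c\<close> to finite sets. By \<open>square_expansion\<close> the L^2
  distance of a partial sum from \<open>\<Psi>\<close> bounds the error of every coefficient in it,
  so the coefficients of \<open>\<Psi>\<close> are \<open>c\<close>; the same expansion then gives
  the norm in the limit.\<close>

lemma synthesis_limit:
  assumes \<Psi>: "L2 M \<Psi>" and c1: "(\<integral>\<^sup>+i. ennreal ((cmod (c i))\<^sup>2) \<partial>coeff_measure) = 1"
    and lim: "\<And>J. (\<And>n. finite (J n)) \<Longrightarrow> (\<And>n. J n \<subseteq> I) \<Longrightarrow>
      (\<lambda>n. \<integral>\<^sup>+i. ennreal ((cmod (c i * indicator (J n) i - c i))\<^sup>2) \<partial>coeff_measure) \<longlonglongrightarrow> 0 \<Longrightarrow>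
      (\<lambda>n. \<integral>\<^sup>+x. ennreal ((cmod ((\<Sum>i\<in>J n. c i / complex_of_real A * \<phi> i x) - \<Psi> x))\<^sup>2) \<partial>M) \<longlonglongrightarrow> 0"
  shows "\<And>i. i \<in> I \<Longrightarrow> coeff \<Psi> i = c i" "(\<integral>\<^sup>+x. ennreal ((cmod (\<Psi> x))\<^sup>2) \<partial>M) = 1" "parseval \<Psi>"
proof -
  have "\<exists>J. finite J \<and> J \<subseteq> I \<and> (\<Sum>i\<in>J. (cmod (c i))\<^sup>2) / A > 1 - e" if "0 < e" "e \<le> 1" for e
  proof (rule ccontr)
    assume *: "\<not> ?thesis"
    have "(\<integral>\<^sup>+i. ennreal ((cmod (c i))\<^sup>2) \<partial>coeff_measure) \<le> ennreal (1 - e)"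
      by (rule nn_integral_coeff_le) (use * in \<open>auto simp: not_less\<close>)
    then have "ennreal 1 \<le> ennreal (1 - e)" using c1 by simp
    then show False using that by (subst (asm) ennreal_le_iff) auto
  qed
  then have "\<exists>J. \<forall>n. finite (J n) \<and> J n \<subseteq> I \<and> (\<Sum>i\<in>J n. (cmod (c i))\<^sup>2) / A > 1 - 1 / real (Suc n)"
    by (intro choice allI) auto
  then obtain J0 where J0: "\<And>n. finite (J0 n)" "\<And>n. J0 n \<subseteq> I" "\<And>n. (\<Sum>i\<in>J0 n. (cmod (c i))\<^sup>2) / A > 1 - 1 / real (Suc n)"
    by blast
  have main: "coeff \<Psi> i0 = c i0 \<and> ((\<forall>i\<in>I. coeff \<Psi> i = c i) \<longrightarrow> (LINT x|M. (cmod (\<Psi> x))\<^sup>2) = 1)" if i0: "i0 \<in> I" for i0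
  proof -
    \<comment> \<open>The index under consideration is put into every set, so that its coefficient
      error is bounded by \<open>D n\<close> for all \<open>n\<close>.\<close>
    define J where "J = (\<lambda>n. insert i0 (J0 n))"
    have J: "finite (J n)" "J n \<subseteq> I" for n using J0 i0 by (auto simp: J_def)
    define S where "S = (\<lambda>n. (\<Sum>i\<in>J n. (cmod (c i))\<^sup>2) / A)"
    have Slow: "S n > 1 - 1 / real (Suc n)" for n
    proof -
      have "(\<Sum>i\<in>J0 n. (cmod (c i))\<^sup>2) \<le> (\<Sum>i\<in>J n. (cmod (c i))\<^sup>2)"
        using J by (intro sum_mono2) (auto simp: J_def)
      then show ?thesis using J0(3)[of n] A(1) unfolding S_def by (meson divide_right_mono less_imp_le less_le_trans)
    qed
    have Sup: "S n \<le> 1" for n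
      using sum_le_nn_integral_coeff[OF J, of "\<lambda>i. (cmod (c i))\<^sup>2"] c1
      unfolding S_def by (simp add: ennreal_le_1)
    have Slim: "S \<longlonglongrightarrow> 1"
    proof (rule tendsto_sandwich[OF _ _ _ tendsto_const])
      show "(\<lambda>n. 1 - 1 / real (Suc n)) \<longlonglongrightarrow> 1" by real_asymp
    qed (use Slow Sup in \<open>auto intro!: always_eventually less_imp_le\<close>)
    have split: "(\<integral>\<^sup>+i. ennreal ((cmod (c i * indicator (J n) i - c i))\<^sup>2) \<partial>coeff_measure) = ennreal (1 - S n)" for n
    proof -
      have m: "f \<in> borel_measurable coeff_measure" for f :: "'i \<Rightarrow> ennreal"
        unfolding coeff_measure_def by (auto simp: measurable_def space_scale_measure)
      have "(\<integral>\<^sup>+i. ennreal ((cmod (c i))\<^sup>2) \<partial>coeff_measure)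
        = (\<integral>\<^sup>+i. ennreal ((cmod (c i * indicator (J n) i - c i))\<^sup>2) + ennreal ((cmod (c i))\<^sup>2) * indicator (J n) i \<partial>coeff_measure)"
        by (rule nn_integral_cong) (auto simp: indicator_def)
      also have "\<dots> = (\<integral>\<^sup>+i. ennreal ((cmod (c i * indicator (J n) i - c i))\<^sup>2) \<partial>coeff_measure)
          + (\<integral>\<^sup>+i. ennreal ((cmod (c i))\<^sup>2) * indicator (J n) i \<partial>coeff_measure)"
        by (rule nn_integral_add) (rule m)+
      also have "(\<integral>\<^sup>+i. ennreal ((cmod (c i))\<^sup>2) * indicator (J n) i \<partial>coeff_measure) = ennreal (S n)"
      proof -
        have "(\<integral>\<^sup>+i. ennreal ((cmod (c i))\<^sup>2) * indicator (J n) i \<partial>count_space I) = (\<Sum>i\<in>J n. ennreal ((cmod (c i))\<^sup>2) * indicator (J n) i)"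
          using J by (intro nn_integral_count_space') auto
        also have "\<dots> = ennreal (\<Sum>i\<in>J n. (cmod (c i))\<^sup>2)" by (simp add: sum_ennreal)
        finally show ?thesis using A(1) by (simp add: nn_integral_coeff S_def ennreal_mult[symmetric] sum_nonneg)
      qed
      finally have "1 = (\<integral>\<^sup>+i. ennreal ((cmod (c i * indicator (J n) i - c i))\<^sup>2) \<partial>coeff_measure) + ennreal (S n)"
        using c1 by simp
      then have "(\<integral>\<^sup>+i. ennreal ((cmod (c i * indicator (J n) i - c i))\<^sup>2) \<partial>coeff_measure) = 1 - ennreal (S n)"
        by (metis ennreal_add_diff_cancel_right ennreal_neq_top)
      then show ?thesis using A(1) by (simp add: S_def ennreal_minus[symmetric] sum_nonneg flip: ennreal_1)
    qed
    have "(\<lambda>n. ennreal (1 - S n)) \<longlonglongrightarrow> ennreal (1 - 1)"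
      by (intro tendsto_ennrealI tendsto_intros Slim)
    then have conv: "(\<lambda>n. \<integral>\<^sup>+x. ennreal ((cmod ((\<Sum>i\<in>J n. c i / complex_of_real A * \<phi> i x) - \<Psi> x))\<^sup>2) \<partial>M) \<longlonglongrightarrow> 0"
      by (intro lim J) (simp add: split)
    define D where "D = (\<lambda>n. LINT x|M. (cmod (\<Psi> x - (\<Sum>i\<in>J n. c i / complex_of_real A * \<phi> i x)))\<^sup>2)"
    have Dn: "(\<integral>\<^sup>+x. ennreal ((cmod ((\<Sum>i\<in>J n. c i / complex_of_real A * \<phi> i x) - \<Psi> x))\<^sup>2) \<partial>M) = ennreal (D n)" for n
    proof -
      have "L2 M (\<lambda>x. \<Psi> x - (\<Sum>i\<in>J n. c i / complex_of_real A * \<phi> i x))"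
        using J by (intro L2_diff[OF \<Psi>] L2_sum L2_cmult phi_L2) auto
      then show ?thesis
        unfolding D_def by (subst norm_minus_commute, intro nn_integral_eq_integral) (auto simp: L2_def)
    qed
    have D0: "0 \<le> D n" for n unfolding D_def by (intro integral_nonneg_AE) auto
    have "(\<lambda>n. enn2real (ennreal (D n))) \<longlonglongrightarrow> enn2real 0"
      using conv unfolding Dn by (intro tendsto_enn2real) auto
    then have Dlim: "D \<longlonglongrightarrow> 0" using D0 by simp
    let ?R = "LINT x|M. (cmod (\<Psi> x))\<^sup>2"
    have exp: "D n = ?R - (\<Sum>i\<in>J n. (cmod (coeff \<Psi> i))\<^sup>2) / A + A * (\<Sum>i\<in>J n. (cmod (c i / A - coeff \<Psi> i / A))\<^sup>2)" for n
      unfolding D_def coeff_def by (rule square_expansion[OF \<Psi> J])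
    have bes: "(\<Sum>i\<in>J n. (cmod (coeff \<Psi> i))\<^sup>2) / A \<le> ?R" for n
      using bessel[OF \<Psi> J, of n] A(1) by (simp add: coeff_def pos_divide_le_eq mult.commute)
    have each: "A * (cmod (c i / A - coeff \<Psi> i / A))\<^sup>2 \<le> D n" if "i \<in> J n" for i n
    proof -
      have "(cmod (c i / A - coeff \<Psi> i / A))\<^sup>2 \<le> (\<Sum>i\<in>J n. (cmod (c i / A - coeff \<Psi> i / A))\<^sup>2)"
        using J that by (intro member_le_sum) auto
      then have "A * (cmod (c i / A - coeff \<Psi> i / A))\<^sup>2 \<le> A * (\<Sum>i\<in>J n. (cmod (c i / A - coeff \<Psi> i / A))\<^sup>2)"
        using A(1) by (intro mult_left_mono) auto
      then show ?thesis using exp[of n] bes[of n] by linarith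
    qed
    have eq: "coeff \<Psi> i0 = c i0"
    proof -
      have "A * (cmod (c i0 / A - coeff \<Psi> i0 / A))\<^sup>2 \<le> 0"
        by (rule LIMSEQ_le_const[OF Dlim]) (use each[of i0] in \<open>auto simp: J_def\<close>)
      then have "(cmod (c i0 / A - coeff \<Psi> i0 / A))\<^sup>2 \<le> 0" using A(1) by (simp add: mult_le_0_iff)
      then have "c i0 / A - coeff \<Psi> i0 / A = 0" by simp
      then show ?thesis using A(1) by simp
    qed
    have "?R = 1" if all: "\<forall>i\<in>I. coeff \<Psi> i = c i"
    proof -
      have "D = (\<lambda>n. ?R - S n)"
      proof
        fix n show "D n = ?R - S n"
        unfolding exp S_def using J(2)[of n] all by (simp add: subset_iff cong: sum.cong)
      qed
      then have "(\<lambda>n. ?R - S n) \<longlonglongrightarrow> 0" using Dlim by simp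
      moreover have "(\<lambda>n. ?R - S n) \<longlonglongrightarrow> ?R - 1" by (intro tendsto_intros Slim)
      ultimately have "?R - 1 = 0" by (rule LIMSEQ_unique[symmetric])
      then show ?thesis by simp
    qed
    with eq show ?thesis by blast
  qed
  show 1: "\<And>i. i \<in> I \<Longrightarrow> coeff \<Psi> i = c i" using main by blast
  \<comment> \<open>The norm identity was derived inside \<open>main\<close>, relative to an index
    \<open>i0\<close>, so one index must exist.\<close>
  have "I \<noteq> {}"
  proof
    assume "I = {}"
    then have "(\<integral>\<^sup>+i. ennreal ((cmod (c i))\<^sup>2) \<partial>coeff_measure) = 0"
      unfolding nn_integral_coeff by (simp add: nn_integral_count_space_finite)
    then show False using c1 by simp
  qed
  then have R: "(LINT x|M. (cmod (\<Psi> x))\<^sup>2) = 1" using main by blast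
  show 2: "(\<integral>\<^sup>+x. ennreal ((cmod (\<Psi> x))\<^sup>2) \<partial>M) = 1"
    using \<Psi> R by (subst nn_integral_eq_integral) (auto simp: L2_def)
  have "(\<integral>\<^sup>+i. ennreal ((cmod (coeff \<Psi> i))\<^sup>2) \<partial>coeff_measure) = 1"
    unfolding c1[symmetric] by (rule nn_integral_cong) (simp add: coeff_measure_def space_scale_measure 1)
  then show "parseval \<Psi>" unfolding parseval_def 2 .
qed

end

section \<open>From the transform to coefficients on a discrete group\<close>

lemma lhs_defined_uncertainty:
  assumes "lhs_defined \<alpha> \<alpha>h \<psi> \<Psi> p q"
  shows "\<not> (renyi_entropy \<alpha> (\<lambda>x. (cmod (\<psi> x))\<^sup>2) (p/2) = \<infinity> \<and> renyi_entropy \<alpha>h (\<lambda>x. (cmod (\<Psi> x))\<^sup>2) (q/2) = - \<infinity>)"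
    "\<not> (renyi_entropy \<alpha> (\<lambda>x. (cmod (\<psi> x))\<^sup>2) (p/2) = - \<infinity> \<and> renyi_entropy \<alpha>h (\<lambda>x. (cmod (\<Psi> x))\<^sup>2) (q/2) = \<infinity>)"
  using assms by (auto simp: lhs_defined_def)

lemma renyi_entropy_cong:
  assumes "\<And>x. x \<in> space M \<Longrightarrow> f x = g x"
  shows "renyi_entropy M f s = renyi_entropy M g s"
proof -
  have "(\<integral>\<^sup>+x. ennreal (h (f x)) \<partial>M) = (\<integral>\<^sup>+x. ennreal (h (g x)) \<partial>M)" for h :: "real \<Rightarrow> real"
    by (rule nn_integral_cong) (simp add: assms)
  from this[of "\<lambda>y. y powr s"] this[of "\<lambda>y. - (y * ln y)"] this[of "\<lambda>y. y * ln y"] show ?thesis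
    by (simp add: renyi_entropy_def shannon_pos_def shannon_neg_def)
qed

text \<open>Uniform densities on sets of reciprocal masses \<open>a\<close> and \<open>1 / a\<close>
  have entropies \<open>ln a\<close> and \<open>- ln a\<close> for every order.\<close>

lemma uncertainty_const:
  assumes B: "B \<in> sets \<alpha>" "emeasure \<alpha> B = ennreal a" and C: "C \<in> sets \<alpha>h" "emeasure \<alpha>h C = ennreal (1 / a)"
    and a: "0 < a"
    and f: "AE x in \<alpha>. (cmod (\<psi> x))\<^sup>2 = (if x \<in> B then 1 / a else 0)"
    and g: "AE x in \<alpha>h. (cmod (\<Psi> x))\<^sup>2 = (if x \<in> C then a else 0)"
  shows "lhs_defined \<alpha> \<alpha>h \<psi> \<Psi> p q" "uncertainty_lhs \<alpha> \<alpha>h \<psi> \<Psi> p q = 0"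
proof -
  have f': "renyi_entropy \<alpha> (\<lambda>x. (cmod (\<psi> x))\<^sup>2) s = ereal (ln a)" "entropy_defined \<alpha> (\<lambda>x. (cmod (\<psi> x))\<^sup>2) s" for s
    using renyi_const[OF B(1) _ _ f] B(2) a by (auto simp: ln_div)
  have g': "renyi_entropy \<alpha>h (\<lambda>x. (cmod (\<Psi> x))\<^sup>2) s = ereal (- ln a)" "entropy_defined \<alpha>h (\<lambda>x. (cmod (\<Psi> x))\<^sup>2) s" for s
    using renyi_const[OF C a g] by auto
  show "lhs_defined \<alpha> \<alpha>h \<psi> \<Psi> p q" "uncertainty_lhs \<alpha> \<alpha>h \<psi> \<Psi> p q = 0"
    using f' g' by (simp_all add: lhs_defined_def uncertainty_lhs_def)
qed

text \<open>For \<open>\<psi>\<close> in both spaces the constant sequence is an admissible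
  approximation, and its transforms converge only to their own value.\<close>

lemma fourier_L2_eq_AE:
  assumes F: "is_fourier_L2 \<alpha> \<alpha>h \<psi> \<Psi>" and \<psi>: "integrable \<alpha> \<psi>" "L2 \<alpha> \<psi>"
    and m: "fourier_L1 \<alpha> \<psi> \<in> borel_measurable \<alpha>h"
  shows "AE \<gamma> in \<alpha>h. \<Psi> \<gamma> = fourier_L1 \<alpha> \<psi> \<gamma>"
proof -
  have [measurable]: "\<Psi> \<in> borel_measurable \<alpha>h" "fourier_L1 \<alpha> \<psi> \<in> borel_measurable \<alpha>h"
    using F m by (auto simp: is_fourier_L2_def L2_def)
  have "(\<lambda>n::nat. \<integral>\<^sup>+\<gamma>. ennreal ((cmod (fourier_L1 \<alpha> \<psi> \<gamma> - \<Psi> \<gamma>))^2) \<partial>\<alpha>h) \<longlonglongrightarrow> 0"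
    using F \<psi> unfolding is_fourier_L2_def by (auto dest!: spec[of _ "\<lambda>_. \<psi>"])
  then have "(\<integral>\<^sup>+\<gamma>. ennreal ((cmod (fourier_L1 \<alpha> \<psi> \<gamma> - \<Psi> \<gamma>))^2) \<partial>\<alpha>h) = 0"
    by (simp add: LIMSEQ_const_iff)
  then have "AE \<gamma> in \<alpha>h. ennreal ((cmod (fourier_L1 \<alpha> \<psi> \<gamma> - \<Psi> \<gamma>))^2) = 0"
    by (subst (asm) nn_integral_0_iff_AE) auto
  then show ?thesis by eventually_elim (simp add: ennreal_eq_0_iff)
qed

lemma dual_groupD:
  fixes \<gamma> :: "'a::{ab_group_add,topological_space} \<Rightarrow> complex"
  assumes "\<gamma> \<in> dual_group"
  shows "continuous_on UNIV \<gamma>" "\<gamma> (x + y) = \<gamma> x * \<gamma> y" "cmod (\<gamma> x) = 1" "\<gamma> 0 = 1" "\<gamma> (- x) = cnj (\<gamma> x)"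
    "cnj (\<gamma> x) * \<gamma> x = 1" "\<gamma> (x - y) = \<gamma> x * cnj (\<gamma> y)"
proof -
  show "continuous_on UNIV \<gamma>" and mult: "\<And>x y. \<gamma> (x + y) = \<gamma> x * \<gamma> y" and one: "\<And>x. cmod (\<gamma> x) = 1"
    using assms by (auto simp: dual_group_def)
  show cc: "cnj (\<gamma> x) * \<gamma> x = 1" for x using complex_norm_square[of "\<gamma> x"] one[of x] by (simp add: mult.commute)
  have "\<gamma> 0 \<noteq> 0" using one[of 0] by auto
  then show z: "\<gamma> 0 = 1" using mult[of 0 0] by simp
  show m: "\<gamma> (- x) = cnj (\<gamma> x)" for x
  proof -
    have "\<gamma> (- x) * \<gamma> x = cnj (\<gamma> x) * \<gamma> x" using mult[of "- x" x] z cc[of x] by simp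
    moreover have "\<gamma> x \<noteq> 0" using one[of x] by auto
    ultimately show ?thesis by simp
  qed
  show "\<gamma> (x - y) = \<gamma> x * cnj (\<gamma> y)" using mult[of x "- y"] m[of y] by simp
qed

text \<open>The evaluations are conjugated so that the coefficient of \<open>\<Psi>\<close> at
  \<open>x\<close> is the integral of \<open>\<Psi> \<gamma> * \<gamma> x\<close>, i.e. the
  inversion integral. Orthogonality follows from invariance of the Haar measure under a character
  that separates the two points.\<close>

lemma discrete_system:
  fixes \<alpha> :: "'a::{ab_group_add,t2_space} measure"
  assumes open_sing: "\<And>x::'a. open {x}" and c: "0 < c"
    and haar: "is_haar dual_group (\<lambda>g1 g2 x. g1 x * g2 x) \<alpha>h" and mass: "emeasure \<alpha>h dual_group = ennreal (1 / c)"
  shows "unimodular_system \<alpha>h (UNIV :: 'a set) (\<lambda>x \<gamma>. cnj (\<gamma> x)) (1 / c)"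
proof -
  have sp: "space \<alpha>h = dual_group" and st: "sets \<alpha>h = sets (restrict_space borel dual_group)"
    using haar by (auto simp: is_haar_def)
  have meas: "(\<lambda>\<gamma>. \<gamma> x) \<in> borel_measurable \<alpha>h" for x :: 'a
  proof -
    have "(\<lambda>\<gamma>::'a \<Rightarrow> complex. \<gamma> x) \<in> borel_measurable borel"
      by (rule borel_measurable_continuous_onI) (rule continuous_on_product_coordinates)
    then have "(\<lambda>\<gamma>::'a \<Rightarrow> complex. \<gamma> x) \<in> borel_measurable (restrict_space borel dual_group)"
      by (rule measurable_restrict_space1)
    then show ?thesis using st measurable_cong_sets by blast
  qed
  interpret finite_measure \<alpha>h by standard (simp add: sp mass)
  \<comment> \<open>On a discrete group every homomorphism into the circle is continuous, so the
    algebraically constructed \<open>\<eta>\<close> belongs to the dual.\<close>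
  have cont: "continuous_on UNIV (g :: 'a \<Rightarrow> complex)" for g
    by (simp add: continuous_on_open_vimage) (metis (no_types, lifting) UN_singleton open_UN open_sing)
  have orth: "ip \<alpha>h (\<lambda>\<gamma>. cnj (\<gamma> x)) (\<lambda>\<gamma>. cnj (\<gamma> y)) = 0" if xy: "x \<noteq> y" for x y :: 'a
  proof -
    obtain \<eta> where \<eta>: "\<And>x x'. \<eta> (x + x') = \<eta> x * \<eta> x'" "\<And>x::'a. cmod (\<eta> x) = 1" "\<eta> (y - x) \<noteq> 1"
      by (rule character_separation[of "y - x"]) (use xy in auto)
    have \<eta>D: "\<eta> \<in> dual_group" "(\<lambda>x. cnj (\<eta> x)) \<in> dual_group" using \<eta> cont by (auto simp: dual_group_def)
    have mem: "(\<lambda>x. g x * h x) \<in> dual_group" if "g \<in> dual_group" "h \<in> dual_group" for g h :: "'a \<Rightarrow> complex"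
      using that cont by (auto simp: dual_group_def norm_mult mult_ac)
    let ?e = "\<lambda>\<gamma>. cnj (\<gamma> x) * \<gamma> y"
    \<comment> \<open>Translation by \<open>\<eta>\<close> multiplies the integrand by
      \<open>\<eta> (y - x) \<noteq> 1\<close> but leaves the integral unchanged, so the integral is
      \<open>0\<close>.\<close>
    have "(LINT \<gamma>|\<alpha>h. ?e (\<lambda>x. \<eta> x * \<gamma> x)) = (LINT \<gamma>|\<alpha>h. ?e \<gamma>)"
    proof (rule haar_integral_shift[OF haar \<eta>D])
      show "?e \<in> borel_measurable \<alpha>h" using meas[of x] meas[of y] by measurable
      fix \<gamma> :: "'a \<Rightarrow> complex"
      assume g: "\<gamma> \<in> dual_group"
      show "(\<lambda>x. \<eta> x * \<gamma> x) \<in> dual_group" "(\<lambda>x. cnj (\<eta> x) * \<gamma> x) \<in> dual_group" using mem \<eta>D g by auto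
      show "(\<lambda>x. \<eta> x * (cnj (\<eta> x) * \<gamma> x)) = \<gamma>" "(\<lambda>x. cnj (\<eta> x) * (\<eta> x * \<gamma> x)) = \<gamma>"
        using dual_groupD(6)[OF \<eta>D(1)] by (auto simp: fun_eq_iff mult.assoc[symmetric] mult.commute[of "\<eta> _"])
    qed
    moreover have "?e (\<lambda>x. \<eta> x * \<gamma> x) = \<eta> (y - x) * ?e \<gamma>" for \<gamma>
      using dual_groupD(7)[OF \<eta>D(1)] by (simp add: mult_ac)
    ultimately have "(LINT \<gamma>|\<alpha>h. \<eta> (y - x) * ?e \<gamma>) = (LINT \<gamma>|\<alpha>h. ?e \<gamma>)" by (simp only:)
    then have "\<eta> (y - x) * (LINT \<gamma>|\<alpha>h. ?e \<gamma>) = (LINT \<gamma>|\<alpha>h. ?e \<gamma>)" by simp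
    then have "(LINT \<gamma>|\<alpha>h. ?e \<gamma>) = 0" using \<eta>(3) by simp
    then show ?thesis by (simp add: ip_def)
  qed
  show ?thesis
  proof
    show "0 < 1 / c" using c by simp
    show "measure \<alpha>h (space \<alpha>h) = 1 / c" using mass c by (simp add: measure_def sp)
    show "(\<lambda>\<gamma>. cnj (\<gamma> x)) \<in> borel_measurable \<alpha>h" for x :: 'a using meas by (rule borel_measurable_cnj)
    show "cmod (cnj (\<gamma> x)) = 1" if "\<gamma> \<in> space \<alpha>h" for \<gamma> and x :: 'a
      using that by (simp add: sp dual_group_def)
  qed (rule orth)
qed

text \<open>Here \<open>\<Psi>\<close> is the function and \<open>\<psi>\<close> its family of
  coefficients, so \<open>coeff_entropy_sum\<close> is applied with \<open>p\<close> and
  \<open>q\<close> interchanged.\<close>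

lemma discrete_inequality:
  fixes \<alpha> :: "'a::{ab_group_add,t2_space} measure"
  assumes setting: "discrete_setting \<alpha> \<alpha>h" and \<psi>: "(\<integral>\<^sup>+x. ennreal ((cmod (\<psi> x))^2) \<partial>\<alpha>) = 1"
    and F: "is_fourier_L2 \<alpha> \<alpha>h \<psi> \<Psi>" and pq: "0 < p" "0 < q" "1/p + 1/q \<ge> 1"
    and def: "lhs_defined \<alpha> \<alpha>h \<psi> \<Psi> p q"
  shows "0 \<le> uncertainty_lhs \<alpha> \<alpha>h \<psi> \<Psi> p q"
proof -
  obtain c where c: "0 < c" and \<alpha>: "\<alpha> = scale_measure (ennreal c) (count_space UNIV)"
    and haar: "is_haar dual_group (\<lambda>g1 g2 x. g1 x * g2 x) \<alpha>h" and mass: "emeasure \<alpha>h dual_group = ennreal (1 / c)"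
    and op: "\<And>x::'a. open {x}"
    using setting unfolding discrete_setting_def by blast
  interpret U: unimodular_system \<alpha>h "UNIV :: 'a set" "\<lambda>x \<gamma>. cnj (\<gamma> x)" "1 / c"
    by (rule discrete_system[OF op c haar mass])
  have N: "U.coeff_measure = \<alpha>" unfolding U.coeff_measure_def \<alpha> by simp
  have all_meas: "f \<in> borel_measurable \<alpha>" for f :: "'a \<Rightarrow> 'b::topological_space"
    unfolding \<alpha> by (simp add: measurable_def space_scale_measure)
  have \<Psi>L: "L2 \<alpha>h \<Psi>" using F by (simp add: is_fourier_L2_def)
  have fin_int: "integrable \<alpha> f" if "finite {x. f x \<noteq> 0}" for f :: "'a \<Rightarrow> 'b::{banach,second_countable_topology}"
  proof (rule integrableI_bounded)
    have "(\<integral>\<^sup>+x. ennreal (norm (f x)) \<partial>count_space UNIV) = (\<Sum>x\<in>{x. f x \<noteq> 0}. ennreal (norm (f x)))"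
      using that by (intro nn_integral_count_space') auto
    then show "(\<integral>\<^sup>+x. ennreal (norm (f x)) \<partial>\<alpha>) < \<infinity>"
      using that unfolding \<alpha> by (subst nn_integral_scale_measure) (auto simp: ennreal_mult_less_top sum_ennreal)
  qed (rule all_meas)
  have lim: "(\<lambda>n. \<integral>\<^sup>+\<gamma>. ennreal ((cmod ((\<Sum>i\<in>J n. \<psi> i / complex_of_real (1 / c) * cnj (\<gamma> i)) - \<Psi> \<gamma>))\<^sup>2) \<partial>\<alpha>h) \<longlonglongrightarrow> 0"
    if J: "\<And>n. finite (J n)"
      and l: "(\<lambda>n. \<integral>\<^sup>+i. ennreal ((cmod (\<psi> i * indicator (J n) i - \<psi> i))\<^sup>2) \<partial>\<alpha>) \<longlonglongrightarrow> 0" for J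
  proof -
    \<comment> \<open>Truncations have finite support, hence are admissible in
      \<open>is_fourier_L2\<close>; their transforms are exactly the partial sums of the system, the
      mass \<open>c\<close> of a point being \<open>1 / A\<close>.\<close>
    let ?f = "\<lambda>n x. \<psi> x * indicator (J n) x"
    have supp: "finite {x. g (?f n x) \<noteq> 0}" if "g 0 = 0" for n and g :: "complex \<Rightarrow> 'b::zero"
      by (rule finite_subset[OF _ J[of n]]) (use that in \<open>auto simp: indicator_def split: if_splits\<close>)
    have "integrable \<alpha> (?f n)" "L2 \<alpha> (?f n)" for n
      using fin_int[OF supp[of "\<lambda>z. z" n]] fin_int[OF supp[of "\<lambda>z. (cmod z)\<^sup>2" n]] all_meas[of "?f n"] unfolding L2_def by auto
    then have "(\<lambda>n. \<integral>\<^sup>+\<gamma>. ennreal ((cmod (fourier_L1 \<alpha> (?f n) \<gamma> - \<Psi> \<gamma>))^2) \<partial>\<alpha>h) \<longlonglongrightarrow> 0"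
      using F l unfolding is_fourier_L2_def by (auto dest!: spec[of _ ?f])
    moreover have "fourier_L1 \<alpha> (?f n) \<gamma> = (\<Sum>i\<in>J n. \<psi> i / complex_of_real (1 / c) * cnj (\<gamma> i))" for n \<gamma>
    proof -
      have "\<alpha> = density (count_space UNIV) (\<lambda>_. ennreal c)"
        unfolding \<alpha> by (rule measure_eqI) (auto simp: emeasure_density nn_integral_cmult_indicator)
      then have "fourier_L1 \<alpha> (?f n) \<gamma> = (LINT x|count_space UNIV. c *\<^sub>R (?f n x * cnj (\<gamma> x)))"
        unfolding fourier_L1_def using c by (simp only:) (rule integral_density, auto)
      also have "\<dots> = (\<Sum>x\<in>J n. c *\<^sub>R (?f n x * cnj (\<gamma> x)))"
        using J by (intro lebesgue_integral_count_space_finite_support[THEN trans] sum.mono_neutral_left)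
          (auto intro: finite_subset[OF _ J[of n]] simp: indicator_def split: if_splits)
      also have "\<dots> = (\<Sum>i\<in>J n. \<psi> i / complex_of_real (1 / c) * cnj (\<gamma> i))"
        by (rule sum.cong) (auto simp: scaleR_conv_of_real mult_ac)
      finally show ?thesis .
    qed
    ultimately show ?thesis by simp
  qed
  have "(\<integral>\<^sup>+i. ennreal ((cmod (\<psi> i))\<^sup>2) \<partial>U.coeff_measure) = 1" using \<psi> N by simp
  note syn = U.synthesis_limit[OF \<Psi>L this, unfolded N, OF lim]
  have co: "U.coeff \<Psi> = \<psi>" using syn(1) by auto
  have "0 \<le> renyi_entropy \<alpha>h (\<lambda>x. (cmod (\<Psi> x))\<^sup>2) (q/2) + renyi_entropy \<alpha> (\<lambda>i. (cmod (\<psi> i))\<^sup>2) (p/2)"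
    using U.coeff_entropy_sum[OF \<Psi>L syn(3) syn(2), of q p] pq lhs_defined_uncertainty[OF def]
    unfolding N co by (auto simp: add.commute)
  then show ?thesis by (simp add: uncertainty_lhs_def add.commute)
qed

text \<open>The transform of the normalized point mass is \<open>sqrt c\<close> times a conjugated
  evaluation, so its squared modulus is the constant \<open>c\<close> on a dual of mass
  \<open>1 / c\<close>.\<close>

lemma discrete_sharp:
  fixes \<alpha> :: "'a::{ab_group_add,t2_space} measure"
  assumes setting: "discrete_setting \<alpha> \<alpha>h"
    and F: "is_fourier_L2 \<alpha> \<alpha>h (\<lambda>x. indicator {x0} x / complex_of_real (sqrt (measure \<alpha> {x0}))) \<Psi>"
  shows "lhs_defined \<alpha> \<alpha>h (\<lambda>x. indicator {x0} x / complex_of_real (sqrt (measure \<alpha> {x0}))) \<Psi> p q"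
    "uncertainty_lhs \<alpha> \<alpha>h (\<lambda>x. indicator {x0} x / complex_of_real (sqrt (measure \<alpha> {x0}))) \<Psi> p q = 0"
proof -
  obtain c where c: "0 < c" and \<alpha>: "\<alpha> = scale_measure (ennreal c) (count_space UNIV)"
    and haar: "is_haar dual_group (\<lambda>g1 g2 x. g1 x * g2 x) \<alpha>h" and mass: "emeasure \<alpha>h dual_group = ennreal (1 / c)"
    and op: "\<And>x::'a. open {x}"
    using setting unfolding discrete_setting_def by blast
  interpret U: unimodular_system \<alpha>h "UNIV :: 'a set" "\<lambda>x \<gamma>. cnj (\<gamma> x)" "1 / c"
    by (rule discrete_system[OF op c haar mass])
  have sp: "space \<alpha>h = dual_group" using haar by (auto simp: is_haar_def)
  have em: "emeasure \<alpha> {x0} = ennreal c" unfolding \<alpha> by simp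
  have me: "measure \<alpha> {x0} = c" using c by (simp add: measure_def em)
  define \<psi> where "\<psi> = (\<lambda>x. indicator {x0} x / complex_of_real (sqrt c))"
  have all_meas: "f \<in> borel_measurable \<alpha>" for f :: "'a \<Rightarrow> 'b::topological_space"
    unfolding \<alpha> by (simp add: measurable_def space_scale_measure)
  have sing: "{x0} \<in> sets \<alpha>" unfolding \<alpha> by simp
  have ind: "integrable \<alpha> (\<lambda>x. indicator {x0} x *\<^sub>R z)" for z :: "'b::{banach,second_countable_topology}"
    using sing em by (intro integrable_scaleR_left integrable_real_indicator) auto
  have int: "integrable \<alpha> \<psi>"
    using ind[of "1 / complex_of_real (sqrt c)"] by (rule Bochner_Integration.integrable_cong[THEN iffD1, rotated -1]) (auto simp: \<psi>_def indicator_def)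
  have sq: "(cmod (\<psi> x))\<^sup>2 = (if x \<in> {x0} then 1 / c else 0)" for x
    using c by (simp add: \<psi>_def norm_divide power_divide)
  have L: "L2 \<alpha> \<psi>"
    unfolding L2_def
    using ind[of "1 / c"] all_meas[of \<psi>] by (auto simp: sq elim!: Bochner_Integration.integrable_cong[THEN iffD1, rotated -1])
  have four: "fourier_L1 \<alpha> \<psi> \<gamma> = complex_of_real (sqrt c) * cnj (\<gamma> x0)" for \<gamma>
  proof -
    have "fourier_L1 \<alpha> \<psi> \<gamma> = (LINT x|\<alpha>. indicator {x0} x *\<^sub>R (cnj (\<gamma> x0) / complex_of_real (sqrt c)))"
      unfolding fourier_L1_def by (rule Bochner_Integration.integral_cong) (auto simp: \<psi>_def indicator_def)
    also have "\<dots> = c *\<^sub>R (cnj (\<gamma> x0) / complex_of_real (sqrt c))"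
      using me sing em by simp
    also have "\<dots> = (complex_of_real c / complex_of_real (sqrt c)) * cnj (\<gamma> x0)" by (simp add: scaleR_conv_of_real)
    also have "complex_of_real c / complex_of_real (sqrt c) = complex_of_real (sqrt c)"
      unfolding of_real_divide[symmetric] using c by (simp add: real_div_sqrt)
    finally show ?thesis .
  qed
  have "fourier_L1 \<alpha> \<psi> \<in> borel_measurable \<alpha>h"
    using U.phi_measurable[of x0] by (simp add: four[abs_def])
  then have "AE \<gamma> in \<alpha>h. \<Psi> \<gamma> = fourier_L1 \<alpha> \<psi> \<gamma>"
    using fourier_L2_eq_AE[OF _ int L] F by (simp add: me \<psi>_def)
  then have ae: "AE \<gamma> in \<alpha>h. (cmod (\<Psi> \<gamma>))\<^sup>2 = (if \<gamma> \<in> space \<alpha>h then c else 0)"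
    using AE_space
  proof eventually_elim
    case (elim \<gamma>)
    then show ?case using U.phi_norm[of x0 \<gamma>] c by (simp add: four norm_mult)
  qed
  have "lhs_defined \<alpha> \<alpha>h \<psi> \<Psi> p q" "uncertainty_lhs \<alpha> \<alpha>h \<psi> \<Psi> p q = 0"
    using uncertainty_const[OF sing em sets.top _ c AE_I2[OF sq] ae] mass sp by auto
  then show "lhs_defined \<alpha> \<alpha>h (\<lambda>x. indicator {x0} x / complex_of_real (sqrt (measure \<alpha> {x0}))) \<Psi> p q"
    "uncertainty_lhs \<alpha> \<alpha>h (\<lambda>x. indicator {x0} x / complex_of_real (sqrt (measure \<alpha> {x0}))) \<Psi> p q = 0"
    unfolding me \<psi>_def by auto
qed

section \<open>Convolution on a compact abelian group\<close>

lemma cauchy_schwarz: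
  assumes f: "L2 M f" and g: "L2 M g"
  shows "(cmod (ip M f g))\<^sup>2 \<le> (LINT x|M. (cmod (f x))\<^sup>2) * (LINT x|M. (cmod (g x))\<^sup>2)"
proof -
  define F where "F = (LINT x|M. (cmod (f x))\<^sup>2)"
  define G where "G = (LINT x|M. (cmod (g x))\<^sup>2)"
  define z where "z = ip M f g"
  have F0: "0 \<le> F" and G0: "0 \<le> G" by (auto simp: F_def G_def intro!: integral_nonneg_AE)
  have *: "0 \<le> F - 2 * t * (cmod z)\<^sup>2 + t\<^sup>2 * (cmod z)\<^sup>2 * G" for t :: real
  proof -
    let ?h = "\<lambda>x. f x - (of_real t * z) * g x"
    have tg: "L2 M (\<lambda>x. (of_real t * z) * g x)" using g by (rule L2_cmult)
    have h: "L2 M ?h" using f tg by (rule L2_diff)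
    have "complex_of_real (LINT x|M. (cmod (?h x))\<^sup>2) = ip M ?h ?h" by (rule ip_self[symmetric])
    also have "\<dots> = ip M f f - cnj (of_real t * z) * ip M f g - of_real t * z * (ip M g f - cnj (of_real t * z) * ip M g g)"
      using ip_simps(3)[OF f tg h] ip_simps(4)[OF f tg f] ip_simps(6)[OF g g f] ip_simps(5)[OF g g h]
        ip_simps(4)[OF f tg g] ip_simps(6)[OF g g g] by simp
    also have "\<dots> = ip M f f - of_real t * (z * cnj z) - of_real t * (z * cnj z) + of_real (t\<^sup>2) * (z * cnj z) * ip M g g"
      using ip_cnj[of M f g] by (simp add: z_def algebra_simps power2_eq_square)
    also have "\<dots> = complex_of_real (F - 2 * t * (cmod z)\<^sup>2 + t\<^sup>2 * (cmod z)\<^sup>2 * G)"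
      unfolding complex_norm_square[symmetric] by (simp add: ip_self F_def G_def)
    finally have "(LINT x|M. (cmod (?h x))\<^sup>2) = F - 2 * t * (cmod z)\<^sup>2 + t\<^sup>2 * (cmod z)\<^sup>2 * G"
      by (simp only: of_real_eq_iff)
    then show ?thesis by (metis (no_types, lifting) integral_nonneg_AE AE_I2 zero_le_power2)
  qed
  have "(cmod z)\<^sup>2 \<le> F * G"
  proof (cases "G = 0")
    case False
    then have "G > 0" using G0 by simp
    have "0 \<le> F - (cmod z)\<^sup>2 / G"
      using *[of "1 / G"] \<open>G > 0\<close> by (simp add: power2_eq_square field_simps)
    then show ?thesis using \<open>G > 0\<close> by (simp add: field_simps)
  next
    case True
    have "(cmod z)\<^sup>2 = 0"
    proof (rule ccontr)
      assume "(cmod z)\<^sup>2 \<noteq> 0"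
      then have "(cmod z)\<^sup>2 > 0" by simp
      \<comment> \<open>For \<open>G = 0\<close> the quadratic is affine in \<open>t\<close>, and
        this \<open>t\<close> gives it the negative value \<open>- F - 2\<close>.\<close>
      then show False using *[of "(F + 1) / (cmod z)\<^sup>2"] True F0 by simp
    qed
    then show ?thesis using F0 G0 by simp
  qed
  then show ?thesis by (simp add: z_def F_def G_def)
qed

locale compact_group =
  fixes \<alpha> :: "'a::{ab_group_add,t2_space} measure"
  assumes cont_add: "continuous_on UNIV (\<lambda>z::'a \<times> 'a. fst z + snd z)"
    and cont_minus: "continuous_on UNIV (uminus :: 'a \<Rightarrow> 'a)"
    and compact_UNIV: "compact (UNIV :: 'a set)"
    and haar: "is_haar UNIV (+) \<alpha>"
begin

lemma space_haar [simp]: "space \<alpha> = UNIV" and sets_haar: "sets \<alpha> = sets borel"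
  using haar by (auto simp: is_haar_def)

lemma emeasure_haar_UNIV: "emeasure \<alpha> UNIV \<noteq> \<infinity>" "emeasure \<alpha> UNIV \<noteq> 0"
proof -
  have "\<forall>K. compact K \<and> K \<subseteq> UNIV \<longrightarrow> emeasure \<alpha> K < \<infinity>" "emeasure \<alpha> UNIV \<noteq> 0"
    using haar unfolding is_haar_def by blast+
  then show "emeasure \<alpha> UNIV \<noteq> \<infinity>" "emeasure \<alpha> UNIV \<noteq> 0" using compact_UNIV by force+
qed

sublocale finite_measure \<alpha>
  by standard (use emeasure_haar_UNIV in simp)

definition total :: real where "total = measure \<alpha> UNIV"

lemma total_pos: "0 < total"
  using emeasure_haar_UNIV by (simp add: total_def emeasure_eq_measure order_less_le)

lemma emeasure_total: "emeasure \<alpha> UNIV = ennreal total"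
  by (simp add: total_def emeasure_eq_measure)

section \<open>Integration of continuous functions\<close>

lemma continuous_add [continuous_intros]:
  "continuous_on S f \<Longrightarrow> continuous_on S g \<Longrightarrow> continuous_on S (\<lambda>x. f x + g x :: 'a)"
  using continuous_on_compose2[OF cont_add, of S "\<lambda>x. (f x, g x)"] by (simp add: continuous_on_Pair)

lemma continuous_minus [continuous_intros]:
  "continuous_on S f \<Longrightarrow> continuous_on S (\<lambda>x. - f x :: 'a)"
  using continuous_on_compose2[OF cont_minus, of S f] by simp

lemma continuous_diff [continuous_intros]:
  "continuous_on S f \<Longrightarrow> continuous_on S g \<Longrightarrow> continuous_on S (\<lambda>x. f x - g x :: 'a)"
  using continuous_add[of S f "\<lambda>x. - g x"] continuous_minus[of S g] by simp

lemma continuous_bounded: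
  fixes f :: "'a \<Rightarrow> 'b::real_normed_vector"
  assumes "continuous_on UNIV f"
  obtains B where "0 < B" "\<And>x. norm (f x) \<le> B"
proof -
  have "bounded (range f)" using assms compact_UNIV by (intro compact_imp_bounded compact_continuous_image)
  then show thesis using that by (auto simp: bounded_pos)
qed

lemma continuous_measurable:
  fixes f :: "'a \<Rightarrow> 'b::topological_space"
  assumes "continuous_on UNIV f" shows "f \<in> borel_measurable \<alpha>"
  using borel_measurable_continuous_onI[OF assms] measurable_cong_sets[OF sets_haar refl] by blast

lemma continuous_L2:
  assumes f: "continuous_on UNIV f" shows "L2 \<alpha> f"
proof -
  obtain B where "0 < B" "\<And>x. cmod (f x) \<le> B" by (rule continuous_bounded[OF f]) blast
  then show ?thesis by (intro L2_bounded[where B = B] continuous_measurable[OF f]) auto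
qed

lemma continuous_integrable:
  fixes f :: "'a \<Rightarrow> 'b::{banach,second_countable_topology}"
  assumes f: "continuous_on UNIV f" shows "integrable \<alpha> f"
proof -
  obtain B where "0 < B" "\<And>x. norm (f x) \<le> B" by (rule continuous_bounded[OF f]) blast
  then show ?thesis by (intro integrable_const_bound[where B = B] continuous_measurable[OF f]) auto
qed

lemma integral_translate:
  fixes f :: "'a \<Rightarrow> complex"
  assumes "f \<in> borel_measurable \<alpha>"
  shows "(LINT y|\<alpha>. f (a + y)) = (LINT y|\<alpha>. f y)"
  by (rule haar_integral_shift[OF haar, of a "- a"]) (use assms in auto)

text \<open>The addition map need not be measurable for the product of the Borel algebras, but a jointly
  continuous function is a uniform limit of functions that depend on the second variable only through
  finitely many values.\<close>

lemma finite_selector: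
  assumes "finite T" "\<And>t. t \<in> T \<Longrightarrow> open (V t :: 'a set)"
  shows "\<exists>s. s \<in> measurable \<alpha> (count_space UNIV) \<and> finite (range s) \<and> (\<forall>y\<in>\<Union>(V ` T). y \<in> V (s y))"
  using assms
proof (induction rule: finite_induct)
  case empty
  show ?case by (intro exI[of _ "\<lambda>_. undefined"]) auto
next
  case (insert t T)
  then obtain s where s: "s \<in> measurable \<alpha> (count_space UNIV)" "finite (range s)" "\<forall>y\<in>\<Union>(V ` T). y \<in> V (s y)" by auto
  have [measurable]: "V t \<in> sets \<alpha>" using insert.prems sets_haar by auto
  show ?case
  proof (intro exI[of _ "\<lambda>y. if y \<in> V t then t else s y"] conjI)
    show "(\<lambda>y. if y \<in> V t then t else s y) \<in> measurable \<alpha> (count_space UNIV)"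
      using s(1) by measurable
    show "finite (range (\<lambda>y. if y \<in> V t then t else s y))"
      by (rule finite_subset[of _ "insert t (range s)"]) (use s(2) in auto)
    show "\<forall>y\<in>\<Union>(V ` insert t T). y \<in> V (if y \<in> V t then t else s y)" using s(3) by auto
  qed
qed

lemma joint_measurable:
  fixes F :: "'a \<times> 'a \<Rightarrow> complex"
  assumes F: "continuous_on UNIV F"
  shows "F \<in> borel_measurable (\<alpha> \<Otimes>\<^sub>M \<alpha>)"
proof -
  have cont: "continuous_on UNIV (\<lambda>x. F (x, y))" for y
    by (rule continuous_on_compose2[OF F]) (auto intro!: continuous_intros)
  have "\<exists>s. s \<in> measurable \<alpha> (count_space UNIV) \<and> finite (range s) \<and> (\<forall>x y. dist (F (x, y)) (F (x, s y)) \<le> e)" if e: "e > 0" for e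
  proof -
    have swap: "continuous_on (UNIV \<times> UNIV) (\<lambda>p. F (snd p, fst p))"
      by (rule continuous_on_compose2[OF F]) (auto intro!: continuous_intros)
    \<comment> \<open>By compactness of the first factor, continuity in the second variable is
      uniform in the first.\<close>
    have "\<exists>V. open V \<and> y0 \<in> V \<and> (\<forall>y\<in>V. \<forall>x. dist (F (x, y)) (F (x, y0)) \<le> e)" for y0
      by (rule continuous_on_prod_compactE[OF swap compact_UNIV UNIV_I e, of y0]) auto
    then obtain V where V: "\<And>y0. open (V y0)" "\<And>y0. y0 \<in> V y0" "\<And>y0 y x. y \<in> V y0 \<Longrightarrow> dist (F (x, y)) (F (x, y0)) \<le> e"
      by metis
    obtain T where T: "finite T" "UNIV \<subseteq> (\<Union>t\<in>T. V t)"
      by (rule compactE_image[OF compact_UNIV, of UNIV V]) (use V in auto)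
    obtain s where "s \<in> measurable \<alpha> (count_space UNIV)" "finite (range s)" "\<forall>y\<in>\<Union>(V ` T). y \<in> V (s y)"
      using finite_selector[OF T(1), of V] V(1) by blast
    moreover from this(3) have "y \<in> V (s y)" for y using T(2) by blast
    ultimately show ?thesis using V(3) by (intro exI[of _ s]) auto
  qed
  then have "\<exists>s. \<forall>n. s n \<in> measurable \<alpha> (count_space UNIV) \<and> finite (range (s n)) \<and> (\<forall>x y. dist (F (x, y)) (F (x, s n y)) \<le> 1 / real (Suc n))"
    by (intro choice allI) auto
  then obtain s where s: "\<And>n. s n \<in> measurable \<alpha> (count_space UNIV)" "\<And>n. finite (range (s n))"
    "\<And>n x y. dist (F (x, y)) (F (x, s n y)) \<le> 1 / real (Suc n)" by blast
  show ?thesis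
  proof (rule borel_measurable_LIMSEQ_metric)
    fix n
    show "(\<lambda>p. F (fst p, s n (snd p))) \<in> borel_measurable (\<alpha> \<Otimes>\<^sub>M \<alpha>)"
    proof (rule measurable_compose_countable'[where f = "\<lambda>j p. F (fst p, j)" and g = "\<lambda>p. s n (snd p)" and I = "range (s n)"])
      show "(\<lambda>p. F (fst p, j)) \<in> borel_measurable (\<alpha> \<Otimes>\<^sub>M \<alpha>)" for j
        using measurable_compose[OF measurable_fst continuous_measurable[OF cont]] .
      have "s n \<in> measurable \<alpha> (count_space (range (s n)))"
        using s(1)[of n] by (auto simp: measurable_def)
      then show "(\<lambda>p. s n (snd p)) \<in> measurable (\<alpha> \<Otimes>\<^sub>M \<alpha>) (count_space (range (s n)))"
        by (rule measurable_compose[OF measurable_snd])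
      show "countable (range (s n))" using s(2) by (rule countable_finite)
    qed
  next
    fix p :: "'a \<times> 'a"
    obtain x y where p: "p = (x, y)" by (cases p)
    have "(\<lambda>n. dist (F (x, s n y)) (F (x, y))) \<longlonglongrightarrow> 0"
    proof (rule tendsto_sandwich[OF _ _ tendsto_const LIMSEQ_inverse_real_of_nat])
      show "\<forall>\<^sub>F n in sequentially. dist (F (x, s n y)) (F (x, y)) \<le> inverse (real (Suc n))"
        using s(3)[of x y] by (auto simp: dist_commute inverse_eq_divide)
    qed auto
    then show "(\<lambda>n. F (fst p, s n (snd p))) \<longlonglongrightarrow> F p"
      unfolding p by (subst tendsto_dist_iff) simp
  qed
qed

lemma fubini:
  fixes F :: "'a \<Rightarrow> 'a \<Rightarrow> complex"
  assumes F: "continuous_on UNIV (\<lambda>(x, y). F x y)"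
  shows "(LINT x|\<alpha>. LINT y|\<alpha>. F x y) = (LINT y|\<alpha>. LINT x|\<alpha>. F x y)"
proof -
  interpret P: pair_sigma_finite \<alpha> \<alpha> by standard
  interpret Q: finite_measure "\<alpha> \<Otimes>\<^sub>M \<alpha>" by (rule finite_measure_pair_measure) (rule finite_measure_axioms)+
  have "compact (range (\<lambda>(x, y). F x y))"
    using compact_continuous_image[OF F] compact_Times[OF compact_UNIV compact_UNIV] by simp
  then have "bounded (range (\<lambda>(x, y). F x y))" by (rule compact_imp_bounded)
  then obtain B where B: "\<And>x y. cmod (F x y) \<le> B" by (auto simp: bounded_iff)
  have "integrable (\<alpha> \<Otimes>\<^sub>M \<alpha>) (\<lambda>(x, y). F x y)"
    by (rule Q.integrable_const_bound[where B = B]) (use B joint_measurable[OF F] in auto)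
  then show ?thesis by (rule P.Fubini_integral[symmetric])
qed

lemma continuous_integral:
  fixes F :: "'a \<Rightarrow> 'a \<Rightarrow> complex"
  assumes F: "continuous_on UNIV (\<lambda>(x, y). F x y)"
  shows "continuous_on UNIV (\<lambda>x. LINT y|\<alpha>. F x y)"
proof -
  have F': "continuous_on (UNIV \<times> UNIV) (\<lambda>(x, y). F x y)" using F by simp
  have cont: "continuous_on UNIV (F x)" for x
    using continuous_on_compose2[OF F, of UNIV "\<lambda>y. (x, y)"] by (simp add: continuous_intros)
  have "(\<lambda>x. LINT y|\<alpha>. F x y) \<midarrow>x0\<rightarrow> (LINT y|\<alpha>. F x0 y)" for x0
  proof (rule tendstoI)
    fix e :: real assume e: "e > 0"
    define e' where "e' = e / (2 * total)"
    have e': "e' > 0" using e total_pos by (simp add: e'_def)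
    obtain X0 where X0: "x0 \<in> X0" "open X0" "\<forall>x\<in>X0 \<inter> UNIV. \<forall>t\<in>UNIV. dist ((\<lambda>(x, y). F x y) (x, t)) ((\<lambda>(x, y). F x y) (x0, t)) \<le> e'"
      using continuous_on_prod_compactE[OF F' compact_UNIV UNIV_I e', of x0] by blast
    have "dist (LINT y|\<alpha>. F x y) (LINT y|\<alpha>. F x0 y) < e" if "x \<in> X0" for x
    proof -
      have "dist (LINT y|\<alpha>. F x y) (LINT y|\<alpha>. F x0 y) = cmod (LINT y|\<alpha>. F x y - F x0 y)"
        unfolding dist_norm by (subst Bochner_Integration.integral_diff) (auto intro: continuous_integrable cont)
      also have "\<dots> \<le> (LINT y|\<alpha>. cmod (F x y - F x0 y))" by (rule integral_norm_bound)
      also have "\<dots> \<le> (LINT y|\<alpha>. e')"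
        using X0(3) that by (intro integral_mono continuous_integrable continuous_intros cont) (auto simp: dist_norm)
      also have "\<dots> = e / 2" using total_pos by (simp add: e'_def total_def)
      also have "\<dots> < e" using e by simp
      finally show ?thesis .
    qed
    then show "\<forall>\<^sub>F x in at x0. dist (LINT y|\<alpha>. F x y) (LINT y|\<alpha>. F x0 y) < e"
      using X0(1,2) by (auto simp: eventually_at_topological)
  qed
  then show ?thesis by (simp add: continuous_on_def)
qed

text \<open>The definition of Haar measure only has translations. The double integral of
  \<open>f (x - y)\<close> is \<open>total\<close> times either side, depending on which variable is
  integrated first, and \<open>total > 0\<close>.\<close>

lemma integral_inverse:
  fixes f :: "'a \<Rightarrow> complex"
  assumes f: "continuous_on UNIV f"
  shows "(LINT y|\<alpha>. f (- y)) = (LINT y|\<alpha>. f y)"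
proof -
  have c: "continuous_on UNIV (\<lambda>y. f (- y))" by (rule continuous_on_compose2[OF f]) (auto intro!: continuous_intros)
  have "(LINT x|\<alpha>. LINT y|\<alpha>. f (x - y)) = (LINT y|\<alpha>. LINT x|\<alpha>. f (x - y))"
  proof (rule fubini)
    show "continuous_on UNIV (\<lambda>(x, y). f (x - y))"
      unfolding case_prod_beta by (rule continuous_on_compose2[OF f]) (auto intro!: continuous_intros)
  qed
  also have "(LINT y|\<alpha>. LINT x|\<alpha>. f (x - y)) = (LINT y|\<alpha>. LINT x|\<alpha>. f x)"
    using integral_translate[OF continuous_measurable[OF f], of "- _"] by simp
  also have "(LINT x|\<alpha>. LINT y|\<alpha>. f (x - y)) = (LINT x|\<alpha>. LINT y|\<alpha>. f (- y))"
    using integral_translate[OF continuous_measurable[OF c], of "- _"] by simp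
  finally show ?thesis using total_pos by (simp add: total_def)
qed

lemma integral_reflect:
  fixes f :: "'a \<Rightarrow> complex"
  assumes f: "continuous_on UNIV f"
  shows "(LINT y|\<alpha>. f (a - y)) = (LINT y|\<alpha>. f y)"
proof -
  have c: "continuous_on UNIV (\<lambda>y. f (a + y))" by (rule continuous_on_compose2[OF f]) (auto intro!: continuous_intros)
  have "(LINT y|\<alpha>. f (a - y)) = (LINT y|\<alpha>. f (a + y))" using integral_inverse[OF c] by simp
  also have "\<dots> = (LINT y|\<alpha>. f y)" by (rule integral_translate[OF continuous_measurable[OF f]])
  finally show ?thesis .
qed

section \<open>The convolution algebra\<close>

abbreviation C :: "('a \<Rightarrow> complex) \<Rightarrow> bool" where
  "C f \<equiv> continuous_on UNIV f"

definition conv :: "('a \<Rightarrow> complex) \<Rightarrow> ('a \<Rightarrow> complex) \<Rightarrow> 'a \<Rightarrow> complex" where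
  "conv f g x = (LINT y|\<alpha>. f (x - y) * g y)"

text \<open>The involution of the convolution algebra; \<open>star f = f\<close> means that
  convolution with \<open>f\<close> is self-adjoint.\<close>

definition star :: "('a \<Rightarrow> complex) \<Rightarrow> 'a \<Rightarrow> complex" where
  "star f x = cnj (f (- x))"

definition norm2 :: "('a \<Rightarrow> complex) \<Rightarrow> real" where
  "norm2 f = (LINT x|\<alpha>. (cmod (f x))\<^sup>2)"

lemma C_compose: "C f \<Longrightarrow> continuous_on S g \<Longrightarrow> continuous_on S (\<lambda>x. f (g x))"
  by (rule continuous_on_compose2) auto

lemma C_star:
  assumes f: "C f" shows "C (star f)"
  unfolding star_def[abs_def] by (intro continuous_intros C_compose[OF f])

lemma C_conv:
  assumes f: "C f" and g: "C g" shows "C (conv f g)"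
  unfolding conv_def[abs_def]
  by (rule continuous_integral) (auto simp: case_prod_beta intro!: continuous_intros C_compose[OF f] C_compose[OF g])

lemma conv_integrable:
  assumes f: "C f" and g: "C g" shows "integrable \<alpha> (\<lambda>y. f (x - y) * g y)"
  by (intro continuous_integrable continuous_intros C_compose[OF f] C_compose[OF g])

lemma conv_commute:
  assumes f: "C f" and g: "C g" shows "conv f g = conv g f"
proof
  fix x
  have "conv f g x = (LINT y|\<alpha>. f (x - (x - y)) * g (x - y))"
    unfolding conv_def by (rule integral_reflect[symmetric, of "\<lambda>y. f (x - y) * g y"]) (intro continuous_intros C_compose[OF f] C_compose[OF g])
  then show "conv f g x = conv g f x" by (simp add: conv_def mult.commute)
qed

lemma conv_assoc:
  assumes f: "C f" and g: "C g" and h: "C h"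
  shows "conv (conv f g) h = conv f (conv g h)"
proof
  fix x
  have "conv (conv f g) h x = (LINT y|\<alpha>. LINT z|\<alpha>. f (x - y - z) * g z * h y)"
    by (simp add: conv_def)
  also have "\<dots> = (LINT y|\<alpha>. LINT w|\<alpha>. f (x - w) * g (w - y) * h y)"
  proof (rule Bochner_Integration.integral_cong[OF refl])
    fix y
    have m: "(\<lambda>z. f (x - y - z) * g z * h y) \<in> borel_measurable \<alpha>"
      by (intro continuous_measurable continuous_intros C_compose[OF f] C_compose[OF g])
    show "(LINT z|\<alpha>. f (x - y - z) * g z * h y) = (LINT w|\<alpha>. f (x - w) * g (w - y) * h y)"
      using integral_translate[OF m, of "- y"] by (simp add: algebra_simps)
  qed
  also have "\<dots> = (LINT w|\<alpha>. LINT y|\<alpha>. f (x - w) * g (w - y) * h y)"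
    by (rule fubini) (auto simp: case_prod_beta intro!: continuous_intros C_compose[OF f] C_compose[OF g] C_compose[OF h])
  also have "\<dots> = conv f (conv g h) x" by (simp add: conv_def mult.assoc)
  finally show "conv (conv f g) h x = conv f (conv g h) x" .
qed

lemma conv_add:
  assumes "C f" "C g" "C h"
  shows "conv h (\<lambda>x. f x + g x) = (\<lambda>x. conv h f x + conv h g x)" "conv (\<lambda>x. f x + g x) h = (\<lambda>x. conv f h x + conv g h x)"
    "conv h (\<lambda>x. f x - g x) = (\<lambda>x. conv h f x - conv h g x)" "conv (\<lambda>x. f x - g x) h = (\<lambda>x. conv f h x - conv g h x)"
  unfolding conv_def using assms conv_integrable
  by (auto simp: distrib_left distrib_right left_diff_distrib right_diff_distrib fun_eq_iff)

lemma conv_scale: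
  "conv h (\<lambda>x. c * f x) = (\<lambda>x. c * conv h f x)" "conv (\<lambda>x. c * f x) h = (\<lambda>x. c * conv f h x)"
  unfolding conv_def by (auto simp: fun_eq_iff mult.left_commute[of _ c] mult.assoc)

lemma conv_zero: "conv h (\<lambda>x. 0) = (\<lambda>x. 0)" "conv (\<lambda>x. 0) h = (\<lambda>x. 0)"
  by (auto simp: conv_def)

lemma star_conv:
  assumes f: "C f" and g: "C g" shows "star (conv f g) = conv (star f) (star g)"
proof
  fix x
  have "star (conv f g) x = (LINT y|\<alpha>. cnj (f (- x - y)) * cnj (g y))"
    unfolding star_def conv_def by (simp flip: Bochner_Integration.integral_cnj)
  also have "\<dots> = (LINT y|\<alpha>. cnj (f (- x - (- y))) * cnj (g (- y)))"
    by (rule integral_inverse[symmetric, of "\<lambda>y. cnj (f (- x - y)) * cnj (g y)"]) (intro continuous_intros C_compose[OF f] C_compose[OF g])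
  also have "\<dots> = conv (star f) (star g) x" by (simp add: conv_def star_def)
  finally show "star (conv f g) x = conv (star f) (star g) x" .
qed

text \<open>Evaluation at \<open>0\<close> thereby acts as a trace: it turns convolution identities
  for self-adjoint kernels into statements about inner products and norms.\<close>

lemma conv_star_zero:
  assumes f: "C f" and g: "C g" shows "conv f (star g) 0 = ip \<alpha> f g"
  using integral_inverse[of "\<lambda>y. f y * cnj (g y)"] f g
  by (simp add: conv_def star_def ip_def continuous_intros)

lemma ip_norm2: "ip \<alpha> f f = complex_of_real (norm2 f)"
  by (simp add: ip_self norm2_def)

lemma norm2_nonneg: "0 \<le> norm2 f"
  unfolding norm2_def by (intro integral_nonneg_AE) auto

text \<open>Cauchy--Schwarz, with a bound independent of \<open>x\<close>: convolution with a fixed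
  kernel turns L^2 estimates into uniform ones.\<close>

lemma conv_bound:
  assumes f: "C f" and g: "C g" shows "(cmod (conv f g x))\<^sup>2 \<le> norm2 f * norm2 g"
proof -
  have c: "C (\<lambda>y. f (x - y))" "C (\<lambda>y. cnj (g y))" by (intro continuous_intros C_compose[OF f] C_compose[OF g])+
  have "conv f g x = ip \<alpha> (\<lambda>y. f (x - y)) (\<lambda>y. cnj (g y))" by (simp add: conv_def ip_def)
  moreover have "norm2 (\<lambda>y. f (x - y)) = norm2 f"
  proof -
    have "complex_of_real (norm2 (\<lambda>y. f (x - y))) = (LINT y|\<alpha>. f (x - y) * cnj (f (x - y)))"
      by (simp add: ip_norm2[symmetric] ip_def)
    also have "\<dots> = (LINT y|\<alpha>. f y * cnj (f y))"
      by (rule integral_reflect) (intro continuous_intros f)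
    finally have "complex_of_real (norm2 (\<lambda>y. f (x - y))) = complex_of_real (norm2 f)"
      unfolding ip_norm2[symmetric, of f] ip_def .
    then show ?thesis by (simp only: of_real_eq_iff)
  qed
  ultimately show ?thesis
    using cauchy_schwarz[OF continuous_L2[OF c(1)] continuous_L2[OF c(2)]] by (simp add: norm2_def)
qed

lemma conv_sup_bound:
  assumes "C f" "C g" "\<And>x. cmod (f x) \<le> B" "\<And>x. cmod (g x) \<le> e"
  shows "cmod (conv f g x) \<le> total * (B * e)"
proof -
  have B: "0 \<le> B" using assms(3)[of 0] norm_ge_zero order_trans by blast
  have "cmod (conv f g x) \<le> (LINT y|\<alpha>. cmod (f (x - y) * g y))" unfolding conv_def by (rule integral_norm_bound)
  also have "\<dots> \<le> (LINT y|\<alpha>. B * e)"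
    using assms B by (intro integral_mono integrable_norm conv_integrable) (auto simp: norm_mult intro!: mult_mono)
  finally show ?thesis by (simp add: total_def)
qed

lemma norm2_conv:
  assumes f: "C f" and g: "C g" shows "norm2 (conv f g) \<le> total * (norm2 f * norm2 g)"
proof -
  have "norm2 (conv f g) \<le> (LINT x|\<alpha>. norm2 f * norm2 g)"
    unfolding norm2_def[of "conv f g"]
    by (intro integral_mono conv_bound f g continuous_integrable continuous_intros C_conv)
  then show ?thesis by (simp add: total_def)
qed

text \<open>Finitely many translates of \<open>U\<close> cover the compact group; if
  \<open>U\<close> were null, so would be the whole group.\<close>

lemma open_positive:
  assumes U: "open (U :: 'a set)" "U \<noteq> {}" shows "0 < measure \<alpha> U"
proof (rule ccontr)
  assume "\<not> 0 < measure \<alpha> U"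
  then have z: "emeasure \<alpha> U = 0" by (simp add: emeasure_eq_measure zero_less_measure_iff)
  obtain u where u: "u \<in> U" using U by blast
  have inv: "\<And>a B. B \<in> sets \<alpha> \<Longrightarrow> (+) a ` B \<in> sets \<alpha> \<and> emeasure \<alpha> ((+) a ` B) = emeasure \<alpha> B"
    using haar unfolding is_haar_def by auto
  have tr: "(+) a ` U = (\<lambda>x. x - a) -` U" for a
    by (auto simp: image_iff) (metis add.commute diff_add_cancel)
  have op: "open ((+) a ` U)" for a
    unfolding tr by (rule open_vimage[OF U(1)]) (intro continuous_intros)
  have cover: "UNIV \<subseteq> (\<Union>a\<in>UNIV. (+) a ` U)"
  proof
    fix x
    have "x = (x - u) + u" by simp
    then show "x \<in> (\<Union>a\<in>UNIV. (+) a ` U)" using u by blast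
  qed
  obtain T where T: "finite T" "UNIV \<subseteq> (\<Union>a\<in>T. (+) a ` U)"
    by (rule compactE_image[OF compact_UNIV, of UNIV "\<lambda>a. (+) a ` U"]) (use op cover in auto)
  have Us: "U \<in> sets \<alpha>" using U sets_haar by auto
  have "emeasure \<alpha> UNIV \<le> emeasure \<alpha> (\<Union>a\<in>T. (+) a ` U)"
    using T inv[OF Us] by (intro emeasure_mono) auto
  also have "\<dots> \<le> (\<Sum>a\<in>T. emeasure \<alpha> ((+) a ` U))"
    using T inv[OF Us] by (intro emeasure_subadditive_finite) auto
  also have "\<dots> = 0" using inv[OF Us] z by simp
  finally show False using emeasure_haar_UNIV by simp
qed

lemma norm2_pos:
  assumes f: "C f" and x: "f x \<noteq> 0" shows "0 < norm2 f"
proof (rule ccontr)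
  assume "\<not> 0 < norm2 f"
  then have "norm2 f = 0" using norm2_nonneg[of f] by simp
  then have ae: "AE x in \<alpha>. (cmod (f x))\<^sup>2 = 0"
    unfolding norm2_def using continuous_L2[OF f] by (subst (asm) integral_nonneg_eq_0_iff_AE) (auto simp: L2_def)
  define U where "U = f -` (- {0})"
  have U: "open U" "U \<noteq> {}" unfolding U_def using f x by (auto intro!: open_vimage)
  have "AE x in \<alpha>. x \<notin> U" using ae by eventually_elim (simp add: U_def)
  then have "emeasure \<alpha> U = 0" using U sets_haar by (subst (asm) AE_iff_measurable[OF _ refl]) auto
  then show False using open_positive[OF U] by (simp add: measure_def)
qed

text \<open>Power method: the normalized powers of \<open>L = K * K\<close> form a Cauchy sequence, because their inner
  products only depend on the sum of the exponents, and the squared norms of the powers are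
  logarithmically convex. Their limit is the projection onto the top eigenspace of \<open>L\<close>.\<close>

lemma log_convex_limit:
  fixes d :: "nat \<Rightarrow> real"
  assumes d0: "0 < d 0" "0 < d 1" and nonneg: "\<And>n. 0 \<le> d n" and convex: "\<And>n. (d (Suc n))\<^sup>2 \<le> d n * d (n + 2)"
    and B: "0 < B" and mult: "\<And>m n. d (m + n + 1) \<le> B * (d m * d n)"
  obtains r m where "0 < r" "0 < m" "(\<lambda>n. d n / r ^ n) \<longlonglongrightarrow> m"
proof -
  have pos: "0 < d n \<and> 0 < d (Suc n)" for n
  proof (induction n)
    case (Suc n)
    then have "0 < d n * d (n + 2)" using convex[of n] by (metis less_le_trans zero_less_power)
    then show ?case using Suc by (simp add: zero_less_mult_iff)
  qed (use d0 in simp)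
  define q where "q = (\<lambda>n. d (Suc n) / d n)"
  have qpos: "0 < q n" for n using pos[of n] by (simp add: q_def)
  have qinc: "incseq q"
  proof (rule incseq_SucI)
    fix n show "q n \<le> q (Suc n)"
      using convex[of n] pos[of n] by (simp add: q_def divide_simps power2_eq_square mult.commute)
  qed
  have qbound: "q n \<le> B * d 0" for n
    using mult[of 0 n] pos[of n] by (simp add: q_def divide_simps mult_ac)
  obtain r where r: "q \<longlonglongrightarrow> r" "\<And>n. q n \<le> r"
    using incseq_convergent[OF qinc] qbound by blast
  have rpos: "0 < r" using qpos[of 0] r(2)[of 0] by linarith
  have step: "d (Suc n) = q n * d n" for n using pos[of n] by (simp add: q_def)
  have low: "q N ^ n * d N \<le> d (N + n)" for N n
  proof (induction n)
    case (Suc n)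
    have "q N ^ Suc n * d N = q N * (q N ^ n * d N)" by simp
    also have "\<dots> \<le> q (N + n) * d (N + n)"
      using Suc qpos incseqD[OF qinc, of N "N + n"] pos[of N] by (intro mult_mono) (auto simp: less_imp_le)
    finally show ?case by (simp add: step)
  qed simp
  have bound: "q N ^ Suc n \<le> B * d n" for N n
  proof -
    have "q N ^ Suc n * d N \<le> B * (d N * d n)" using low[of N "Suc n"] mult[of N n] by simp
    then show ?thesis using pos[of N] by (simp add: mult_ac)
  qed
  \<comment> \<open>The ratios increase to \<open>r\<close>; letting \<open>N\<close> grow in
    \<open>bound\<close> gives the lower bound \<open>r / B\<close> for \<open>d n / r ^ n\<close>.
    It keeps the limit \<open>m\<close> from being \<open>0\<close>.\<close>
  have rb: "r ^ Suc n \<le> B * d n" for n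
    by (rule LIMSEQ_le_const2[OF tendsto_power[OF r(1)]]) (use bound in auto)
  define \<delta> where "\<delta> = (\<lambda>n. d n / r ^ n)"
  have dec: "decseq \<delta>"
  proof (rule decseq_SucI)
    fix n
    have "d (Suc n) \<le> r * d n" unfolding step using r(2)[of n] pos[of n] by (intro mult_right_mono) auto
    then show "\<delta> (Suc n) \<le> \<delta> n" using rpos by (simp add: \<delta>_def divide_simps mult.commute)
  qed
  have dlow: "r / B \<le> \<delta> n" for n
    using rb[of n] rpos B by (simp add: \<delta>_def divide_simps mult_ac)
  obtain m where m: "\<delta> \<longlonglongrightarrow> m" using decseq_convergent[OF dec, of "r / B"] dlow by blast
  have "r / B \<le> m" by (rule LIMSEQ_le_const[OF m]) (use dlow in auto)
  moreover have "0 < r / B" using rpos B by simp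
  ultimately have "0 < m" by linarith
  then show thesis using that rpos m unfolding \<delta>_def by blast
qed

lemma power_idempotent:
  assumes K: "C K" "star K = K" "K x \<noteq> 0"
  obtains r E where "0 < r" "C E" "star E = E" "conv E E = E" "E 0 \<noteq> 0" "conv (conv K K) E = (\<lambda>x. complex_of_real r * E x)"
proof -
  \<comment> \<open>\<open>k n\<close> has \<open>n + 1\<close> factors \<open>K\<close>, which is
    the source of the index \<open>m + n + 1\<close> in products.\<close>
  define k where "k = (\<lambda>n. (conv K ^^ n) K)"
  have k0: "k 0 = K" and kSuc: "k (Suc n) = conv K (k n)" for n by (simp_all add: k_def)
  have kC: "C (k n)" for n by (induction n) (auto simp: k0 kSuc K C_conv)
  have kstar: "star (k n) = k n" for n
    by (induction n) (auto simp: k0 kSuc K star_conv kC)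
  have kconv: "conv (k m) (k n) = k (m + n + 1)" for m n
  proof (induction m)
    case (Suc m)
    then show ?case using conv_assoc[OF K(1) kC kC, of m n] by (simp add: kSuc)
  qed (simp add: k0 kSuc)
  have kip: "ip \<alpha> (k m) (k n) = k (m + n + 1) 0" for m n
    using conv_star_zero[OF kC kC, of m n] by (simp add: kstar kconv)
  define d where "d = (\<lambda>n. norm2 (k n))"
  have dk: "k (2 * n + 1) 0 = complex_of_real (d n)" for n
    using kip[of n n] by (simp add: d_def ip_norm2 mult_2)
  have ipd: "ip \<alpha> (k m) (k n) = complex_of_real (d j)" if "m + n = 2 * j" for m n j
    unfolding kip that by (rule dk)
  have dpos0: "0 < d 0" unfolding d_def k0 by (rule norm2_pos[OF K(1,3)])
  have dpos1: "0 < d 1"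
    unfolding d_def by (rule norm2_pos[OF kC, of _ 0]) (use dk[of 0] dpos0 in simp)
  have convex: "(d (Suc n))\<^sup>2 \<le> d n * d (n + 2)" for n
  proof -
    have "(cmod (ip \<alpha> (k n) (k (n + 2))))\<^sup>2 \<le> d n * d (n + 2)"
      unfolding d_def norm2_def by (intro cauchy_schwarz continuous_L2 kC)
    then show ?thesis using ipd[of n "n + 2" "Suc n"] by simp
  qed
  have mult: "d (m + n + 1) \<le> total * (d m * d n)" for m n
    using norm2_conv[OF kC kC, of m n] unfolding kconv d_def .
  obtain r m where r: "0 < r" and m: "0 < m" "(\<lambda>n. d n / r ^ n) \<longlonglongrightarrow> m"
    by (rule log_convex_limit[of d total, OF dpos0 dpos1 _ convex total_pos mult]) (auto simp: d_def norm2_nonneg)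
  \<comment> \<open>\<open>k (2 * n + 1)\<close> is the \<open>(n + 1)\<close>-st power of
    \<open>L\<close>, so \<open>G n\<close> is the \<open>(n + 1)\<close>-st convolution power of
    \<open>L\<close> divided by \<open>r\<close>.\<close>
  define G where "G = (\<lambda>n x. complex_of_real (1 / r ^ Suc n) * k (2 * n + 1) x)"
  have GC: "C (G n)" for n unfolding G_def by (intro continuous_intros kC)
  have Gstar: "star (G n) = G n" for n
    using kstar[of "2 * n + 1"] by (simp add: G_def star_def fun_eq_iff)
  define L where "L = conv K K"
  have Lk: "L = k 1" by (simp add: L_def k0 kSuc)
  have LC: "C L" unfolding Lk by (rule kC)
  have GG: "conv (G i) (G j) = G (i + j + 1)" for i j
    unfolding G_def conv_scale kconv by (auto simp: fun_eq_iff power_add[symmetric] field_simps)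
  have LG: "conv L (G n) = (\<lambda>x. complex_of_real r * G (Suc n) x)" for n
    unfolding G_def conv_scale Lk kconv using r by (auto simp: fun_eq_iff field_simps)
  define \<delta> where "\<delta> = (\<lambda>n. d n / r ^ n)"
  have \<delta>lim: "\<delta> \<longlonglongrightarrow> m" using m by (simp add: \<delta>_def)
  have ipG: "ip \<alpha> (G i) (G j) = complex_of_real (\<delta> (i + j + 1) / r)" for i j
  proof -
    have "ip \<alpha> (G i) (G j) = complex_of_real (1 / r ^ Suc i) * (complex_of_real (1 / r ^ Suc j) * ip \<alpha> (k (2 * i + 1)) (k (2 * j + 1)))"
    proof -
      have kL: "L2 \<alpha> (k n)" for n by (intro continuous_L2 kC)
      have 1: "ip \<alpha> (\<lambda>x. c * k n x) h = c * ip \<alpha> (k n) h" if "L2 \<alpha> h" for c n h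
        by (rule ip_simps(5)[OF kL kL that])
      have 2: "ip \<alpha> h (\<lambda>x. c * k n x) = cnj c * ip \<alpha> h (k n)" if "L2 \<alpha> h" for c n h
        by (rule ip_simps(6)[OF kL kL that])
      show ?thesis unfolding G_def 1[OF L2_cmult[OF kL]] 2[OF kL] by simp
    qed
    also have "ip \<alpha> (k (2 * i + 1)) (k (2 * j + 1)) = complex_of_real (d (i + j + 1))"
      by (rule ipd) simp
    finally show ?thesis using r by (simp add: \<delta>_def power_add[symmetric] field_simps)
  qed
  \<comment> \<open>All three inner products are values of the convergent sequence
    \<open>\<delta>\<close>, so the differences are small in L^2.\<close>
  have diff: "norm2 (\<lambda>x. G i x - G j x) = (\<delta> (2 * i + 1) + \<delta> (2 * j + 1) - 2 * \<delta> (i + j + 1)) / r" for i j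
  proof -
    have L2: "L2 \<alpha> (G i)" "L2 \<alpha> (G j)" by (intro continuous_L2 GC)+
    note L2d = L2_diff[OF L2]
    have "complex_of_real (norm2 (\<lambda>x. G i x - G j x)) = ip \<alpha> (G i) (G i) - ip \<alpha> (G i) (G j) - (ip \<alpha> (G j) (G i) - ip \<alpha> (G j) (G j))"
      unfolding ip_norm2[symmetric] ip_simps(3)[OF L2 L2d] ip_simps(4)[OF L2 L2(1)] ip_simps(4)[OF L2 L2(2)] ..
    also have "\<dots> = complex_of_real ((\<delta> (2 * i + 1) + \<delta> (2 * j + 1) - 2 * \<delta> (i + j + 1)) / r)"
    proof -
      have idx: "i + i + 1 = 2 * i + 1" "j + j + 1 = 2 * j + 1" "j + i + 1 = i + j + 1" by simp_all
      have "a / r - b / r - (b / r - c / r) = (a + c - 2 * b) / r" for a b c :: real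
        by (simp add: diff_divide_distrib add_divide_distrib)
      then show ?thesis unfolding ipG idx of_real_diff[symmetric] by (simp only:)
    qed
    finally show ?thesis by (simp only: of_real_eq_iff)
  qed
  have cauchy: "uniformly_Cauchy_on UNIV (\<lambda>n. G (Suc n))"
  proof (rule uniformly_Cauchy_onI)
    fix e :: real assume e: "e > 0"
    \<comment> \<open>Chosen so that \<open>(norm2 L + 1) * (c / r) = (r * e)\<^sup>2\<close>; the
      summand \<open>1\<close> keeps the denominator positive.\<close>
    define c where "c = (r * e)\<^sup>2 * r / (norm2 L + 1)"
    have nL: "0 < norm2 L + 1" using norm2_nonneg[of L] by linarith
    have c: "0 < c" using e r nL by (simp add: c_def)
    have "Cauchy \<delta>" using \<delta>lim by (rule LIMSEQ_imp_Cauchy)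
    then obtain N where N: "\<And>i j. i \<ge> N \<Longrightarrow> j \<ge> N \<Longrightarrow> \<bar>\<delta> i - \<delta> j\<bar> < c / 2"
      using CauchyD[of \<delta> "c / 2"] c by (auto simp: real_norm_def)
    have "dist (G (Suc i) x) (G (Suc j) x) < e" if ij: "i \<ge> N" "j \<ge> N" for i j x
    proof -
      let ?g = "\<lambda>x. G i x - G j x"
      have gC: "C ?g" by (intro continuous_intros GC)
      have "norm2 ?g < c / r"
      proof -
        have "\<delta> (2 * i + 1) + \<delta> (2 * j + 1) - 2 * \<delta> (i + j + 1) < c"
          using N[of "2 * i + 1" "i + j + 1"] N[of "2 * j + 1" "i + j + 1"] ij by linarith
        then show ?thesis unfolding diff using r by (simp add: divide_strict_right_mono)
      qed
      \<comment> \<open>One further convolution with \<open>L\<close> upgrades the L^2 estimate to a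
        uniform one, so that the limit is continuous.\<close>
      have "complex_of_real r * (G (Suc i) x - G (Suc j) x) = conv L ?g x"
        unfolding conv_add(3)[OF GC GC LC] LG by (simp add: algebra_simps)
      then have "r * cmod (G (Suc i) x - G (Suc j) x) = cmod (conv L ?g x)"
        using r by (metis abs_of_pos norm_mult norm_of_real)
      then have "(r * cmod (G (Suc i) x - G (Suc j) x))\<^sup>2 \<le> norm2 L * norm2 ?g"
        using conv_bound[OF LC gC] by simp
      also have "\<dots> \<le> (norm2 L + 1) * norm2 ?g" using norm2_nonneg by (intro mult_right_mono) auto
      also have "\<dots> < (norm2 L + 1) * (c / r)" using nL \<open>norm2 ?g < c / r\<close> by (intro mult_strict_left_mono)
      also have "\<dots> = (r * e)\<^sup>2" using nL r by (simp add: c_def)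
      finally have "r * cmod (G (Suc i) x - G (Suc j) x) < r * e"
        by (rule power2_less_imp_less) (use r e in auto)
      then show ?thesis using r by (simp add: dist_norm)
    qed
    then show "\<exists>M. \<forall>x\<in>UNIV. \<forall>m\<ge>M. \<forall>n\<ge>M. dist (G (Suc m) x) (G (Suc n) x) < e" by blast
  qed
  then obtain E where unif: "uniform_limit UNIV (\<lambda>n. G (Suc n)) E sequentially"
    using Cauchy_uniformly_convergent[OF cauchy] by (auto simp: uniformly_convergent_on_def)
  have EC: "C E"
    by (rule uniform_limit_theorem[OF _ unif]) (auto intro: always_eventually GC)
  have lim: "(\<lambda>n. G (Suc n) x) \<longlonglongrightarrow> E x" for x
    using tendsto_uniform_limitI[OF unif] by simp
  have lim0: "(\<lambda>n. G n x) \<longlonglongrightarrow> E x" for x using lim by (rule LIMSEQ_imp_Suc)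
  have convlim: "(\<lambda>n. conv f (G (Suc n)) x) \<longlonglongrightarrow> conv f E x" if f: "C f" for f x
  proof (rule tendstoI)
    fix e :: real assume e: "e > 0"
    obtain B where B: "0 < B" "\<And>x. cmod (f x) \<le> B" by (rule continuous_bounded[OF f]) blast
    define e' where "e' = e / (2 * (total * B))"
    have e': "e' > 0" using e B total_pos by (simp add: e'_def)
    have "\<forall>\<^sub>F n in sequentially. \<forall>x\<in>UNIV. dist (G (Suc n) x) (E x) < e'"
      using unif e' by (simp add: uniform_limit_iff)
    then show "\<forall>\<^sub>F n in sequentially. dist (conv f (G (Suc n)) x) (conv f E x) < e"
    proof eventually_elim
      case (elim n)
      have "cmod (conv f (\<lambda>x. G (Suc n) x - E x) x) \<le> total * (B * e')"
        using elim by (intro conv_sup_bound f B continuous_intros GC EC) (auto simp: dist_norm less_imp_le)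
      also have "\<dots> = e / 2" using B total_pos by (simp add: e'_def)
      also have "\<dots> < e" using e by simp
      finally show ?case by (simp add: conv_add(3)[OF GC EC f] dist_norm)
    qed
  qed
  have GE: "conv (G i) E = E" for i
  proof
    fix x
    have "(\<lambda>n. G (i + Suc n + 1) x) \<longlonglongrightarrow> conv (G i) E x" using convlim[OF GC, of i x] by (simp add: GG)
    moreover have "(\<lambda>n. G (i + Suc n + 1) x) \<longlonglongrightarrow> E x"
      using LIMSEQ_ignore_initial_segment[OF lim0[of x], of "i + 2"] by (simp add: add_ac)
    ultimately show "conv (G i) E x = E x" by (rule LIMSEQ_unique)
  qed
  have EE: "conv E E = E"
  proof
    fix x
    have "(\<lambda>n. E x) \<longlonglongrightarrow> conv E E x"
      using convlim[OF EC, of x] by (simp add: conv_commute[OF EC GC] GE)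
    then show "conv E E x = E x" by (simp add: LIMSEQ_const_iff)
  qed
  have LE: "conv L E = (\<lambda>x. complex_of_real r * E x)"
  proof
    fix x
    have "(\<lambda>n. complex_of_real r * G (Suc (Suc n)) x) \<longlonglongrightarrow> conv L E x"
      using convlim[OF LC, of x] by (simp add: LG)
    moreover have "(\<lambda>n. complex_of_real r * G (Suc (Suc n)) x) \<longlonglongrightarrow> complex_of_real r * E x"
      by (intro tendsto_intros LIMSEQ_Suc[OF lim])
    ultimately show "conv L E x = complex_of_real r * E x" by (rule LIMSEQ_unique)
  qed
  have Es: "star E = E"
  proof
    fix x
    have "(\<lambda>n. cnj (G n (- x))) \<longlonglongrightarrow> cnj (E (- x))" by (intro tendsto_intros lim0)
    moreover have "cnj (G n (- x)) = G n x" for n using fun_cong[OF Gstar[of n], of x] by (simp add: star_def)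
    ultimately have "(\<lambda>n. G n x) \<longlonglongrightarrow> star E x" by (simp add: star_def)
    then show "star E x = E x" using lim0 LIMSEQ_unique by blast
  qed
  \<comment> \<open>Positivity of \<open>m\<close> enters here: the trace of the limit is
    \<open>m / r\<close>, so the projection is not zero.\<close>
  have "(\<lambda>n. G n 0) \<longlonglongrightarrow> complex_of_real (m / r)"
  proof -
    have "G n 0 = complex_of_real (\<delta> n / r)" for n
      unfolding G_def dk using r by (simp add: \<delta>_def)
    then show ?thesis using \<delta>lim r by (auto intro!: tendsto_intros)
  qed
  then have "E 0 = complex_of_real (m / r)" using lim0 LIMSEQ_unique by blast
  then have E0: "E 0 \<noteq> 0" using m r by simp
  show thesis by (rule that[OF r EC Es EE E0 LE[unfolded L_def]])
qed

end

section \<open>Characters of compact groups\<close>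

context compact_group begin

definition idempotent :: "('a \<Rightarrow> complex) \<Rightarrow> bool" where
  "idempotent e \<longleftrightarrow> C e \<and> star e = e \<and> conv e e = e \<and> (\<exists>x. e x \<noteq> 0)"

text \<open>An idempotent reproduces itself, so \<open>conv_bound\<close> gives the supremum bound
  \<open>norm2 e\<close>; integrating its square gives
  \<open>norm2 e \<le> total * (norm2 e)\<^sup>2\<close>. This uniform lower bound on traces takes
  the place of a dimension count.\<close>

lemma idempotent_zero:
  assumes e: "idempotent e"
  shows "e 0 = complex_of_real (norm2 e)" "1 / total \<le> norm2 e"
proof -
  have E: "C e" "star e = e" "conv e e = e" "\<exists>x. e x \<noteq> 0" using e by (auto simp: idempotent_def)
  show 1: "e 0 = complex_of_real (norm2 e)"
    using conv_star_zero[OF E(1,1)] E by (simp add: ip_norm2)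
  have pos: "0 < norm2 e" using E(4) norm2_pos[OF E(1)] by blast
  have "(cmod (e x))\<^sup>2 \<le> (norm2 e)\<^sup>2" for x
    using conv_bound[OF E(1,1), of x] E(3) by (simp add: power2_eq_square)
  then have "norm2 e \<le> (LINT x|\<alpha>. (norm2 e)\<^sup>2)"
    unfolding norm2_def[of e] using continuous_L2[OF E(1)]
    by (intro integral_mono) (auto simp: L2_def norm2_def)
  also have "\<dots> = total * (norm2 e)\<^sup>2" by (simp add: total_def)
  finally have "1 \<le> total * norm2 e" using pos by (simp add: power2_eq_square)
  then show "1 / total \<le> norm2 e" using total_pos by (simp add: pos_divide_le_eq mult.commute)
qed

text \<open>A self-adjoint idempotent of almost minimal trace \<open>e 0\<close> cannot be split, since every nonzero
  summand has trace at least \<open>1 / total\<close>. It is then a multiple of a character.\<close>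

lemma eigencharacter:
  assumes K: "C K" "star K = K" "K x \<noteq> 0"
  obtains \<gamma> r where "\<gamma> \<in> dual_group" "0 < r" "conv (conv K K) \<gamma> = (\<lambda>x. complex_of_real r * \<gamma> x)"
proof -
  define L where "L = conv K K"
  have LC: "C L" unfolding L_def by (intro C_conv K)
  obtain r E0 where r: "0 < r" and E0: "C E0" "star E0 = E0" "conv E0 E0 = E0" "E0 0 \<noteq> 0" "conv L E0 = (\<lambda>x. complex_of_real r * E0 x)"
    unfolding L_def by (rule power_idempotent[OF K])
  define \<E> where "\<E> = {e. idempotent e \<and> conv L e = (\<lambda>x. complex_of_real r * e x)}"
  have E0m: "E0 \<in> \<E>" using E0 by (auto simp: \<E>_def idempotent_def)
  define i where "i = Inf (norm2 ` \<E>)"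
  have bdd: "bdd_below (norm2 ` \<E>)" using norm2_nonneg by (intro bdd_belowI[of _ 0]) auto
  have ilow: "i \<le> norm2 e" if "e \<in> \<E>" for e unfolding i_def using bdd that by (intro cInf_lower) auto
  \<comment> \<open>The infimum need not be attained. A distance below \<open>1 / total\<close> is
    enough, because no nonzero idempotent has a smaller trace than that.\<close>
  have "Inf (norm2 ` \<E>) < i + 1 / total" using total_pos by (simp add: i_def)
  then obtain e where eE: "e \<in> \<E>" and esmall: "norm2 e < i + 1 / total"
    using cInf_lessD[of "norm2 ` \<E>"] E0m by auto
  have id: "idempotent e" and e: "C e" "star e = e" "conv e e = e" "conv L e = (\<lambda>x. complex_of_real r * e x)"
    using eE by (auto simp: \<E>_def idempotent_def)
  obtain x1 where x1: "e x1 \<noteq> 0" using id by (auto simp: idempotent_def)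
  \<comment> \<open>The power method applied to \<open>S\<close> gives an idempotent
    \<open>E\<close> absorbed by \<open>e\<close> and again in \<open>\<E>\<close>. If
    \<open>E \<noteq> e\<close>, then \<open>e\<close> splits into \<open>E\<close> of trace at
    least \<open>i\<close> and \<open>e - E\<close> of trace at least \<open>1 / total\<close>,
    which exceeds its trace. So \<open>E = e\<close>, and the eigenvalue equation reads
    \<open>conv S S = t * e\<close>.\<close>
  have square: "\<exists>t. conv S S = (\<lambda>x. complex_of_real t * e x)" if S: "C S" "star S = S" "conv e S = S" for S
  proof (cases "\<exists>x. S x \<noteq> 0")
    case False
    then have "S = (\<lambda>x. 0)" by auto
    then show ?thesis by (intro exI[of _ 0]) (simp add: conv_zero)
  next
    case True
    then obtain y where "S y \<noteq> 0" by blast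
    then obtain t E where t: "0 < t" and E: "C E" "star E = E" "conv E E = E" "E 0 \<noteq> 0"
      "conv (conv S S) E = (\<lambda>x. complex_of_real t * E x)"
      by (rule power_idempotent[OF S(1,2)])
    have SS: "C (conv S S)" by (intro C_conv S)
    have eSS: "conv e (conv S S) = conv S S" using conv_assoc[OF e(1) S(1) S(1)] S(3) by simp
    have "conv e (\<lambda>x. complex_of_real t * E x) = (\<lambda>x. complex_of_real t * E x)"
      using conv_assoc[OF e(1) SS E(1)] eSS E(5) by simp
    then have eE': "conv e E = E" using t unfolding conv_scale by (simp add: fun_eq_iff)
    have Ee: "conv E e = E" using eE' conv_commute[OF e(1) E(1)] by simp
    have LE: "conv L E = (\<lambda>x. complex_of_real r * E x)"
      using conv_assoc[OF LC e(1) E(1)] e(4) eE' by (simp add: conv_scale)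
    have EE: "E \<in> \<E>" using E LE by (auto simp: \<E>_def idempotent_def)
    have "E = e"
    proof (rule ccontr)
      assume ne: "E \<noteq> e"
      let ?D = "\<lambda>x. e x - E x"
      have DC: "C ?D" by (intro continuous_intros e E)
      have Ds: "star ?D = ?D" using e(2) E(2) by (simp add: star_def fun_eq_iff)
      have DD: "conv ?D ?D = ?D"
        unfolding conv_add(3)[OF e(1) E(1) DC] conv_add(4)[OF e(1) E(1) e(1)] conv_add(4)[OF e(1) E(1) E(1)]
        by (simp add: e(3) E(3) eE' Ee)
      obtain z where "E z \<noteq> e z" using ne by (auto simp: fun_eq_iff)
      then have "?D z \<noteq> 0" by auto
      then have "\<exists>x. ?D x \<noteq> 0" by blast
      then have Di: "idempotent ?D" using DC Ds DD by (simp add: idempotent_def)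
      have "complex_of_real (norm2 e) = complex_of_real (norm2 E + norm2 ?D)"
        using idempotent_zero(1)[OF id] idempotent_zero(1)[OF Di] idempotent_zero(1)[of E] EE by (simp add: \<E>_def algebra_simps)
      then have "norm2 e = norm2 E + norm2 ?D" by (simp only: of_real_eq_iff)
      then show False using ilow[OF EE] idempotent_zero(2)[OF Di] esmall by linarith
    qed
    then have "conv (conv S S) e = (\<lambda>x. complex_of_real t * e x)" using E(5) by simp
    moreover have "conv (conv S S) e = conv S S" using eSS conv_commute[OF e(1) SS] by simp
    ultimately show ?thesis by auto
  qed
  \<comment> \<open>Polarization: \<open>e\<close> acts as unit on \<open>S\<close>, so the square
    of \<open>e + S\<close> has cross term \<open>2 * S\<close>, while all the squares are multiples
    of \<open>e\<close>.\<close>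
  have multiple: "\<exists>c. S = (\<lambda>x. c * e x)" if S: "C S" "star S = S" "conv e S = S" for S
  proof -
    obtain t where t: "conv S S = (\<lambda>x. complex_of_real t * e x)" using square[OF S] by blast
    let ?T = "\<lambda>x. e x + S x"
    have TC: "C ?T" by (intro continuous_intros e S)
    have "star ?T = ?T" using e(2) S(2) by (simp add: star_def fun_eq_iff)
    moreover have "conv e ?T = ?T" using conv_add(1)[OF e(1) S(1) e(1)] e(3) S(3) by simp
    ultimately obtain u where u: "conv ?T ?T = (\<lambda>x. complex_of_real u * e x)" using square[OF TC] by blast
    have Se: "conv S e = S" using S(3) conv_commute[OF e(1) S(1)] by simp
    have "conv ?T ?T = (\<lambda>x. (e x + S x) + (S x + complex_of_real t * e x))"
      unfolding conv_add(1)[OF e(1) S(1) TC] conv_add(2)[OF e(1) S(1) e(1)] conv_add(2)[OF e(1) S(1) S(1)]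
      by (simp add: e(3) S(3) Se t)
    then have "(e x + S x) + (S x + complex_of_real t * e x) = complex_of_real u * e x" for x
      using u by (simp add: fun_eq_iff)
    then have "2 * S x = complex_of_real (u - t - 1) * e x" for x
      by (simp add: algebra_simps)
    then have "S x = complex_of_real ((u - t - 1) / 2) * e x" for x
      by (simp add: field_simps)
    then show ?thesis by blast
  qed
  \<comment> \<open>The translates of \<open>e\<close> are absorbed by \<open>e\<close> but are not
    self-adjoint: \<open>star\<close> exchanges those by \<open>a\<close> and \<open>- a\<close>.
    Their sum and \<open>\<i>\<close> times their difference are self-adjoint, and the translate is
    recovered from both.\<close>
  have shift: "\<exists>c. \<forall>x. e (x - a) = c * e x" for a
  proof -
    have tC: "C (\<lambda>x. e (x - b))" for b by (intro continuous_intros C_compose[OF e(1)])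
    have et: "conv e (\<lambda>x. e (x - b)) = (\<lambda>x. e (x - b))" for b
    proof
      fix x
      have "conv (\<lambda>x. e (x - b)) e x = conv e e (x - b)" by (simp add: conv_def algebra_simps)
      then show "conv e (\<lambda>x. e (x - b)) x = e (x - b)" using conv_commute[OF e(1) tC[of b]] e(3) by simp
    qed
    have es: "cnj (e (- x)) = e x" for x using fun_cong[OF e(2), of x] by (simp add: star_def)
    have es1: "cnj (e (- x - b)) = e (x - (- b))" for x b using es[of "x + b"] by simp
    let ?p = "\<lambda>x. e (x - a)" and ?m = "\<lambda>x. e (x - (- a))"
    have "\<exists>c. (\<lambda>x. ?p x + ?m x) = (\<lambda>x. c * e x)"
    proof (rule multiple)
      show "C (\<lambda>x. ?p x + ?m x)" by (intro continuous_on_add tC)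
      show "star (\<lambda>x. ?p x + ?m x) = (\<lambda>x. ?p x + ?m x)" using es1[of _ a] es1[of _ "- a"] by (simp add: star_def fun_eq_iff algebra_simps)
      show "conv e (\<lambda>x. ?p x + ?m x) = (\<lambda>x. ?p x + ?m x)" unfolding conv_add(1)[OF tC tC e(1)] et ..
    qed
    then obtain c1 where c1: "\<And>x. ?p x + ?m x = c1 * e x" by (auto simp: fun_eq_iff)
    have "\<exists>c. (\<lambda>x. \<i> * (?p x - ?m x)) = (\<lambda>x. c * e x)"
    proof (rule multiple)
      show "C (\<lambda>x. \<i> * (?p x - ?m x))" by (intro continuous_on_mult continuous_on_const continuous_on_diff tC)
      show "star (\<lambda>x. \<i> * (?p x - ?m x)) = (\<lambda>x. \<i> * (?p x - ?m x))" using es1[of _ a] es1[of _ "- a"] by (simp add: star_def fun_eq_iff algebra_simps)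
      show "conv e (\<lambda>x. \<i> * (?p x - ?m x)) = (\<lambda>x. \<i> * (?p x - ?m x))" unfolding conv_scale conv_add(3)[OF tC tC e(1)] et ..
    qed
    then obtain c2 where c2: "\<And>x. \<i> * (?p x - ?m x) = c2 * e x" by (auto simp: fun_eq_iff)
    have "?p x = (c1 - \<i> * c2) / 2 * e x" for x
    proof -
      have "\<i> * (\<i> * (?p x - ?m x)) = \<i> * (c2 * e x)" unfolding c2 ..
      then have minus: "?p x - ?m x = - (\<i> * c2 * e x)" by (simp add: algebra_simps)
      have "2 * ?p x = (?p x + ?m x) + (?p x - ?m x)" by simp
      then have "2 * ?p x = c1 * e x - \<i> * c2 * e x" unfolding c1 minus by simp
      then show ?thesis by (simp add: algebra_simps)
    qed
    then show ?thesis by blast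
  qed
  then obtain c where c: "\<And>a x. e (x - a) = c a * e x" by metis
  have e0: "e 0 = complex_of_real (norm2 e)" and n0: "0 < norm2 e"
    using idempotent_zero[OF id] norm2_pos[OF e(1) x1] by auto
  have e0': "e 0 \<noteq> 0" using e0 n0 by simp
  define \<gamma> where "\<gamma> = (\<lambda>x. e x / e 0)"
  \<comment> \<open>Translation by \<open>- y\<close> multiplies \<open>e\<close> by
    \<open>c (- y)\<close>, and evaluation at \<open>0\<close> identifies this factor as
    \<open>e y / e 0\<close>.\<close>
  have mult: "\<gamma> (x + y) = \<gamma> x * \<gamma> y" for x y
    using c[of x "- y"] c[of 0 "- y"] e0' by (simp add: \<gamma>_def field_simps)
  have "\<gamma> 0 = 1" using e0' by (simp add: \<gamma>_def)
  moreover have "\<gamma> (- x) = cnj (\<gamma> x)" for x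
    using fun_cong[OF e(2), of "- x"] e0 by (simp add: star_def \<gamma>_def)
  ultimately have "\<gamma> x * cnj (\<gamma> x) = 1" for x using mult[of x "- x"] by simp
  then have "complex_of_real ((cmod (\<gamma> x))\<^sup>2) = complex_of_real 1" for x unfolding complex_norm_square by simp
  then have "(cmod (\<gamma> x))\<^sup>2 = 1" for x by (simp only: of_real_eq_iff)
  then have "cmod (\<gamma> x) = 1" for x by (simp add: power2_eq_1_iff) (smt (verit) norm_ge_zero)
  moreover have "C \<gamma>" unfolding \<gamma>_def using e0' by (intro continuous_intros e) auto
  ultimately have "\<gamma> \<in> dual_group" using mult by (simp add: dual_group_def)
  moreover have "conv L \<gamma> = (\<lambda>x. complex_of_real r * \<gamma> x)"
    using e(4) conv_scale(1)[of L "1 / e 0" e] by (simp add: \<gamma>_def fun_eq_iff)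
  ultimately show thesis using that r unfolding L_def by blast
qed

lemma conv_character:
  assumes f: "C f" and g: "\<gamma> \<in> dual_group"
  shows "conv f \<gamma> = (\<lambda>x. ip \<alpha> f \<gamma> * \<gamma> x)"
proof
  fix x
  note D = dual_groupD[OF g]
  have "conv f \<gamma> x = conv \<gamma> f x" using conv_commute[OF f D(1)] by simp
  also have "\<dots> = (LINT y|\<alpha>. f y * cnj (\<gamma> y) * \<gamma> x)"
    unfolding conv_def using D(2)[of x "- _"] D(5) by (simp add: mult_ac)
  finally show "conv f \<gamma> x = ip \<alpha> f \<gamma> * \<gamma> x" by (simp add: ip_def)
qed

section \<open>Separation of points\<close>

lemma urysohn_function:
  assumes "closed S" "closed T" "S \<inter> T = {}"
  obtains u :: "'a \<Rightarrow> real" where "continuous_on UNIV u" "\<And>x. 0 \<le> u x \<and> u x \<le> 1" "\<And>x. x \<in> S \<Longrightarrow> u x = 0" "\<And>x. x \<in> T \<Longrightarrow> u x = 1"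
proof -
  have "compact_space (euclidean :: 'a topology)" using compact_UNIV by (simp add: compact_space_def)
  moreover have "Hausdorff_space (euclidean :: 'a topology)" by (simp add: Hausdorff_space_def disjnt_def) (meson hausdorff)
  ultimately have "normal_space (euclidean :: 'a topology)" by (intro compact_Hausdorff_or_regular_imp_normal_space) auto
  moreover have "closedin euclidean S" "closedin euclidean T" "disjnt S T" using assms by (auto simp: disjnt_def)
  moreover have "(0::real) \<le> 1" by simp
  ultimately obtain u :: "'a \<Rightarrow> real" where u: "continuous_map euclidean (top_of_set {0..1}) u" "u ` S \<subseteq> {0}" "u ` T \<subseteq> {1}"
    by (rule Urysohn_lemma)
  then have "continuous_on UNIV u" "range u \<subseteq> {0..1}" by (auto simp: continuous_map_in_subtopology image_subset_iff_funcset)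
  then show thesis using u that[of u] by (auto simp: image_subset_iff)
qed

text \<open>Let \<open>k\<close> be a function minus its translate by \<open>x0\<close>. Convolution
  with \<open>k\<close> annihilates every character that is \<open>1\<close> at \<open>x0\<close>,
  but \<open>K = k * star k\<close> is a nonzero self-adjoint kernel and therefore has an
  eigencharacter with positive eigenvalue.\<close>

lemma characters_separate_points:
  fixes x0 :: 'a
  assumes x0: "x0 \<noteq> 0"
  obtains \<gamma> where "\<gamma> \<in> dual_group" "\<gamma> x0 \<noteq> 1"
proof -
  obtain u :: "'a \<Rightarrow> real" where u: "continuous_on UNIV u" "u x0 = 0" "u 0 = 1"
    by (rule urysohn_function[of "{x0}" "{0}"]) (use x0 in auto)
  define w where "w = (\<lambda>x. complex_of_real (u x))"
  have wC: "C w" unfolding w_def by (intro continuous_intros u)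
  define v where "v = (\<lambda>x. w (x - x0))"
  have vC: "C v" unfolding v_def by (intro continuous_intros C_compose[OF wC])
  define k where "k = (\<lambda>x. w x - v x)"
  have kC: "C k" unfolding k_def by (intro continuous_intros wC vC)
  have "k x0 \<noteq> 0" using u by (simp add: k_def v_def w_def)
  then have kn: "0 < norm2 k" by (rule norm2_pos[OF kC])
  define K where "K = conv k (star k)"
  have sC: "C (star k)" by (rule C_star[OF kC])
  have KC: "C K" unfolding K_def by (intro C_conv kC sC)
  have "star (star k) = k" by (simp add: star_def fun_eq_iff)
  then have Ks: "star K = K" unfolding K_def star_conv[OF kC sC] using conv_commute[OF sC kC] by simp
  have "K 0 \<noteq> 0" unfolding K_def conv_star_zero[OF kC kC] ip_norm2 using kn by simp
  then obtain \<gamma> r where g: "\<gamma> \<in> dual_group" and r: "0 < r" "conv (conv K K) \<gamma> = (\<lambda>x. complex_of_real r * \<gamma> x)"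
    by (rule eigencharacter[OF KC Ks])
  note D = dual_groupD[OF g]
  have "\<gamma> x0 \<noteq> 1"
  proof
    assume one: "\<gamma> x0 = 1"
    have "conv v \<gamma> x = conv w \<gamma> (x - x0)" for x by (simp add: conv_def v_def algebra_simps)
    moreover have "\<gamma> (x - x0) = \<gamma> x" for x using D(2)[of "x - x0" x0] one by simp
    ultimately have "conv v \<gamma> = conv w \<gamma>" unfolding conv_character[OF wC g] by auto
    then have "conv k \<gamma> = (\<lambda>x. 0)" unfolding k_def conv_add(4)[OF wC vC D(1)] by simp
    then have "conv K \<gamma> = (\<lambda>x. 0)"
      using conv_assoc[OF sC kC D(1)] conv_commute[OF kC sC] by (simp add: K_def conv_zero)
    then have "conv (conv K K) \<gamma> = (\<lambda>x. 0)"
      using conv_assoc[OF KC KC D(1)] by (simp add: conv_zero)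
    then have "complex_of_real r * \<gamma> 0 = 0" using r(2) by (metis)
    then show False using r(1) D(4) by simp
  qed
  with g show thesis by (rule that)
qed

section \<open>Trigonometric polynomials\<close>

inductive trig :: "('a \<Rightarrow> complex) \<Rightarrow> bool" where
  trig_zero: "trig (\<lambda>x. 0)"
| trig_step: "trig f \<Longrightarrow> \<gamma> \<in> dual_group \<Longrightarrow> trig (\<lambda>x. f x + c * \<gamma> x)"

lemma trig_continuous: "trig f \<Longrightarrow> C f"
proof (induction rule: trig.induct)
  case (trig_step f \<gamma> c)
  show ?case
    by (intro continuous_on_add continuous_on_mult continuous_on_const trig_step.IH dual_groupD(1)[OF trig_step.hyps(2)])
qed simp

lemma trig_add: "trig g \<Longrightarrow> trig f \<Longrightarrow> trig (\<lambda>x. f x + g x)"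
proof (induction rule: trig.induct)
  case (trig_step g \<gamma> c)
  then show ?case using trig.trig_step[of "\<lambda>x. f x + g x" \<gamma> c] by (simp add: add.assoc)
qed simp

lemma trig_character: "\<gamma> \<in> dual_group \<Longrightarrow> trig (\<lambda>x. c * \<gamma> x)"
  using trig_step[OF trig_zero, of \<gamma> c] by simp

lemma dual_group_mult: "\<gamma> \<in> dual_group \<Longrightarrow> \<eta> \<in> dual_group \<Longrightarrow> (\<lambda>x. \<gamma> x * \<eta> x) \<in> dual_group"
  by (auto simp: dual_group_def norm_mult mult_ac intro!: continuous_intros)

lemma dual_group_cnj: "\<gamma> \<in> dual_group \<Longrightarrow> (\<lambda>x. cnj (\<gamma> x)) \<in> dual_group"
  by (auto simp: dual_group_def intro!: continuous_intros)

lemma dual_group_one: "(\<lambda>x. 1) \<in> dual_group"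
  by (auto simp: dual_group_def)

lemma trig_mult_character: "trig f \<Longrightarrow> \<gamma> \<in> dual_group \<Longrightarrow> trig (\<lambda>x. c * \<gamma> x * f x)"
proof (induction rule: trig.induct)
  case (trig_step f \<eta> d)
  then show ?case
    using trig.trig_step[OF trig_step.IH[OF trig_step.prems] dual_group_mult[OF trig_step.prems trig_step.hyps(2)], of "c * d"]
    by (simp add: algebra_simps)
qed (simp add: trig_zero)

lemma trig_mult: "trig f \<Longrightarrow> trig g \<Longrightarrow> trig (\<lambda>x. f x * g x)"
proof (induction rule: trig.induct)
  case (trig_step f \<gamma> c)
  have "trig (\<lambda>x. f x * g x + c * \<gamma> x * g x)"
    using trig_step by (intro trig_add trig_mult_character)
  then show ?case by (simp add: distrib_right)
qed (simp add: trig_zero)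

lemma trig_const: "trig (\<lambda>x. c)"
  using trig_character[OF dual_group_one, of c] by simp

lemma trig_cmult: "trig f \<Longrightarrow> trig (\<lambda>x. c * f x)"
  using trig_mult[OF trig_const] .

lemma trig_cnj: "trig f \<Longrightarrow> trig (\<lambda>x. cnj (f x))"
proof (induction rule: trig.induct)
  case (trig_step f \<gamma> c)
  then show ?case using trig.trig_step[OF trig_step.IH dual_group_cnj, of \<gamma> "cnj c"] by simp
qed (simp add: trig_zero)

text \<open>Repeated characters are merged into one term, since orthogonality and
  \<open>square_expansion\<close> need distinct indices.\<close>

lemma trig_sum:
  assumes "trig f"
  obtains J a where "finite J" "J \<subseteq> dual_group" "f = (\<lambda>x. \<Sum>\<gamma>\<in>J. a \<gamma> * \<gamma> x)"
proof -
  have "\<exists>J a. finite J \<and> J \<subseteq> dual_group \<and> f = (\<lambda>x. \<Sum>\<gamma>\<in>J. a \<gamma> * \<gamma> x)"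
    using assms
  proof (induction rule: trig.induct)
    case trig_zero
    show ?case by (intro exI[of _ "{}"]) auto
  next
    case (trig_step f \<eta> c)
    then obtain J a where J: "finite J" "J \<subseteq> dual_group" "f = (\<lambda>x. \<Sum>\<gamma>\<in>J. a \<gamma> * \<gamma> x)" by blast
    define b where "b = (\<lambda>\<gamma>. (if \<gamma> \<in> J then a \<gamma> else 0) + (if \<gamma> = \<eta> then c else 0))"
    have "f x + c * \<eta> x = (\<Sum>\<gamma>\<in>insert \<eta> J. b \<gamma> * \<gamma> x)" for x
    proof -
      have "(\<Sum>\<gamma>\<in>insert \<eta> J. b \<gamma> * \<gamma> x) = (\<Sum>\<gamma>\<in>insert \<eta> J. (if \<gamma> \<in> J then a \<gamma> * \<gamma> x else 0) + (if \<gamma> = \<eta> then c * \<gamma> x else 0))"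
        by (intro sum.cong) (auto simp: b_def distrib_right)
      also have "\<dots> = (\<Sum>\<gamma>\<in>insert \<eta> J. if \<gamma> \<in> J then a \<gamma> * \<gamma> x else 0) + c * \<eta> x"
        using J(1) by (simp add: sum.distrib)
      also have "(\<Sum>\<gamma>\<in>insert \<eta> J. if \<gamma> \<in> J then a \<gamma> * \<gamma> x else 0) = (\<Sum>\<gamma>\<in>J. a \<gamma> * \<gamma> x)"
        using J(1) by (intro sum.mono_neutral_cong_right) auto
      finally show ?thesis by (simp add: J(3))
    qed
    then show ?case using J trig_step.hyps by (intro exI[of _ "insert \<eta> J"] exI[of _ b]) auto
  qed
  then show thesis using that by blast
qed

text \<open>The real form of Stone--Weierstrass is used, for the ring of real functions that are
  trigonometric polynomials as complex ones. It separates points because real and imaginary parts of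
  characters belong to it.\<close>

lemma trig_uniformly_dense:
  fixes u :: "'a \<Rightarrow> real"
  assumes u: "continuous_on UNIV u" and e: "0 < e"
  obtains P where "trig P" "\<And>x. cmod (complex_of_real (u x) - P x) < e"
proof -
  define R where "R = {g :: 'a \<Rightarrow> real. trig (\<lambda>x. complex_of_real (g x))}"
  have R: "function_ring_on R UNIV"
  proof
    show "compact (UNIV :: 'a set)" by (rule compact_UNIV)
    show "continuous_on UNIV g" if "g \<in> R" for g
      using that trig_continuous[of "\<lambda>x. complex_of_real (g x)"] by (simp add: R_def)
    show "(\<lambda>x. f x + g x) \<in> R" "(\<lambda>x. f x * g x) \<in> R" if "f \<in> R" "g \<in> R" for f g
      using that trig_add trig_mult by (auto simp: R_def)
    show "(\<lambda>_. c) \<in> R" for c using trig_const by (simp add: R_def)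
    show "\<exists>f\<in>R. f x \<noteq> f y" if "x \<noteq> y" for x y
    proof -
      obtain \<gamma> where g: "\<gamma> \<in> dual_group" "\<gamma> (x - y) \<noteq> 1"
        by (rule characters_separate_points[of "x - y"]) (use \<open>x \<noteq> y\<close> in auto)
      note D = dual_groupD[OF g(1)]
      have "\<gamma> x \<noteq> \<gamma> y"
      proof
        assume "\<gamma> x = \<gamma> y"
        then have "\<gamma> (x - y) = 1" using D(6)[of y] by (simp add: D(7) mult.commute)
        with g(2) show False ..
      qed
      then have ri: "Re (\<gamma> x) \<noteq> Re (\<gamma> y) \<or> Im (\<gamma> x) \<noteq> Im (\<gamma> y)" by (auto simp: complex_eq_iff)
      have t: "trig \<gamma>" using trig_character[OF g(1), of 1] by simp
      have "trig (\<lambda>x. (1/2) * (\<gamma> x + cnj (\<gamma> x)))" "trig (\<lambda>x. (- \<i> / 2) * (\<gamma> x + (-1) * cnj (\<gamma> x)))"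
        by (intro trig_cmult trig_add trig_cnj t)+
      moreover have "(1/2) * (z + cnj z) = complex_of_real (Re z)" "(- \<i> / 2) * (z + (-1) * cnj z) = complex_of_real (Im z)" for z
        by (simp_all add: complex_eq_iff)
      ultimately have mem: "(\<lambda>x. Re (\<gamma> x)) \<in> R" "(\<lambda>x. Im (\<gamma> x)) \<in> R"
        unfolding R_def by simp_all
      from ri show ?thesis
      proof
        assume "Re (\<gamma> x) \<noteq> Re (\<gamma> y)"
        then show ?thesis by (intro bexI[OF _ mem(1)])
      next
        assume "Im (\<gamma> x) \<noteq> Im (\<gamma> y)"
        then show ?thesis by (intro bexI[OF _ mem(2)])
      qed
    qed
  qed
  then obtain g where g: "g \<in> R" "\<And>x. \<bar>u x - g x\<bar> < e"
    using function_ring_on.Stone_Weierstrass_basic[OF R u e] by auto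
  show thesis
  proof (rule that[of "\<lambda>x. complex_of_real (g x)"])
    show "trig (\<lambda>x. complex_of_real (g x))" using g(1) by (simp add: R_def)
    show "cmod (complex_of_real (u x) - complex_of_real (g x)) < e" for x
      using g(2)[of x] by (simp flip: of_real_diff)
  qed
qed

section \<open>Density in L^2 and Parseval's identity\<close>

definition approximable :: "('a \<Rightarrow> complex) \<Rightarrow> bool" where
  "approximable f \<longleftrightarrow> L2 \<alpha> f \<and> (\<forall>e>0. \<exists>P. trig P \<and> norm2 (\<lambda>x. f x - P x) < e)"

lemma norm2_add:
  assumes "L2 \<alpha> f" "L2 \<alpha> g"
  shows "norm2 (\<lambda>x. f x + g x) \<le> 2 * norm2 f + 2 * norm2 g"
proof -
  have "norm2 (\<lambda>x. f x + g x) \<le> (LINT x|\<alpha>. 2 * (cmod (f x))\<^sup>2 + 2 * (cmod (g x))\<^sup>2)"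
    unfolding norm2_def
  proof (rule integral_mono)
    show "integrable \<alpha> (\<lambda>x. (cmod (f x + g x))\<^sup>2)" using L2_add[OF assms] by (simp add: L2_def)
    show "integrable \<alpha> (\<lambda>x. 2 * (cmod (f x))\<^sup>2 + 2 * (cmod (g x))\<^sup>2)" using assms by (simp add: L2_def)
  qed (rule cmod_add_square_le)
  also have "\<dots> = 2 * norm2 f + 2 * norm2 g" using assms by (simp add: norm2_def L2_def)
  finally show ?thesis .
qed

lemma approximable_limit:
  assumes f: "L2 \<alpha> f" and ap: "\<And>e. 0 < e \<Longrightarrow> \<exists>g. approximable g \<and> norm2 (\<lambda>x. f x - g x) < e"
  shows "approximable f"
  unfolding approximable_def
proof (intro conjI allI impI f)
  fix e :: real assume e: "0 < e"
  then obtain g where g: "approximable g" "norm2 (\<lambda>x. f x - g x) < e / 4" using ap[of "e / 4"] by auto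
  then obtain P where P: "trig P" "norm2 (\<lambda>x. g x - P x) < e / 4" "L2 \<alpha> g"
    using e unfolding approximable_def by (meson divide_pos_pos zero_less_numeral)
  have "L2 \<alpha> P" using trig_continuous[OF P(1)] by (rule continuous_L2)
  then have "norm2 (\<lambda>x. (f x - g x) + (g x - P x)) \<le> 2 * norm2 (\<lambda>x. f x - g x) + 2 * norm2 (\<lambda>x. g x - P x)"
    using f P(3) by (intro norm2_add L2_diff)
  then have "norm2 (\<lambda>x. f x - P x) < e" using g(2) P(2) by simp
  with P(1) show "\<exists>P. trig P \<and> norm2 (\<lambda>x. f x - P x) < e" by blast
qed

lemma approximable_zero: "approximable (\<lambda>x. 0)"
  unfolding approximable_def using trig_zero continuous_L2[of "\<lambda>x. 0"]
  by (auto intro!: exI[of _ "\<lambda>x. 0"] simp: norm2_def)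

lemma approximable_add:
  assumes "approximable f" "approximable g"
  shows "approximable (\<lambda>x. f x + g x)"
  unfolding approximable_def
proof (intro conjI allI impI)
  have L: "L2 \<alpha> f" "L2 \<alpha> g" using assms by (auto simp: approximable_def)
  then show "L2 \<alpha> (\<lambda>x. f x + g x)" by (rule L2_add)
  fix e :: real assume e: "0 < e"
  then have e4: "0 < e / 4" by simp
  obtain P Q where P: "trig P" "norm2 (\<lambda>x. f x - P x) < e / 4" and Q: "trig Q" "norm2 (\<lambda>x. g x - Q x) < e / 4"
    using assms e4 unfolding approximable_def by blast
  have "norm2 (\<lambda>x. (f x - P x) + (g x - Q x)) \<le> 2 * norm2 (\<lambda>x. f x - P x) + 2 * norm2 (\<lambda>x. g x - Q x)"
    by (intro norm2_add L2_diff L continuous_L2 trig_continuous P Q)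
  then have "norm2 (\<lambda>x. (f x - P x) + (g x - Q x)) < e" using P(2) Q(2) by linarith
  then have "norm2 (\<lambda>x. (f x + g x) - (P x + Q x)) < e" by (simp add: algebra_simps)
  then show "\<exists>P. trig P \<and> norm2 (\<lambda>x. (f x + g x) - P x) < e" using trig_add[OF Q(1) P(1)] by blast
qed

lemma approximable_cmult:
  assumes "approximable f"
  shows "approximable (\<lambda>x. c * f x)"
  unfolding approximable_def
proof (intro conjI allI impI)
  show "L2 \<alpha> (\<lambda>x. c * f x)" using assms by (auto simp: approximable_def intro: L2_cmult)
  fix e :: real assume e: "0 < e"
  define b where "b = (cmod c)\<^sup>2 + 1"
  have b: "0 < b" by (simp add: b_def add_nonneg_pos)
  then have "0 < e / b" using e by simp
  then obtain P where P: "trig P" "norm2 (\<lambda>x. f x - P x) < e / b"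
    using assms unfolding approximable_def by blast
  have "norm2 (\<lambda>x. c * f x - c * P x) = (cmod c)\<^sup>2 * norm2 (\<lambda>x. f x - P x)"
    by (simp add: norm2_def norm_mult power_mult_distrib flip: right_diff_distrib)
  also have "\<dots> \<le> b * norm2 (\<lambda>x. f x - P x)" using norm2_nonneg by (intro mult_right_mono) (auto simp: b_def)
  also have "\<dots> < e" using P(2) b by (simp add: pos_less_divide_eq mult.commute)
  finally show "\<exists>P. trig P \<and> norm2 (\<lambda>x. c * f x - P x) < e" using trig_cmult[OF P(1)] by blast
qed

text \<open>Outer regularity encloses \<open>B\<close> in an open \<open>U\<close>; inner regularity
  of \<open>U\<close>, not of \<open>B\<close>, gives a compact \<open>K\<close>. A Urysohn function
  between \<open>K\<close> and the complement of \<open>U\<close> differs from the indicator only on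
  \<open>U - B\<close> and \<open>U - K\<close>.\<close>

lemma indicator_approximation:
  assumes B: "B \<in> sets \<alpha>" and e: "0 < e"
  obtains u :: "'a \<Rightarrow> real" where "continuous_on UNIV u" "norm2 (\<lambda>x. indicator B x - complex_of_real (u x)) < e"
proof -
  have "emeasure \<alpha> B = (INF U\<in>{U. openin (top_of_set UNIV) U \<and> B \<subseteq> U}. emeasure \<alpha> U)"
    using haar B unfolding is_haar_def by blast
  moreover have "emeasure \<alpha> B < ennreal (measure \<alpha> B + e / 4)"
    using e by (simp add: emeasure_eq_measure ennreal_less_iff)
  ultimately have "\<exists>U\<in>{U. openin (top_of_set UNIV) U \<and> B \<subseteq> U}. emeasure \<alpha> U < ennreal (measure \<alpha> B + e / 4)"
    by (metis (no_types, lifting) INF_less_iff)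
  then obtain U where U: "open U" "B \<subseteq> U" "measure \<alpha> U < measure \<alpha> B + e / 4"
    by (auto simp: emeasure_eq_measure ennreal_less_iff)
  have Um: "U \<in> sets \<alpha>" using U sets_haar by auto
  have "\<exists>K. compact K \<and> K \<subseteq> U \<and> measure \<alpha> U - e / 4 < measure \<alpha> K"
  proof (cases "measure \<alpha> U - e / 4 < 0")
    case True
    then show ?thesis by (intro exI[of _ "{}"]) auto
  next
    case False
    have "openin (top_of_set UNIV) U" using U(1) by simp
    then have "emeasure \<alpha> U = (SUP K\<in>{K. compact K \<and> K \<subseteq> U}. emeasure \<alpha> K)"
      using haar unfolding is_haar_def by blast
    moreover have "ennreal (measure \<alpha> U - e / 4) < emeasure \<alpha> U"
      using e False by (simp add: emeasure_eq_measure ennreal_less_iff)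
    ultimately have "\<exists>K\<in>{K. compact K \<and> K \<subseteq> U}. ennreal (measure \<alpha> U - e / 4) < emeasure \<alpha> K"
      by (metis (no_types, lifting) less_SUP_iff)
    then show ?thesis using False by (auto simp: emeasure_eq_measure ennreal_less_iff)
  qed
  then obtain K where K: "compact K" "K \<subseteq> U" "measure \<alpha> U - e / 4 < measure \<alpha> K" by blast
  have Km: "K \<in> sets \<alpha>" using K sets_haar by (simp add: compact_imp_closed)
  obtain u :: "'a \<Rightarrow> real" where u: "continuous_on UNIV u" "\<And>x. 0 \<le> u x \<and> u x \<le> 1" "\<And>x. x \<in> - U \<Longrightarrow> u x = 0" "\<And>x. x \<in> K \<Longrightarrow> u x = 1"
    by (rule urysohn_function[of "- U" K]) (use U K in \<open>auto intro: compact_imp_closed\<close>)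
  have uL: "L2 \<alpha> (\<lambda>x. complex_of_real (u x))" by (intro continuous_L2 continuous_intros u)
  have iL: "L2 \<alpha> (indicator B :: 'a \<Rightarrow> complex)"
    by (rule L2_bounded[where B = 1]) (use B in \<open>auto simp: indicator_def\<close>)
  have "norm2 (\<lambda>x. indicator B x - complex_of_real (u x)) \<le> (LINT x|\<alpha>. indicator (U - B) x + indicator (U - K) x)"
    unfolding norm2_def
  proof (rule integral_mono)
    show "integrable \<alpha> (\<lambda>x. (cmod (indicator B x - complex_of_real (u x)))\<^sup>2)"
      using L2_diff[OF iL uL] by (simp add: L2_def)
    show "integrable \<alpha> (\<lambda>x. indicator (U - B) x + indicator (U - K) x :: real)"
      using Um Km B by (intro Bochner_Integration.integrable_add integrable_real_indicator) (auto simp: emeasure_eq_measure)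
    fix x
    have sq: "(cmod (1 - complex_of_real (u x)))\<^sup>2 \<le> 1" "(cmod (complex_of_real (u x)))\<^sup>2 \<le> 1"
    proof -
      have "cmod (1 - complex_of_real (u x)) = \<bar>1 - u x\<bar>" by (metis norm_of_real of_real_1 of_real_diff)
      then have "cmod (1 - complex_of_real (u x)) \<le> 1" "cmod (complex_of_real (u x)) \<le> 1" using u(2)[of x] by auto
      then show "(cmod (1 - complex_of_real (u x)))\<^sup>2 \<le> 1" "(cmod (complex_of_real (u x)))\<^sup>2 \<le> 1"
        using power_le_one[OF norm_ge_zero] by blast+
    qed
    show "(cmod (indicator B x - complex_of_real (u x)))\<^sup>2 \<le> indicator (U - B) x + indicator (U - K) x"
      using sq u(3)[of x] u(4)[of x] U(2) K(2) by (cases "x \<in> U"; cases "x \<in> K"; cases "x \<in> B") (auto simp: indicator_def)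
  qed
  also have "\<dots> = measure \<alpha> (U - B) + measure \<alpha> (U - K)"
    using Um Km B by (subst Bochner_Integration.integral_add) (auto simp: emeasure_eq_measure)
  also have "\<dots> = (measure \<alpha> U - measure \<alpha> B) + (measure \<alpha> U - measure \<alpha> K)"
    using Um Km B U K by (simp add: finite_measure_Diff)
  also have "\<dots> < e" using U(3) K(3) e by linarith
  finally show thesis by (rule that[OF u(1)])
qed

lemma approximable_continuous:
  assumes u: "continuous_on UNIV (u :: 'a \<Rightarrow> real)"
  shows "approximable (\<lambda>x. complex_of_real (u x))"
  unfolding approximable_def
proof (intro conjI allI impI)
  show "L2 \<alpha> (\<lambda>x. complex_of_real (u x))" by (intro continuous_L2 continuous_intros u)
  fix e :: real assume e: "0 < e"
  define d where "d = sqrt (e / (2 * total))"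
  have d: "0 < d" "d\<^sup>2 = e / (2 * total)" using e total_pos by (auto simp: d_def)
  obtain P where P: "trig P" "\<And>x. cmod (complex_of_real (u x) - P x) < d" by (rule trig_uniformly_dense[OF u d(1)]) blast
  have "norm2 (\<lambda>x. complex_of_real (u x) - P x) \<le> (LINT x|\<alpha>. d\<^sup>2)"
    unfolding norm2_def using P
    by (intro integral_mono continuous_integrable continuous_intros u trig_continuous power_mono) (auto simp: less_imp_le)
  also have "\<dots> = e / 2" using total_pos d by (simp add: total_def)
  also have "\<dots> < e" using e by simp
  finally show "\<exists>P. trig P \<and> norm2 (\<lambda>x. complex_of_real (u x) - P x) < e" using P(1) by blast
qed

lemma approximable_indicator:
  assumes B: "B \<in> sets \<alpha>" shows "approximable (indicator B)"
proof (rule approximable_limit)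
  show "L2 \<alpha> (indicator B)" by (rule L2_bounded[where B = 1]) (use B in \<open>auto simp: indicator_def\<close>)
  fix e :: real assume "0 < e"
  then obtain u :: "'a \<Rightarrow> real" where "continuous_on UNIV u" "norm2 (\<lambda>x. indicator B x - complex_of_real (u x)) < e"
    by (rule indicator_approximation[OF B])
  then show "\<exists>g. approximable g \<and> norm2 (\<lambda>x. indicator B x - g x) < e" using approximable_continuous by blast
qed

lemma approximable_simple:
  assumes s: "simple_function \<alpha> (s :: 'a \<Rightarrow> complex)" shows "approximable s"
proof -
  have fin: "finite (range s)" and meas: "\<And>z. s -` {z} \<in> sets \<alpha>"
    using simple_functionD(1)[OF s] simple_functionD(2)[OF s, of "{_}"] by auto
  have sum: "approximable (\<lambda>x. \<Sum>z\<in>Z. z * indicator (s -` {z}) x)" if "finite Z" for Z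
    using that
  proof (induction rule: finite_induct)
    case (insert z Z)
    show ?case
      unfolding sum.insert[OF insert.hyps]
      by (intro approximable_add approximable_cmult approximable_indicator meas insert.IH)
  qed (simp add: approximable_zero)
  have "s x = (\<Sum>z\<in>range s. z * indicator (s -` {z}) x)" for x
  proof -
    have "(\<Sum>z\<in>range s. z * indicator (s -` {z}) x) = (\<Sum>z\<in>range s. if z = s x then z else 0)"
      by (intro sum.cong) (auto simp: indicator_def)
    then show ?thesis using fin by simp
  qed
  then have "s = (\<lambda>x. \<Sum>z\<in>range s. z * indicator (s -` {z}) x)" by (rule ext)
  then show ?thesis using sum[OF fin] by simp
qed

lemma approximable_L2:
  assumes f: "L2 \<alpha> f" shows "approximable f"
proof (rule approximable_limit[OF f])
  fix e :: real assume e: "0 < e"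
  have fm [measurable]: "f \<in> borel_measurable \<alpha>" using f by (simp add: L2_def)
  obtain F where F: "\<And>n. simple_function \<alpha> (F n)" "\<And>x. x \<in> space \<alpha> \<Longrightarrow> (\<lambda>n. F n x) \<longlonglongrightarrow> f x"
    "\<And>n x. x \<in> space \<alpha> \<Longrightarrow> dist (F n x) 0 \<le> 2 * dist (f x) 0"
    using borel_measurable_implies_sequence_metric[OF fm, of 0] by blast
  have [measurable]: "F n \<in> borel_measurable \<alpha>" for n using F(1) by (rule borel_measurable_simple_function)
  have "(\<lambda>n. norm2 (\<lambda>x. f x - F n x)) \<longlonglongrightarrow> (LINT x|\<alpha>. 0)"
    unfolding norm2_def
  \<comment> \<open>The factor is \<open>(1 + 2)\<^sup>2\<close>, from
    \<open>|F n| \<le> 2 * |f|\<close>.\<close>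
  proof (rule integral_dominated_convergence[where w = "\<lambda>x. 9 * (cmod (f x))\<^sup>2"])
    show "integrable \<alpha> (\<lambda>x. 9 * (cmod (f x))\<^sup>2)" using f by (simp add: L2_def)
    show "AE x in \<alpha>. (\<lambda>n. (cmod (f x - F n x))\<^sup>2) \<longlonglongrightarrow> 0"
    proof (rule AE_I2)
      fix x assume "x \<in> space \<alpha>"
      then have "(\<lambda>n. (cmod (f x - F n x))\<^sup>2) \<longlonglongrightarrow> (cmod (f x - f x))\<^sup>2" by (intro tendsto_intros F(2))
      then show "(\<lambda>n. (cmod (f x - F n x))\<^sup>2) \<longlonglongrightarrow> 0" by simp
    qed
    show "AE x in \<alpha>. norm ((cmod (f x - F n x))\<^sup>2) \<le> 9 * (cmod (f x))\<^sup>2" for n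
    proof (rule AE_I2)
      fix x assume x: "x \<in> space \<alpha>"
      have "cmod (f x - F n x) \<le> cmod (f x) + cmod (F n x)" by (rule norm_triangle_ineq4)
      also have "\<dots> \<le> 3 * cmod (f x)" using F(3)[OF x, of n] by simp
      finally have "(cmod (f x - F n x))\<^sup>2 \<le> (3 * cmod (f x))\<^sup>2" by (intro power_mono) auto
      then show "norm ((cmod (f x - F n x))\<^sup>2) \<le> 9 * (cmod (f x))\<^sup>2" by (simp add: power_mult_distrib)
    qed
  qed measurable
  then have "\<forall>\<^sub>F n in sequentially. norm2 (\<lambda>x. f x - F n x) < e" using e by (simp add: order_tendstoD)
  then obtain n where "norm2 (\<lambda>x. f x - F n x) < e" by (auto simp: eventually_sequentially)
  then show "\<exists>g. approximable g \<and> norm2 (\<lambda>x. f x - g x) < e" using approximable_simple[OF F(1)] by blast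
qed

sublocale U: unimodular_system \<alpha> dual_group "\<lambda>\<gamma>. \<gamma>" total
proof
  show "0 < total" by (rule total_pos)
  show "measure \<alpha> (space \<alpha>) = total" by (simp add: total_def)
  show "\<gamma> \<in> borel_measurable \<alpha>" if "\<gamma> \<in> dual_group" for \<gamma> :: "'a \<Rightarrow> complex" using continuous_measurable[OF dual_groupD(1)[OF that]] .
  show "cmod (\<gamma> x) = 1" if "\<gamma> \<in> dual_group" for \<gamma> and x :: 'a using dual_groupD(3)[OF that] .
  show "ip \<alpha> \<gamma> \<eta> = 0" if ne: "\<gamma> \<in> dual_group" "\<eta> \<in> dual_group" "\<gamma> \<noteq> \<eta>" for \<gamma> \<eta> :: "'a \<Rightarrow> complex"
  proof -
    define h where "h = (\<lambda>x. \<gamma> x * cnj (\<eta> x))"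
    have h: "h \<in> dual_group" unfolding h_def by (intro dual_group_mult dual_group_cnj ne)
    note D = dual_groupD[OF h]
    obtain a where a: "\<gamma> a \<noteq> \<eta> a" using ne(3) by (auto simp: fun_eq_iff)
    have "h a \<noteq> 1"
    proof
      assume "h a = 1"
      then have "\<gamma> a * (cnj (\<eta> a) * \<eta> a) = \<eta> a" by (simp add: h_def mult.assoc[symmetric])
      then show False using dual_groupD(6)[OF ne(2)] a by simp
    qed
    have "(LINT x|\<alpha>. h (a + x)) = (LINT x|\<alpha>. h x)" by (rule integral_translate[OF continuous_measurable[OF D(1)]])
    then have "h a * (LINT x|\<alpha>. h x) = (LINT x|\<alpha>. h x)" by (simp add: D(2))
    then have "(LINT x|\<alpha>. h x) = 0" using \<open>h a \<noteq> 1\<close> by simp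
    then show ?thesis by (simp add: ip_def h_def)
  qed
qed

text \<open>One inequality is Bessel's. For the other, no polynomial with characters in
  \<open>J\<close> comes closer to \<open>f\<close> in squared norm than \<open>norm2 f\<close>
  minus the coefficient sum over \<open>J\<close>, and density makes that distance arbitrarily
  small.\<close>

lemma character_parseval:
  assumes f: "L2 \<alpha> f" shows "U.parseval f"
proof -
  have N: "(\<integral>\<^sup>+x. ennreal ((cmod (f x))\<^sup>2) \<partial>\<alpha>) = ennreal (norm2 f)"
    unfolding norm2_def using f by (intro nn_integral_eq_integral) (auto simp: L2_def)
  have up: "(\<integral>\<^sup>+\<gamma>. ennreal ((cmod (U.coeff f \<gamma>))\<^sup>2) \<partial>U.coeff_measure) \<le> ennreal (norm2 f)"
    by (rule U.nn_integral_coeff_le)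
      (use U.bessel[OF f] total_pos in \<open>auto simp: U.coeff_def norm2_def pos_divide_le_eq mult.commute\<close>)
  have low: "ennreal (norm2 f) \<le> (\<integral>\<^sup>+\<gamma>. ennreal ((cmod (U.coeff f \<gamma>))\<^sup>2) \<partial>U.coeff_measure) + ennreal e" if e: "0 < e" for e
  proof -
    obtain P where P: "trig P" "norm2 (\<lambda>x. f x - P x) < e" using approximable_L2[OF f] e unfolding approximable_def by blast
    obtain J a where J: "finite J" "J \<subseteq> dual_group" "P = (\<lambda>x. \<Sum>\<gamma>\<in>J. a \<gamma> * \<gamma> x)" by (rule trig_sum[OF P(1)])
    let ?S = "(\<Sum>\<gamma>\<in>J. (cmod (U.coeff f \<gamma>))\<^sup>2) / total"
    have "norm2 (\<lambda>x. f x - P x) \<ge> norm2 f - ?S"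
      using U.square_expansion[OF f J(1,2), of a] total_pos unfolding norm2_def J(3) U.coeff_def
      by (simp add: sum_nonneg)
    then have "norm2 f \<le> ?S + e" using P(2) by linarith
    then have "ennreal (norm2 f) \<le> ennreal ?S + ennreal e"
      using e total_pos by (subst ennreal_plus[symmetric]) (auto intro!: ennreal_leI divide_nonneg_pos sum_nonneg)
    also have "\<dots> \<le> (\<integral>\<^sup>+\<gamma>. ennreal ((cmod (U.coeff f \<gamma>))\<^sup>2) \<partial>U.coeff_measure) + ennreal e"
      by (intro add_right_mono U.sum_le_nn_integral_coeff J) auto
    finally show ?thesis .
  qed
  have "ennreal (norm2 f) \<le> (\<integral>\<^sup>+\<gamma>. ennreal ((cmod (U.coeff f \<gamma>))\<^sup>2) \<partial>U.coeff_measure)"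
    by (rule ennreal_le_epsilon) (use low in auto)
  with up show ?thesis unfolding U.parseval_def N by (rule antisym)
qed

end

section \<open>The compact setting\<close>

context compact_group begin

lemma emeasure_coeff_singleton: "\<gamma> \<in> dual_group \<Longrightarrow> emeasure U.coeff_measure {\<gamma>} = ennreal (1 / total)"
  by (simp add: U.coeff_measure_def)

text \<open>Every point of the dual is an atom of positive mass, so a null set contains none of
  them.\<close>

lemma AE_coeff_measure:
  assumes ae: "AE \<gamma> in U.coeff_measure. P \<gamma>" and g: "\<gamma> \<in> dual_group"
  shows "P \<gamma>"
proof (rule ccontr)
  assume "\<not> P \<gamma>"
  obtain N where N: "{\<gamma> \<in> space U.coeff_measure. \<not> P \<gamma>} \<subseteq> N" "emeasure U.coeff_measure N = 0" "N \<in> sets U.coeff_measure"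
    using ae by (rule AE_E)
  have "\<gamma> \<in> N" using N(1) g \<open>\<not> P \<gamma>\<close> by (auto simp: U.coeff_measure_def space_scale_measure)
  then have "emeasure U.coeff_measure {\<gamma>} \<le> emeasure U.coeff_measure N" using N(3) by (intro emeasure_mono) auto
  then show False using N(2) emeasure_coeff_singleton[OF g] total_pos by simp
qed

text \<open>The measure is finite, so \<open>\<psi>\<close> itself is integrable and its transform
  is given by the integral at every character.\<close>

lemma fourier_coefficients:
  assumes \<psi>: "L2 \<alpha> \<psi>" and F: "is_fourier_L2 \<alpha> U.coeff_measure \<psi> \<Psi>" and g: "\<gamma> \<in> dual_group"
  shows "\<Psi> \<gamma> = U.coeff \<psi> \<gamma>"
proof -
  have "fourier_L1 \<alpha> \<psi> \<in> borel_measurable U.coeff_measure"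
    unfolding U.coeff_measure_def by (auto simp: measurable_def space_scale_measure)
  then have "AE \<gamma> in U.coeff_measure. \<Psi> \<gamma> = fourier_L1 \<alpha> \<psi> \<gamma>"
    by (rule fourier_L2_eq_AE[OF F L2_integrable[OF \<psi>] \<psi>])
  then have "\<Psi> \<gamma> = fourier_L1 \<alpha> \<psi> \<gamma>" using g by (rule AE_coeff_measure)
  then show ?thesis by (simp add: fourier_L1_def U.coeff_def ip_def)
qed

lemma compact_inequality:
  assumes \<psi>: "L2 \<alpha> \<psi>" "(\<integral>\<^sup>+x. ennreal ((cmod (\<psi> x))^2) \<partial>\<alpha>) = 1"
    and F: "is_fourier_L2 \<alpha> U.coeff_measure \<psi> \<Psi>" and pq: "0 < p" "0 < q" "1/p + 1/q \<ge> 1"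
    and def: "lhs_defined \<alpha> U.coeff_measure \<psi> \<Psi> p q"
  shows "0 \<le> uncertainty_lhs \<alpha> U.coeff_measure \<psi> \<Psi> p q"
proof -
  have eq: "renyi_entropy U.coeff_measure (\<lambda>\<gamma>. (cmod (\<Psi> \<gamma>))\<^sup>2) s = renyi_entropy U.coeff_measure (\<lambda>\<gamma>. (cmod (U.coeff \<psi> \<gamma>))\<^sup>2) s" for s
    by (rule renyi_entropy_cong) (simp add: U.coeff_measure_def space_scale_measure fourier_coefficients[OF \<psi>(1) F])
  show ?thesis
    using U.coeff_entropy_sum[OF \<psi>(1) character_parseval[OF \<psi>(1)] \<psi>(2) pq] lhs_defined_uncertainty[OF def]
    unfolding uncertainty_lhs_def eq by blast
qed

text \<open>By orthogonality the transform is concentrated at \<open>\<gamma>\<close> with squared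
  modulus \<open>total\<close>, an atom of mass \<open>1 / total\<close>, while the density on the
  group is uniform.\<close>

lemma compact_sharp:
  assumes g: "\<gamma> \<in> dual_group"
    and F: "is_fourier_L2 \<alpha> U.coeff_measure (\<lambda>x. \<gamma> x / complex_of_real (sqrt total)) \<Psi>"
  shows "lhs_defined \<alpha> U.coeff_measure (\<lambda>x. \<gamma> x / complex_of_real (sqrt total)) \<Psi> p q"
    "uncertainty_lhs \<alpha> U.coeff_measure (\<lambda>x. \<gamma> x / complex_of_real (sqrt total)) \<Psi> p q = 0"
proof -
  define \<psi> where "\<psi> = (\<lambda>x. \<gamma> x / complex_of_real (sqrt total))"
  note D = dual_groupD[OF g]
  have \<psi>': "\<psi> = (\<lambda>x. 1 / complex_of_real (sqrt total) * \<gamma> x)" by (simp add: \<psi>_def fun_eq_iff)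
  have gL: "L2 \<alpha> \<gamma>" using D(1) by (rule continuous_L2)
  have L: "L2 \<alpha> \<psi>" unfolding \<psi>' by (rule L2_cmult[OF gL])
  have F': "is_fourier_L2 \<alpha> U.coeff_measure \<psi> \<Psi>" using F by (simp add: \<psi>_def)
  have sq: "(cmod (\<psi> x))\<^sup>2 = (if x \<in> UNIV then 1 / total else 0)" for x
    using D(3)[of x] total_pos by (simp add: \<psi>_def norm_divide power_divide)
  have \<Psi>: "(cmod (\<Psi> \<eta>))\<^sup>2 = (if \<eta> \<in> {\<gamma>} then total else 0)" if h: "\<eta> \<in> space U.coeff_measure" for \<eta>
  proof -
    have h: "\<eta> \<in> dual_group" using h by (simp add: U.coeff_measure_def space_scale_measure)
    have "\<Psi> \<eta> = 1 / complex_of_real (sqrt total) * ip \<alpha> \<gamma> \<eta>"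
      unfolding fourier_coefficients[OF L F' h] U.coeff_def \<psi>' 
      by (rule ip_simps(5)[OF gL gL continuous_L2[OF dual_groupD(1)[OF h]]])
    then show ?thesis
      using U.phi_ip[OF g h] total_pos by (auto simp: norm_mult norm_divide power_divide power_mult_distrib power2_eq_square)
  qed
  have "UNIV \<in> sets \<alpha>" "{\<gamma>} \<in> sets U.coeff_measure" using g sets_haar by (auto simp: U.coeff_measure_def)
  then have "lhs_defined \<alpha> U.coeff_measure \<psi> \<Psi> p q" "uncertainty_lhs \<alpha> U.coeff_measure \<psi> \<Psi> p q = 0"
    using uncertainty_const[OF _ emeasure_total _ emeasure_coeff_singleton[OF g] total_pos AE_I2[OF sq] AE_I2[OF \<Psi>]] by auto
  then show "lhs_defined \<alpha> U.coeff_measure (\<lambda>x. \<gamma> x / complex_of_real (sqrt total)) \<Psi> p q"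
    "uncertainty_lhs \<alpha> U.coeff_measure (\<lambda>x. \<gamma> x / complex_of_real (sqrt total)) \<Psi> p q = 0"
    unfolding \<psi>_def by auto
qed

end

lemma compact_setting_group:
  fixes \<alpha> :: "'a::{ab_group_add, t2_space} measure"
  assumes "continuous_on UNIV (\<lambda>z::'a \<times> 'a. fst z + snd z)" "continuous_on UNIV (uminus :: 'a \<Rightarrow> 'a)"
    and setting: "compact_setting \<alpha> \<alpha>h"
  shows "compact_group \<alpha>" "unimodular_system.coeff_measure dual_group (measure \<alpha> UNIV) = \<alpha>h"
proof -
  show "compact_group \<alpha>" using assms by (simp add: compact_setting_def compact_group_def)
  then interpret compact_group \<alpha> .
  have "inverse (emeasure \<alpha> UNIV) = ennreal (1 / total)"
    unfolding emeasure_total using total_pos by (simp add: inverse_ennreal inverse_eq_divide)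
  then show "unimodular_system.coeff_measure dual_group (measure \<alpha> UNIV) = \<alpha>h"
    using setting by (simp add: U.coeff_measure_def[unfolded total_def] compact_setting_def total_def)
qed

theorem theorem5p3:
  fixes \<alpha> :: "'a::{ab_group_add, t2_space} measure" and \<alpha>h :: "('a \<Rightarrow> complex) measure"
  assumes cont_add: "continuous_on UNIV (\<lambda>z::'a \<times> 'a. fst z + snd z)"
      and cont_minus: "continuous_on UNIV (uminus :: 'a \<Rightarrow> 'a)"
      and setting: "compact_setting \<alpha> \<alpha>h \<or> discrete_setting \<alpha> \<alpha>h"
  shows "(\<forall>\<psi> \<Psi> p q. L2 \<alpha> \<psi> \<and> (\<integral>\<^sup>+x. ennreal ((cmod (\<psi> x))^2) \<partial>\<alpha>) = 1 \<and>
            is_fourier_L2 \<alpha> \<alpha>h \<psi> \<Psi> \<and> 0 < p \<and> 0 < q \<and> 1/p + 1/q \<ge> 1 \<and>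
            lhs_defined \<alpha> \<alpha>h \<psi> \<Psi> p q
            \<longrightarrow> uncertainty_lhs \<alpha> \<alpha>h \<psi> \<Psi> p q \<ge> 0)
       \<and> (compact_setting \<alpha> \<alpha>h \<longrightarrow>
            (\<forall>\<gamma>\<in>dual_group. \<forall>\<Psi> p q.
               is_fourier_L2 \<alpha> \<alpha>h (\<lambda>x. \<gamma> x / complex_of_real (sqrt (measure \<alpha> UNIV))) \<Psi> \<and>
               0 < p \<and> 0 < q \<and> 1/p + 1/q \<ge> 1 \<longrightarrow>
               lhs_defined \<alpha> \<alpha>h (\<lambda>x. \<gamma> x / complex_of_real (sqrt (measure \<alpha> UNIV))) \<Psi> p q \<and>
               uncertainty_lhs \<alpha> \<alpha>h (\<lambda>x. \<gamma> x / complex_of_real (sqrt (measure \<alpha> UNIV))) \<Psi> p q = 0))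
       \<and> (discrete_setting \<alpha> \<alpha>h \<longrightarrow>
            (\<forall>x0 \<Psi> p q.
               is_fourier_L2 \<alpha> \<alpha>h (\<lambda>x. indicator {x0} x / complex_of_real (sqrt (measure \<alpha> {x0}))) \<Psi> \<and>
               0 < p \<and> 0 < q \<and> 1/p + 1/q \<ge> 1 \<longrightarrow>
               lhs_defined \<alpha> \<alpha>h (\<lambda>x. indicator {x0} x / complex_of_real (sqrt (measure \<alpha> {x0}))) \<Psi> p q \<and>
               uncertainty_lhs \<alpha> \<alpha>h (\<lambda>x. indicator {x0} x / complex_of_real (sqrt (measure \<alpha> {x0}))) \<Psi> p q = 0))"
proof (intro conjI impI allI ballI; (elim conjE)?)
  fix \<psi> :: "'a \<Rightarrow> complex" and \<Psi> :: "('a \<Rightarrow> complex) \<Rightarrow> complex" and p q :: real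
  assume h: "L2 \<alpha> \<psi>" "(\<integral>\<^sup>+x. ennreal ((cmod (\<psi> x))^2) \<partial>\<alpha>) = 1" "is_fourier_L2 \<alpha> \<alpha>h \<psi> \<Psi>"
    "0 < p" "0 < q" "1/p + 1/q \<ge> 1" "lhs_defined \<alpha> \<alpha>h \<psi> \<Psi> p q"
  from setting show "uncertainty_lhs \<alpha> \<alpha>h \<psi> \<Psi> p q \<ge> 0"
  proof
    assume s: "compact_setting \<alpha> \<alpha>h"
    interpret compact_group \<alpha> by (rule compact_setting_group(1)[OF cont_add cont_minus s])
    have "U.coeff_measure = \<alpha>h" using compact_setting_group(2)[OF cont_add cont_minus s] by (simp add: total_def)
    then show ?thesis using compact_inequality[OF h(1,2) _ h(4-6), of \<Psi>] h(3,7) by simp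
  qed (use discrete_inequality[OF _ h(2-7)] in auto)
next
  fix \<gamma> :: "'a \<Rightarrow> complex" and \<Psi> :: "('a \<Rightarrow> complex) \<Rightarrow> complex" and p q :: real
  assume s: "compact_setting \<alpha> \<alpha>h" and g: "\<gamma> \<in> dual_group"
    and F: "is_fourier_L2 \<alpha> \<alpha>h (\<lambda>x. \<gamma> x / complex_of_real (sqrt (measure \<alpha> UNIV))) \<Psi>"
  interpret compact_group \<alpha> by (rule compact_setting_group(1)[OF cont_add cont_minus s])
  have c: "U.coeff_measure = \<alpha>h" using compact_setting_group(2)[OF cont_add cont_minus s] by (simp add: total_def)
  show "lhs_defined \<alpha> \<alpha>h (\<lambda>x. \<gamma> x / complex_of_real (sqrt (measure \<alpha> UNIV))) \<Psi> p q"
    "uncertainty_lhs \<alpha> \<alpha>h (\<lambda>x. \<gamma> x / complex_of_real (sqrt (measure \<alpha> UNIV))) \<Psi> p q = 0"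
    using compact_sharp[OF g, unfolded c, unfolded total_def, OF F] by auto
next
  fix x0 :: 'a and \<Psi> :: "('a \<Rightarrow> complex) \<Rightarrow> complex" and p q :: real
  assume s: "discrete_setting \<alpha> \<alpha>h"
    and F: "is_fourier_L2 \<alpha> \<alpha>h (\<lambda>x. indicator {x0} x / complex_of_real (sqrt (measure \<alpha> {x0}))) \<Psi>"
  show "lhs_defined \<alpha> \<alpha>h (\<lambda>x. indicator {x0} x / complex_of_real (sqrt (measure \<alpha> {x0}))) \<Psi> p q"
    "uncertainty_lhs \<alpha> \<alpha>h (\<lambda>x. indicator {x0} x / complex_of_real (sqrt (measure \<alpha> {x0}))) \<Psi> p q = 0"
    by (rule discrete_sharp[OF s F])+
qed

end
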